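(* Let $T(t)$, $t\ge 0$, be the strongly continuous, positive, contraction semigroup on $C_0(E)$ whose generator is (the closure of) the operator $L$ with core $D$ described in the context, and let $T_\varepsilon$ be the linear operator on $l_0^\infty(E_\varepsilon)$ given by $(T_\varepsilon f)(x,k(x))=\sum_{y\in\varepsilon\mathbb Z^d}p_\varepsilon(x,y)f(y,k(y))$. Then for every $F\in C_0(E)$ and every $t\ge 0$, $$\left\|T_\varepsilon^{[t/\varepsilon^2]}\pi_\varepsilon F-\pi_\varepsilon T(t)F\right\|_{l_0^\infty(E_\varepsilon)}=\sup_{x\in\varepsilon\mathbb Z^d}\left|T_\varepsilon^{[t/\varepsilon^2]}\pi_\varepsilon F(x,k(x))-\pi_\varepsilon T(t)F(x,k(x))\right|\to 0\quad\text{as }\varepsilon\to 0 .$$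
   Context: Setting. Let $d\ge 1$, let $\Gamma=\ell_1\mathbb Z\times\dots\times\ell_d\mathbb Z$ be the period lattice ($\ell_i\in\mathbb N$, $\ell_i\geq 1$) and $\mathbb T^d=\mathbb Z^d/\Gamma$ the discrete torus (periodicity cell). "Periodic" means $\Gamma$-periodic. For all sufficiently small $\varepsilon>0$ let $P^{(\varepsilon)}=P^0+\varepsilon^2V$, where $P^0=\{p_0(x,y)\}$ and $V=\{v(x,y)\}$, $x,y\in\mathbb Z^d$, are fixed (independent of $\varepsilon$) real matrices. Write $p(x,y)=p^{(\varepsilon)}(x,y)$ for the entries of $P^{(\varepsilon)}$. Assumptions on $P^{(\varepsilon)}$: $p(x,y)\ge 0$, $p(x,y)=p(y,x)$, $\sum_yp(x,y)=1$ for all $x$; for every $\xi\in\mathbb Z^d$ the function $x\mapsto p(x,x+\xi)$ is periodic; there is $c_1>0$ (independent of $\varepsilon$) with $p(x,x+\xi)=0$ if $|\xi|>c_1$; the random walk with transition probabilities $p$ is irreducible on $\mathbb Z^d$. (The entries of $P^0$ and $V$ are likewise periodic, symmetric and of finite range.) The torus is split as $\mathbb T^d=A\cup B$, $A\cap B=\emptyset$, $A,B\ne\emptyset$; $A=\{x_1,\dots,x_M\}$. $A^\sharp,B^\sharp,\{x_j\}^\sharp\subset\mathbb Z^d$ denote periodic extensions. Two points $x',x''$ are connected if there is a path $x'=x^1,\dots,x^n=x''$ with $p_0(x^j,x^{j+1})>0$ for all $j$. $B$ is connected and $B^\sharp$ is unbounded and connected. Further: $p_0(x,y)\ge0$, $p_0(x,y)=p_0(y,x)$,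 $\sum_yp_0(x,y)=1$; $p_0(x,x)=1$ for $x\in A^\sharp$; $p_0(x,y)=0$ for $x,y\in A^\sharp$, $x\ne y$; $p_0(x,y)=0$ for $x\in B^\sharp$, $y\in A^\sharp$; $\sum_yv(x,y)=0$ for all $x$. Rescaled process space. $p_\varepsilon(x,y)=p(x/\varepsilon,y/\varepsilon)$ for $x,y\in\varepsilon\mathbb Z^d$. For $x\in\varepsilon\mathbb Z^d$ let $k(x)=0$ if $x\in\varepsilon B^\sharp$ and $k(x)=j$ if $x\in\varepsilon\{x_j\}^\sharp$, $j=1,\dots,M$. $E_\varepsilon=\{(x,k(x)):x\in\varepsilon\mathbb Z^d\}$; $l_0^\infty(E_\varepsilon)$ is the Banach space of functions on $E_\varepsilon$ vanishing as $|x|\to\infty$, with the sup norm. Limit space and operator. $E=\mathbb R^d\times\{0,1,\dots,M\}$; $C_0(E)$ is the space of continuous functions vanishing at infinity, $F=(f_0,\dots,f_M)$ with $f_k=F(\cdot,k)\in C_0(\mathbb R^d)$, with norm $\max_k\|f_k\|_{C_0(\mathbb R^d)}$. The map $\pi_\varepsilon:C_0(E)\to l_0^\infty(E_\varepsilon)$ is $(\pi_\varepsilon F)(x,k(x))=f_{k(x)}(x)$. The core is $D=\{(f_0,\dots,f_M): f_0\in C_0^\infty(\mathbb R^d),\ f_j\in C_0(\mathbb R^d),\ j=1,\dots,M\}$ ($C_0^\infty$: smooth with compact support), and for $F\in D$ $$(LF)(x,k)=\mathbf 1_{\{k=0\}}\,\Theta\cdot\nabla\nabla f_0(x)+\lambda(k)\sum_{j\ne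 k}\mu_{kj}(f_j(x)-f_k(x)),$$ where $\Theta\cdot\nabla\nabla f=\sum_{i,m}\Theta_{im}\partial_i\partial_mf$, $\lambda(k)=\sum_{j\neq k}\alpha_{kj}$, $\mu_{kj}=\alpha_{kj}/\lambda(k)$ (indices in $\{0,\dots,M\}$; $\lambda(k)>0$). Here, with $\bar v(y,y')=\sum_{\gamma\in\Gamma}v(y,y'+\gamma)$ the periodized kernel on $\mathbb T^d\times\mathbb T^d$, $$\alpha_{0j}=\frac1{|B|}\sum_{y\in B}\bar v(y,x_j),\quad \alpha_{j0}=\sum_{y\in B}\bar v(x_j,y),\quad \alpha_{kj}=\bar v(x_k,x_j)\quad (j,k=1,\dots,M,\ j\ne k).$$ The (positive definite) matrix $\Theta$ is $$\Theta=\frac1{|B|}\sum_{y\in B}\sum_{\xi}p_0(y,y+\xi)\,\xi\otimes\Big(\tfrac12\xi+h(y+\xi)\Big),$$ where the sum is over $\xi\in\mathbb Z^d$ with $p_0(y,y+\xi)\ne0$ and $h:B^\sharp\to\mathbb R^d$ is a periodic solution, unique up to an additive constant, of $\sum_\xi p_0(y,y+\xi)\big(\xi+h(y+\xi)-h(y)\big)=0$, $y\in B^\sharp$. The closure of $(L,D)$ generates a strongly continuous, positive, contraction (Feller) semigroup on $C_0(E)$. *)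

theory Defs
  imports "HOL-Analysis.Analysis"
begin

type_synonym 'd kernel = "int ^ 'd \<Rightarrow> int ^ 'd \<Rightarrow> real"

definition ivec :: "int ^ 'd \<Rightarrow> real ^ 'd" where
  "ivec z = (\<chi> i. real_of_int (z $ i))"

definition period_lattice :: "('d::finite \<Rightarrow> nat) \<Rightarrow> (int ^ 'd) set" where
  "period_lattice ell = {\<gamma>. \<forall>i. int (ell i) dvd \<gamma> $ i}"

text \<open>Points of the quotient of the lattice by the periods are represented by their unique
  representatives in the box below.\<close>

definition torus :: "('d::finite \<Rightarrow> nat) \<Rightarrow> (int ^ 'd) set" where
  "torus ell = {z. \<forall>i. 0 \<le> z $ i \<and> z $ i < int (ell i)}"

definition periodic_ext :: "('d::finite \<Rightarrow> nat) \<Rightarrow> (int ^ 'd) set \<Rightarrow> (int ^ 'd) set" where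
  "periodic_ext ell S = {z + \<gamma> | z \<gamma>. z \<in> S \<and> \<gamma> \<in> period_lattice ell}"

definition periodic_kernel :: "('d::finite \<Rightarrow> nat) \<Rightarrow> 'd kernel \<Rightarrow> bool" where
  "periodic_kernel ell q \<longleftrightarrow> (\<forall>\<xi> x. \<forall>\<gamma>\<in>period_lattice ell. q (x + \<gamma>) (x + \<gamma> + \<xi>) = q x (x + \<xi>))"

definition symmetric_kernel :: "'d::finite kernel \<Rightarrow> bool" where
  "symmetric_kernel q \<longleftrightarrow> (\<forall>x y. q x y = q y x)"

definition finite_range :: "real \<Rightarrow> 'd::finite kernel \<Rightarrow> bool" where
  "finite_range c q \<longleftrightarrow> (\<forall>x \<xi>. norm (ivec \<xi>) > c \<longrightarrow> q x (x + \<xi>) = 0)"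

definition stochastic_kernel :: "'d::finite kernel \<Rightarrow> bool" where
  "stochastic_kernel q \<longleftrightarrow> (\<forall>x y. 0 \<le> q x y) \<and> (\<forall>x. (q x has_sum 1) UNIV)"

definition connected_by :: "'d::finite kernel \<Rightarrow> int ^ 'd \<Rightarrow> int ^ 'd \<Rightarrow> bool" where
  "connected_by q x y \<longleftrightarrow> (x, y) \<in> {(u, w). q u w > 0}\<^sup>*"

definition connected_on_torus ::
    "('d::finite \<Rightarrow> nat) \<Rightarrow> 'd kernel \<Rightarrow> int ^ 'd \<Rightarrow> int ^ 'd \<Rightarrow> bool" where
  "connected_on_torus ell q x y \<longleftrightarrow>
     (x, y) \<in> {(u, w). u \<in> torus ell \<and> w \<in> torus ell \<and> (\<exists>\<gamma>\<in>period_lattice ell. q u (w + \<gamma>) > 0)}\<^sup>*"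

definition periodized :: "('d::finite \<Rightarrow> nat) \<Rightarrow> 'd kernel \<Rightarrow> 'd kernel" where
  "periodized ell q y y' = (\<Sum>\<^sub>\<infinity>\<gamma>\<in>period_lattice ell. q y (y' + \<gamma>))"

definition perturbed :: "'d::finite kernel \<Rightarrow> 'd kernel \<Rightarrow> real \<Rightarrow> 'd kernel" where
  "perturbed P0 V \<epsilon> x y = P0 x y + \<epsilon>\<^sup>2 * V x y"

definition scaled :: "real \<Rightarrow> (int ^ 'd) set \<Rightarrow> (real ^ 'd) set" where
  "scaled \<epsilon> S = (\<lambda>z. \<epsilon> *\<^sub>R ivec z) ` S"

text \<open>At a point of the scaled lattice the quotients below are integers, so that the floor
  only changes the type.\<close>

definition unscale :: "real \<Rightarrow> real ^ 'd \<Rightarrow> int ^ 'd" where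
  "unscale \<epsilon> x = (\<chi> i. \<lfloor>x $ i / \<epsilon>\<rfloor>)"

definition phase ::
    "('d::finite \<Rightarrow> nat) \<Rightarrow> (int ^ 'd) set \<Rightarrow> nat \<Rightarrow> (nat \<Rightarrow> int ^ 'd) \<Rightarrow> real \<Rightarrow> real ^ 'd \<Rightarrow> nat" where
  "phase ell B M xs \<epsilon> x =
     (if x \<in> scaled \<epsilon> (periodic_ext ell B) then 0
      else (THE j. j \<in> {1..M} \<and> x \<in> scaled \<epsilon> (periodic_ext ell {xs j})))"

definition ext_space ::
    "('d::finite \<Rightarrow> nat) \<Rightarrow> (int ^ 'd) set \<Rightarrow> nat \<Rightarrow> (nat \<Rightarrow> int ^ 'd) \<Rightarrow> real \<Rightarrow> ((real ^ 'd) \<times> nat) set" where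
  "ext_space ell B M xs \<epsilon> = {(x, phase ell B M xs \<epsilon> x) | x. x \<in> scaled \<epsilon> UNIV}"

text \<open>Functions on \<^term>\<open>ext_space ell B M xs \<epsilon>\<close> are represented by functions on the whole
  product that are zero outside of it.\<close>

definition transition_op ::
    "('d::finite \<Rightarrow> nat) \<Rightarrow> 'd kernel \<Rightarrow> 'd kernel \<Rightarrow> (int ^ 'd) set \<Rightarrow> nat \<Rightarrow> (nat \<Rightarrow> int ^ 'd) \<Rightarrow> real
      \<Rightarrow> ((real ^ 'd) \<times> nat \<Rightarrow> real) \<Rightarrow> ((real ^ 'd) \<times> nat \<Rightarrow> real)" where
  "transition_op ell P0 V B M xs \<epsilon> f = (\<lambda>(x, k).
     if (x, k) \<in> ext_space ell B M xs \<epsilon>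
     then \<Sum>\<^sub>\<infinity>y\<in>scaled \<epsilon> UNIV.
            perturbed P0 V \<epsilon> (unscale \<epsilon> x) (unscale \<epsilon> y) * f (y, phase ell B M xs \<epsilon> y)
     else 0)"

text \<open>This is the sup norm for functions that are bounded on the set. The functions to which it
  is applied are bounded as soon as the perturbed kernel is stochastic, i.e. for small \<open>\<epsilon>\<close>.\<close>

definition sup_norm_on :: "'a set \<Rightarrow> ('a \<Rightarrow> real) \<Rightarrow> real" where
  "sup_norm_on S f = (SUP e\<in>S. \<bar>f e\<bar>)"

text \<open>\<open>C0E M\<close> is the space of continuous functions vanishing at infinity on
  \<open>(real ^ 'd) \<times> {0..M}\<close>, extended by zero to \<open>(real ^ 'd) \<times> nat\<close>; the norm inherited from
  bounded continuous functions is the maximum of the sup norms of the \<open>M + 1\<close> components.\<close>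

definition C0E :: "nat \<Rightarrow> (((real ^ 'd::finite) \<times> nat) \<Rightarrow>\<^sub>C real) set" where
  "C0E M = {F. (\<forall>k\<le>M. ((\<lambda>x. apply_bcontfun F (x, k)) \<longlongrightarrow> 0) at_infinity) \<and>
               (\<forall>k>M. \<forall>x. apply_bcontfun F (x, k) = 0)}"

definition proj_eps ::
    "('d::finite \<Rightarrow> nat) \<Rightarrow> (int ^ 'd) set \<Rightarrow> nat \<Rightarrow> (nat \<Rightarrow> int ^ 'd) \<Rightarrow> real
      \<Rightarrow> (((real ^ 'd) \<times> nat) \<Rightarrow>\<^sub>C real) \<Rightarrow> ((real ^ 'd) \<times> nat \<Rightarrow> real)" where
  "proj_eps ell B M xs \<epsilon> F = (\<lambda>e. if e \<in> ext_space ell B M xs \<epsilon> then apply_bcontfun F e else 0)"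

definition partial_deriv :: "'d \<Rightarrow> (real ^ 'd::finite \<Rightarrow> real) \<Rightarrow> (real ^ 'd \<Rightarrow> real)" where
  "partial_deriv i f x = frechet_derivative f (at x) (axis i 1)"

primrec times_cont_diff :: "nat \<Rightarrow> (real ^ 'd::finite \<Rightarrow> real) \<Rightarrow> bool" where
  "times_cont_diff 0 f \<longleftrightarrow> continuous_on UNIV f"
| "times_cont_diff (Suc n) f \<longleftrightarrow>
     f differentiable_on UNIV \<and> (\<forall>i. times_cont_diff n (partial_deriv i f))"

definition smooth_compact_support :: "(real ^ 'd::finite \<Rightarrow> real) \<Rightarrow> bool" where
  "smooth_compact_support f \<longleftrightarrow> (\<forall>n. times_cont_diff n f) \<and> compact (closure {x. f x \<noteq> 0})"

definition core :: "nat \<Rightarrow> (((real ^ 'd::finite) \<times> nat) \<Rightarrow>\<^sub>C real) set" where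
  "core M = {F \<in> C0E M. smooth_compact_support (\<lambda>x. apply_bcontfun F (x, 0))}"

definition periodic_corrector ::
    "('d::finite \<Rightarrow> nat) \<Rightarrow> 'd kernel \<Rightarrow> (int ^ 'd) set \<Rightarrow> (int ^ 'd \<Rightarrow> real ^ 'd) \<Rightarrow> bool" where
  "periodic_corrector ell P0 B h \<longleftrightarrow>
     (\<forall>y\<in>periodic_ext ell B. \<forall>\<gamma>\<in>period_lattice ell. h (y + \<gamma>) = h y) \<and>
     (\<forall>y\<in>periodic_ext ell B.
        (\<Sum>\<xi> | P0 y (y + \<xi>) \<noteq> 0. P0 y (y + \<xi>) *\<^sub>R (ivec \<xi> + h (y + \<xi>) - h y)) = 0)"

definition eff_matrix ::
    "'d::finite kernel \<Rightarrow> (int ^ 'd) set \<Rightarrow> (int ^ 'd \<Rightarrow> real ^ 'd) \<Rightarrow> real ^ 'd ^ 'd" where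
  "eff_matrix P0 B h = (\<chi> i m. 1 / real (card B) *
     (\<Sum>y\<in>B. \<Sum>\<xi> | P0 y (y + \<xi>) \<noteq> 0.
        P0 y (y + \<xi>) * (ivec \<xi> $ i * ((1/2) *\<^sub>R ivec \<xi> + h (y + \<xi>)) $ m)))"

text \<open>Only the values for \<open>k \<noteq> j\<close> are meaningful.\<close>

definition jump_coeff ::
    "('d::finite \<Rightarrow> nat) \<Rightarrow> 'd kernel \<Rightarrow> (int ^ 'd) set \<Rightarrow> (nat \<Rightarrow> int ^ 'd) \<Rightarrow> nat \<Rightarrow> nat \<Rightarrow> real" where
  "jump_coeff ell V B xs k j =
     (if k = 0 then 1 / real (card B) * (\<Sum>y\<in>B. periodized ell V y (xs j))
      else if j = 0 then \<Sum>y\<in>B. periodized ell V (xs k) y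
      else periodized ell V (xs k) (xs j))"

definition jump_intensity ::
    "('d::finite \<Rightarrow> nat) \<Rightarrow> 'd kernel \<Rightarrow> (int ^ 'd) set \<Rightarrow> nat \<Rightarrow> (nat \<Rightarrow> int ^ 'd) \<Rightarrow> nat \<Rightarrow> real" where
  "jump_intensity ell V B M xs k = (\<Sum>j\<in>{0..M} - {k}. jump_coeff ell V B xs k j)"

definition jump_prob ::
    "('d::finite \<Rightarrow> nat) \<Rightarrow> 'd kernel \<Rightarrow> (int ^ 'd) set \<Rightarrow> nat \<Rightarrow> (nat \<Rightarrow> int ^ 'd) \<Rightarrow> nat \<Rightarrow> nat \<Rightarrow> real" where
  "jump_prob ell V B M xs k j = jump_coeff ell V B xs k j / jump_intensity ell V B M xs k"

definition limit_expr ::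
    "('d::finite \<Rightarrow> nat) \<Rightarrow> 'd kernel \<Rightarrow> 'd kernel \<Rightarrow> (int ^ 'd) set \<Rightarrow> nat \<Rightarrow> (nat \<Rightarrow> int ^ 'd)
      \<Rightarrow> (int ^ 'd \<Rightarrow> real ^ 'd) \<Rightarrow> ((real ^ 'd) \<times> nat \<Rightarrow> real) \<Rightarrow> ((real ^ 'd) \<times> nat \<Rightarrow> real)" where
  "limit_expr ell P0 V B M xs h F = (\<lambda>(x, k).
     (if k = 0
      then \<Sum>i\<in>UNIV. \<Sum>m\<in>UNIV. eff_matrix P0 B h $ i $ m *
             partial_deriv i (partial_deriv m (\<lambda>x. F (x, 0))) x
      else 0) +
     jump_intensity ell V B M xs k *
       (\<Sum>j\<in>{0..M} - {k}. jump_prob ell V B M xs k j * (F (x, j) - F (x, k))))"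

text \<open>Unbounded operators are represented by their graphs.\<close>

definition limit_op ::
    "('d::finite \<Rightarrow> nat) \<Rightarrow> 'd kernel \<Rightarrow> 'd kernel \<Rightarrow> (int ^ 'd) set \<Rightarrow> nat \<Rightarrow> (nat \<Rightarrow> int ^ 'd)
      \<Rightarrow> (int ^ 'd \<Rightarrow> real ^ 'd)
      \<Rightarrow> ((((real ^ 'd) \<times> nat) \<Rightarrow>\<^sub>C real) \<times> (((real ^ 'd) \<times> nat) \<Rightarrow>\<^sub>C real)) set" where
  "limit_op ell P0 V B M xs h = {(F, G). F \<in> core M \<and> G \<in> C0E M \<and>
     (\<forall>x. \<forall>k\<le>M. apply_bcontfun G (x, k) =
        limit_expr ell P0 V B M xs h (apply_bcontfun F) (x, k))}"

text \<open>The space \<open>X\<close> below is meant to be a closed linear subspace of the type.\<close>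

definition contraction_semigroup_on :: "'a::real_normed_vector set \<Rightarrow> (real \<Rightarrow> 'a \<Rightarrow> 'a) \<Rightarrow> bool" where
  "contraction_semigroup_on X T \<longleftrightarrow>
     (\<forall>t\<ge>0. \<forall>f\<in>X. T t f \<in> X) \<and>
     (\<forall>t\<ge>0. \<forall>f\<in>X. \<forall>g\<in>X. T t (f + g) = T t f + T t g) \<and>
     (\<forall>t\<ge>0. \<forall>f\<in>X. \<forall>c. T t (c *\<^sub>R f) = c *\<^sub>R T t f) \<and>
     (\<forall>f\<in>X. T 0 f = f) \<and>
     (\<forall>s\<ge>0. \<forall>t\<ge>0. \<forall>f\<in>X. T (s + t) f = T s (T t f)) \<and>
     (\<forall>f\<in>X. ((\<lambda>t. T t f) \<longlongrightarrow> f) (at_right 0)) \<and>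
     (\<forall>t\<ge>0. \<forall>f\<in>X. norm (T t f) \<le> norm f)"

definition positive_on ::
    "('a::topological_space \<Rightarrow>\<^sub>C real) set \<Rightarrow> (real \<Rightarrow> ('a \<Rightarrow>\<^sub>C real) \<Rightarrow> ('a \<Rightarrow>\<^sub>C real)) \<Rightarrow> bool" where
  "positive_on X T \<longleftrightarrow> (\<forall>t\<ge>0. \<forall>F\<in>X. (\<forall>e. 0 \<le> apply_bcontfun F e) \<longrightarrow>
     (\<forall>e. 0 \<le> apply_bcontfun (T t F) e))"

definition generator_on ::
    "'a::real_normed_vector set \<Rightarrow> (real \<Rightarrow> 'a \<Rightarrow> 'a) \<Rightarrow> ('a \<times> 'a) set" where
  "generator_on X T = {(f, g). f \<in> X \<and> g \<in> X \<and>
     ((\<lambda>t. (1 / t) *\<^sub>R (T t f - f)) \<longlongrightarrow> g) (at_right 0)}"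

locale high_contrast_walk =
  fixes ell :: "'d::finite \<Rightarrow> nat"
    and P0 V :: "'d kernel"
    and c1 :: real
    and A B :: "(int ^ 'd) set"
    and M :: nat
    and xs :: "nat \<Rightarrow> int ^ 'd"
  assumes periods_pos: "\<And>i. ell i \<ge> 1"
    and range_pos: "c1 > 0"
    and P0_periodic: "periodic_kernel ell P0"
    and P0_symmetric: "symmetric_kernel P0"
    and P0_range: "finite_range c1 P0"
    and P0_stochastic: "stochastic_kernel P0"
    and V_periodic: "periodic_kernel ell V"
    and V_symmetric: "symmetric_kernel V"
    and V_range: "finite_range c1 V"
    and V_sum: "\<And>x. (V x has_sum 0) UNIV"
    and perturbed_walk: "\<forall>\<^sub>F \<epsilon> in at_right 0.
          stochastic_kernel (perturbed P0 V \<epsilon>) \<and>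
          symmetric_kernel (perturbed P0 V \<epsilon>) \<and>
          periodic_kernel ell (perturbed P0 V \<epsilon>) \<and>
          finite_range c1 (perturbed P0 V \<epsilon>) \<and>
          (\<forall>x y. connected_by (perturbed P0 V \<epsilon>) x y)"
    and torus_split: "A \<union> B = torus ell" "A \<inter> B = {}" "A \<noteq> {}" "B \<noteq> {}"
    and A_enum: "bij_betw xs {1..M} A"
    and B_connected: "\<And>x y. x \<in> B \<Longrightarrow> y \<in> B \<Longrightarrow> connected_on_torus ell P0 x y"
    and B_ext_unbounded: "\<not> bounded (ivec ` periodic_ext ell B)"
    and B_ext_connected: "\<And>x y. x \<in> periodic_ext ell B \<Longrightarrow> y \<in> periodic_ext ell B \<Longrightarrow> connected_by P0 x y"
    and P0_A_diag: "\<And>x. x \<in> periodic_ext ell A \<Longrightarrow> P0 x x = 1"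
    and P0_A_off: "\<And>x y. x \<in> periodic_ext ell A \<Longrightarrow> y \<in> periodic_ext ell A \<Longrightarrow> x \<noteq> y \<Longrightarrow> P0 x y = 0"
    and P0_B_A: "\<And>x y. x \<in> periodic_ext ell B \<Longrightarrow> y \<in> periodic_ext ell A \<Longrightarrow> P0 x y = 0"

end

theory Submission
  imports Defs
begin

text \<open>Kurtz's scheme: if for \<open>(F, G)\<close> in the graph of the limit operator there are lattice functions
  \<open>u \<epsilon>\<close> with \<open>u \<epsilon> - sample \<epsilon> F \<longlonglongrightarrow> 0\<close> and \<open>(S \<epsilon> (u \<epsilon>) - u \<epsilon>) / \<epsilon>\<^sup>2 - sample \<epsilon> G \<longlonglongrightarrow> 0\<close>, where
  \<open>S \<epsilon>\<close> is the transition operator, then the discrete semigroups converge. No resolvents are needed: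
  on a short time interval \<open>\<tau>\<close> both semigroups agree with \<open>F + \<tau> G\<close> up to \<open>o(\<tau>)\<close>, uniformly along the
  orbit because the generator has dense domain, and the errors add up by contractivity.

  The functions \<open>u \<epsilon>\<close> are two-scale expansions. On the sites over \<open>x\<^sub>j\<close> take \<open>f\<^sub>j\<close>; on the sites over
  \<open>B\<close> take \<open>f\<^sub>0 + \<epsilon> h \<bullet> \<nabla>f\<^sub>0 + \<epsilon>\<^sup>2 (\<Sum> W\<^sub>i\<^sub>m \<partial>\<^sub>i\<partial>\<^sub>m f\<^sub>0 + \<Sum> Q\<^sub>j (f\<^sub>j - f\<^sub>0))\<close>. The periodic correctors \<open>W\<close>
  and \<open>Q\<close> solve Poisson equations on the connected weighted graph \<open>B\<close>, whose right hand sides have mean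
  zero precisely because \<open>\<Theta>\<close> and \<open>\<alpha>\<^sub>0\<^sub>j\<close> are the averages over \<open>B\<close>.\<close>

subsection \<open>Contraction semigroups on closed subspaces\<close>

text \<open>\<open>T\<close> is linear only on the subspace \<open>X\<close>, and the generator
  gives one-sided derivatives at time 0. Apart from one averaging argument for density, orbits are
  therefore handled by telescoping over small time steps, in the same form for \<open>T\<close> and
  for the powers of the transition operator. The generator value \<open>g\<close> of a domain
  element need not lie in the domain; a domain element \<open>f'\<close> close to \<open>g\<close>
  stands in for it, and this is the role of the recurring pair \<open>(f', g')\<close>. On the
  lattice the core grants only continuity of \<open>f\<^sub>j\<close> for j >= 1. The corrector that
  contains \<open>f\<^sub>j\<close> carries the factor \<open>\<epsilon>\<^sup>2\<close>, so after
  division by \<open>\<epsilon>\<^sup>2\<close> only its increments under shifts of order \<epsilon>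
  enter, and uniform continuity suffices; derivatives are taken of \<open>f\<^sub>0\<close> alone.
  Sites over A get no corrector: \<open>P0\<close> does not move them, and a single site per cell
  leaves nothing to average. Over B the jump rate into a phase depends on the site, and
  \<open>Q\<^sub>j\<close> trades it for its mean. Lattice functions are indexed by unscaled integer
  points, so that one Banach space serves all \<epsilon>.\<close>

locale subspace_semigroup =
  fixes X :: "'a::banach set" and T :: "real \<Rightarrow> 'a \<Rightarrow> 'a"
  assumes semigroup: "contraction_semigroup_on X T"
    and subspace_X: "subspace X"
    and closed_X: "closed X"
begin

lemma mem: "0 \<le> t \<Longrightarrow> f \<in> X \<Longrightarrow> T t f \<in> X"
  and T_add: "0 \<le> t \<Longrightarrow> f \<in> X \<Longrightarrow> g \<in> X \<Longrightarrow> T t (f + g) = T t f + T t g"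
  and T_scaleR: "0 \<le> t \<Longrightarrow> f \<in> X \<Longrightarrow> T t (c *\<^sub>R f) = c *\<^sub>R T t f"
  and T_0: "f \<in> X \<Longrightarrow> T 0 f = f"
  and T_plus: "0 \<le> s \<Longrightarrow> 0 \<le> t \<Longrightarrow> f \<in> X \<Longrightarrow> T (s + t) f = T s (T t f)"
  and T_tendsto: "f \<in> X \<Longrightarrow> ((\<lambda>t. T t f) \<longlongrightarrow> f) (at_right 0)"
  and T_contr: "0 \<le> t \<Longrightarrow> f \<in> X \<Longrightarrow> norm (T t f) \<le> norm f"
  using semigroup unfolding contraction_semigroup_on_def by auto

lemma X_diff: "f \<in> X \<Longrightarrow> g \<in> X \<Longrightarrow> f - g \<in> X"
  and X_add: "f \<in> X \<Longrightarrow> g \<in> X \<Longrightarrow> f + g \<in> X"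
  and X_scaleR: "f \<in> X \<Longrightarrow> c *\<^sub>R f \<in> X"
  and X_0: "0 \<in> X"
  using subspace_X by (auto simp: subspace_diff subspace_add subspace_scale subspace_0)

lemma T_diff:
  assumes "0 \<le> t" "f \<in> X" "g \<in> X"
  shows "T t (f - g) = T t f - T t g"
  using T_add[OF assms(1,2) X_scaleR[OF assms(3)], of "-1"] T_scaleR[OF assms(1,3), of "-1"] by simp

lemma T_sum:
  assumes "0 \<le> t" "\<And>i. i \<in> I \<Longrightarrow> f i \<in> X"
  shows "(\<Sum>i\<in>I. f i) \<in> X \<and> T t (\<Sum>i\<in>I. f i) = (\<Sum>i\<in>I. T t (f i))"
proof -
  have "T t 0 = 0" using T_scaleR[OF assms(1) X_0, of 0] by simp
  with assms show ?thesis
    by (induction I rule: infinite_finite_induct) (auto simp: T_add X_0 X_add)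
qed

lemma T_dist: "0 \<le> t \<Longrightarrow> f \<in> X \<Longrightarrow> g \<in> X \<Longrightarrow> norm (T t f - T t g) \<le> norm (f - g)"
  using T_contr[of t "f - g"] by (simp add: T_diff X_diff)

text \<open>The increment is \<open>T s\<close> applied to \<open>T (r - s) f - f\<close>, and
  \<open>T s\<close> contracts.\<close>

lemma T_increment:
  assumes "0 \<le> s" "s \<le> r" "f \<in> X"
  shows "norm (T r f - T s f) \<le> norm (T (r - s) f - f)"
  using T_plus[of s "r - s" f] T_dist[of s "T (r - s) f" f] assms by (simp add: mem)

text \<open>The bound of \<open>T_increment\<close> depends only on the distance of the two times,
  so right continuity at 0 gives continuity from both sides everywhere.\<close>

lemma continuous_T:
  assumes "f \<in> X"
  shows "continuous_on {0..} (\<lambda>t. T t f)"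
proof (unfold continuous_on_iff, intro ballI allI impI)
  fix s e :: real assume s: "s \<in> {0..}" and e: "0 < e"
  obtain d where d: "d > 0" "\<And>r. 0 < r \<Longrightarrow> r < d \<Longrightarrow> norm (T r f - f) < e"
    using tendstoD[OF T_tendsto[OF assms] e] unfolding eventually_at dist_norm
    by (auto simp: dist_real_def)
  have d': "norm (T r f - f) < e" if "0 \<le> r" "r < d" for r
    using d(2)[of r] that e T_0[OF assms] by (cases "r = 0") auto
  show "\<exists>d>0. \<forall>r\<in>{0..}. dist r s < d \<longrightarrow> dist (T r f) (T s f) < e"
  proof (intro exI[of _ d] conjI ballI impI)
    fix r assume r: "r \<in> {0..}" "dist r s < d"
    show "dist (T r f) (T s f) < e"
    proof (cases "s \<le> r")
      case True
      then show ?thesis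
        using T_increment[of s r f] d'[of "r - s"] s r assms by (auto simp: dist_norm dist_real_def)
    next
      case False
      then show ?thesis
        using T_increment[of r s f] d'[of "s - r"] s r assms
        by (auto simp: dist_norm dist_real_def norm_minus_commute)
    qed
  qed (fact d(1))
qed

text \<open>\<open>T t\<close> is bounded and linear on \<open>X\<close> only, so it is moved
  through Riemann sums: one tagged division fine for both gauges gives a sum in \<open>X\<close>
  close to \<open>I\<close> whose image is close to \<open>J\<close>. Closedness of \<open>X\<close>
  then catches \<open>I\<close>, and contractivity identifies the image.\<close>

lemma integral_T:
  assumes "0 \<le> t" and \<phi>: "\<And>s. s \<in> {a..b} \<Longrightarrow> \<phi> s \<in> X"
    and I: "(\<phi> has_integral I) {a..b::real}" and J: "((\<lambda>s. T t (\<phi> s)) has_integral J) {a..b}"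
  shows "I \<in> X \<and> T t I = J"
proof -
  have sums: "\<exists>R\<in>X. norm (R - I) < e \<and> norm (T t R - J) < e" if "e > 0" for e
  proof -
    obtain \<gamma> where \<gamma>: "gauge \<gamma>"
      "\<And>\<D>. \<D> tagged_division_of {a..b} \<Longrightarrow> \<gamma> fine \<D> \<Longrightarrow>
         norm ((\<Sum>(x,k)\<in>\<D>. measure lborel k *\<^sub>R \<phi> x) - I) < e"
      using I \<open>e > 0\<close> unfolding has_integral_real by metis
    obtain \<gamma>' where \<gamma>': "gauge \<gamma>'"
      "\<And>\<D>. \<D> tagged_division_of {a..b} \<Longrightarrow> \<gamma>' fine \<D> \<Longrightarrow>
         norm ((\<Sum>(x,k)\<in>\<D>. measure lborel k *\<^sub>R T t (\<phi> x)) - J) < e"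
      using J \<open>e > 0\<close> unfolding has_integral_real by metis
    obtain \<D> where \<D>: "\<D> tagged_division_of {a..b}" "(\<lambda>x. \<gamma> x \<inter> \<gamma>' x) fine \<D>"
      using fine_division_exists_real[OF gauge_Int[OF \<gamma>(1) \<gamma>'(1)]] by metis
    have mem': "measure lborel k *\<^sub>R \<phi> x \<in> X \<and> T t (measure lborel k *\<^sub>R \<phi> x) = measure lborel k *\<^sub>R T t (\<phi> x)"
      if "(x, k) \<in> \<D>" for x k
      using tagged_division_ofD(2,3)[OF \<D>(1) that] \<phi> assms(1) by (auto simp: X_scaleR T_scaleR)
    let ?R = "\<Sum>(x,k)\<in>\<D>. measure lborel k *\<^sub>R \<phi> x"
    have "T t ?R = (\<Sum>p\<in>\<D>. T t (case p of (x,k) \<Rightarrow> measure lborel k *\<^sub>R \<phi> x))" and RX: "?R \<in> X"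
      using T_sum[of t \<D> "\<lambda>(x,k). measure lborel k *\<^sub>R \<phi> x"] mem' assms(1) by auto
    then have "T t ?R = (\<Sum>(x,k)\<in>\<D>. measure lborel k *\<^sub>R T t (\<phi> x))"
      using mem' by (auto intro!: sum.cong)
    then show ?thesis
      using RX \<gamma>(2)[OF \<D>(1)] \<gamma>'(2)[OF \<D>(1)] \<D>(2) by (auto simp: fine_Int)
  qed
  have IX: "I \<in> X"
    unfolding closed_approachable[OF closed_X, symmetric] dist_norm using sums by meson
  have "norm (T t I - J) < e" if e: "e > 0" for e
  proof -
    obtain R where R: "R \<in> X" "norm (R - I) < e/2" "norm (T t R - J) < e/2"
      using sums[OF half_gt_zero[OF e]] by blast
    have "norm (T t I - T t R) \<le> norm (R - I)"
      using T_dist[OF assms(1) IX R(1)] by (simp add: norm_minus_commute)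
    then show ?thesis
      using norm_triangle_ineq[of "T t I - T t R" "T t R - J"] R by simp
  qed
  then have "T t I = J" by (metis less_irrefl right_minus_eq zero_less_norm_iff)
  with IX show ?thesis by simp
qed

lemma generatorD: "(f, g) \<in> generator_on X T \<Longrightarrow> f \<in> X" "(f, g) \<in> generator_on X T \<Longrightarrow> g \<in> X"
  by (auto simp: generator_on_def)

text \<open>\<open>T s\<close> commutes with the semigroup, so the difference quotient of
  \<open>T s f\<close> is \<open>T s\<close> of the one of \<open>f\<close>, and its error can only
  shrink.\<close>

lemma generator_T:
  assumes "(f, g) \<in> generator_on X T" "0 \<le> s"
  shows "(T s f, T s g) \<in> generator_on X T"
proof -
  have f: "f \<in> X" and g: "g \<in> X" and lim: "((\<lambda>t. (1 / t) *\<^sub>R (T t f - f)) \<longlongrightarrow> g) (at_right 0)"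
    using assms by (auto simp: generator_on_def)
  have "norm ((1 / t) *\<^sub>R (T t (T s f) - T s f) - T s g) \<le> norm ((1 / t) *\<^sub>R (T t f - f) - g)"
    if "t > 0" for t
  proof -
    have "T t (T s f) = T s (T t f)"
      using T_plus[of s t f] T_plus[of t s f] that assms f by (simp add: add.commute)
    then have "(1 / t) *\<^sub>R (T t (T s f) - T s f) - T s g = T s ((1 / t) *\<^sub>R (T t f - f) - g)"
      using that assms f g by (simp add: T_diff T_scaleR X_diff X_scaleR mem)
    then show ?thesis
      using that assms f g by (simp add: T_contr X_diff X_scaleR mem)
  qed
  then have "\<forall>\<^sub>F t in at_right 0. norm ((1 / t) *\<^sub>R (T t (T s f) - T s f) - T s g)
      \<le> norm ((1 / t) *\<^sub>R (T t f - f) - g)"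
    by (auto simp: eventually_at_right_less eventually_at_filter)
  from Lim_null_comparison[OF this] lim
  have "((\<lambda>t. (1 / t) *\<^sub>R (T t (T s f) - T s f) - T s g) \<longlongrightarrow> 0) (at_right 0)"
    using tendsto_norm_zero[OF LIM_zero[OF lim]] by auto
  then show ?thesis
    using f g assms LIM_zero_iff by (auto simp: generator_on_def mem)
qed

lemma generator_scaleR:
  assumes "(f, g) \<in> generator_on X T"
  shows "(c *\<^sub>R f, c *\<^sub>R g) \<in> generator_on X T"
proof -
  have f: "f \<in> X" and g: "g \<in> X" and lim: "((\<lambda>t. (1 / t) *\<^sub>R (T t f - f)) \<longlongrightarrow> g) (at_right 0)"
    using assms by (auto simp: generator_on_def)
  have "((\<lambda>t. c *\<^sub>R (1 / t) *\<^sub>R (T t f - f)) \<longlongrightarrow> c *\<^sub>R g) (at_right 0)"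
    by (intro tendsto_intros lim)
  then have "((\<lambda>t. (1 / t) *\<^sub>R (T t (c *\<^sub>R f) - c *\<^sub>R f)) \<longlongrightarrow> c *\<^sub>R g) (at_right 0)"
    by (rule Lim_transform_eventually)
      (auto simp: eventually_at_filter T_scaleR f scaleR_diff_right mult.commute)
  then show ?thesis
    using f g by (auto simp: generator_on_def X_scaleR)
qed

lemma integral_mean_tendsto:
  fixes \<phi> :: "real \<Rightarrow> 'a"
  assumes "continuous_on {0..} \<phi>" "0 \<le> a"
  shows "((\<lambda>r. (1 / r) *\<^sub>R integral {a..a+r} \<phi>) \<longlongrightarrow> \<phi> a) (at_right 0)"
proof -
  have "continuous_on {a..a+1} \<phi>"
    using assms by (auto intro: continuous_on_subset)
  then have "((\<lambda>u. integral {a..u} \<phi>) has_vector_derivative \<phi> a) (at a within {a..a+1})"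
    by (intro integral_has_vector_derivative) auto
  then have "((\<lambda>u. (1 / norm (u - a)) *\<^sub>R (integral {a..u} \<phi> - (u - a) *\<^sub>R \<phi> a)) \<longlongrightarrow> 0) (at_right a)"
    by (simp add: has_vector_derivative_def has_derivative_within at_within_Icc_at_right)
  then have "((\<lambda>u. (1 / (u - a)) *\<^sub>R integral {a..u} \<phi> - \<phi> a) \<longlongrightarrow> 0) (at_right a)"
    by (rule Lim_transform_eventually) (auto simp: eventually_at_filter scaleR_diff_right)
  then have "((\<lambda>u. (1 / (u - a)) *\<^sub>R integral {a..u} \<phi>) \<longlongrightarrow> \<phi> a) (at_right a)"
    by (simp add: LIM_zero_iff)
  then show ?thesis
    by (subst (asm) filterlim_at_right_to_0) (simp add: add.commute)
qed

text \<open>The averages of the orbit over short intervals \<open>{0..h}\<close> lie in the domain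
  and converge to \<open>f\<close>.\<close>

lemma generator_dense:
  assumes "f \<in> X" "e > 0"
  shows "\<exists>f' g'. (f', g') \<in> generator_on X T \<and> norm (f - f') < e"
proof -
  let ?\<phi> = "\<lambda>s. T s f"
  have cont: "continuous_on {0..} ?\<phi>" by (rule continuous_T[OF assms(1)])
  have int: "?\<phi> integrable_on {a..b}" if "0 \<le> a" for a b
    by (rule integrable_continuous_real, rule continuous_on_subset[OF cont]) (use that in auto)
  have "((\<lambda>h. (1 / h) *\<^sub>R integral {0..h} ?\<phi>) \<longlongrightarrow> f) (at_right 0)"
    using integral_mean_tendsto[OF cont, of 0] T_0[OF assms(1)] by simp
  from tendstoD[OF this assms(2)] have "\<forall>\<^sub>F h in at_right 0. 0 < h \<and> dist ((1 / h) *\<^sub>R integral {0..h} ?\<phi>) f < e"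
    using eventually_at_right_less[of 0] by eventually_elim auto
  then obtain h where h: "h > 0" "dist ((1 / h) *\<^sub>R integral {0..h} ?\<phi>) f < e"
    using eventually_happens'[OF trivial_limit_at_right_real] by blast
  define I where "I = integral {0..h} ?\<phi>"
  \<comment> \<open>\<open>T r I\<close> integrates the orbit over the window shifted by
    \<open>r\<close>. The windows overlap, so \<open>T r I - I\<close> is a difference of integrals
    over the two ends only, whose means converge to \<open>T h f\<close> and
    \<open>T 0 f\<close>.\<close>
  have TI: "I \<in> X \<and> T r I = integral {r..h+r} ?\<phi>" if r: "r \<ge> 0" for r
  proof (rule integral_T[OF r])
    show "(?\<phi> has_integral I) {0..h}" unfolding I_def by (rule integrable_integral) (simp add: int)
    have "((?\<phi> \<circ> (+) r) has_integral integral {r..h+r} ?\<phi>) {0..h}"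
      using integrable_integral[OF int[OF r, of "h+r"]] has_integral_shift_Icc_real[of ?\<phi> r _ 0 h] by simp
    then show "((\<lambda>s. T r (T s f)) has_integral integral {r..h+r} ?\<phi>) {0..h}"
      by (rule has_integral_eq[rotated]) (use r assms in \<open>auto simp: T_plus\<close>)
  qed (use assms in \<open>auto simp: mem\<close>)
  have "((\<lambda>r. (1 / r) *\<^sub>R integral {h..h+r} ?\<phi> - (1 / r) *\<^sub>R integral {0..0+r} ?\<phi>) \<longlongrightarrow> T h f - T 0 f) (at_right 0)"
    by (intro tendsto_diff integral_mean_tendsto[OF cont]) (use h in auto)
  then have "((\<lambda>r. (1 / r) *\<^sub>R (T r I - I)) \<longlongrightarrow> T h f - f) (at_right 0)"
    unfolding T_0[OF assms(1)]
  proof (rule Lim_transform_eventually)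
    have "(1 / r) *\<^sub>R integral {h..h+r} ?\<phi> - (1 / r) *\<^sub>R integral {0..0+r} ?\<phi> = (1 / r) *\<^sub>R (T r I - I)"
      if "r > 0" for r
    proof -
      have "integral {0..r} ?\<phi> + T r I = I + integral {h..h+r} ?\<phi>"
        using Henstock_Kurzweil_Integration.integral_combine[where f = ?\<phi> and a = 0 and c = r and b = "h+r"]
          Henstock_Kurzweil_Integration.integral_combine[where f = ?\<phi> and a = 0 and c = h and b = "h+r"] TI[of r] that h int
        by (simp add: I_def)
      then have "integral {h..h+r} ?\<phi> - integral {0..0+r} ?\<phi> = T r I - I"
        by (simp add: algebra_simps)
      then show ?thesis by (simp flip: scaleR_diff_right)
    qed
    then show "\<forall>\<^sub>F r in at_right 0. (1 / r) *\<^sub>R integral {h..h+r} ?\<phi> - (1 / r) *\<^sub>R integral {0..0+r} ?\<phi>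
        = (1 / r) *\<^sub>R (T r I - I)" by (auto simp: eventually_at_filter)
  qed
  then have gen: "(I, T h f - f) \<in> generator_on X T"
    using TI[of 0] h assms by (auto simp: generator_on_def X_diff mem)
  have "((1 / h) *\<^sub>R I, (1 / h) *\<^sub>R (T h f - f)) \<in> generator_on X T"
    using gen by (rule generator_scaleR)
  then show ?thesis
    using h(2) unfolding I_def dist_norm norm_minus_commute[of f] by blast
qed

text \<open>Telescoping substitute for integrating the derivative \<open>T s g\<close> of the orbit
  over \<open>{0..t}\<close> and comparing it with the constant \<open>g'\<close>.\<close>

lemma T_minus_linear_le:
  assumes fg: "(f, g) \<in> generator_on X T" and t: "0 \<le> t"
    and T_g: "\<And>s. 0 \<le> s \<Longrightarrow> s \<le> t \<Longrightarrow> norm (T s g - g') \<le> b" and g': "g' \<in> X"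
  shows "norm (T t f - f - t *\<^sub>R g') \<le> t * b"
proof (cases "t = 0")
  case True
  then show ?thesis using T_0[OF generatorD(1)[OF fg]] by simp
next
  case False
  then have t: "t > 0" using t by simp
  have f: "f \<in> X" and g: "g \<in> X" using fg generatorD by auto
  show ?thesis
  proof (rule field_le_epsilon)
    fix e :: real assume "e > 0"
    \<comment> \<open>The error \<open>r * e'\<close> of one step adds up to
      \<open>t * e' = e\<close> over the whole interval.\<close>
    define e' where "e' = e / t"
    have e': "e' > 0" using \<open>e > 0\<close> t by (simp add: e'_def)
    have lim: "((\<lambda>r. (1 / r) *\<^sub>R (T r f - f)) \<longlongrightarrow> g) (at_right 0)"
      using fg by (simp add: generator_on_def)
    obtain d where d: "d > 0" "\<And>r. 0 < r \<Longrightarrow> r < d \<Longrightarrow> norm ((1 / r) *\<^sub>R (T r f - f) - g) < e'"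
      using tendstoD[OF lim e'] unfolding eventually_at dist_norm by (auto simp: dist_real_def)
    \<comment> \<open>This makes the step length \<open>r = t / n\<close> smaller than
      \<open>d\<close>, so the difference quotient at 0 controls each increment after a shift by
      \<open>T (j * r)\<close>.\<close>
    obtain n :: nat where n: "t / d < n"
      using reals_Archimedean2 by blast
    have "0 < t / d" using t d(1) by simp
    then have "real n > 0" using n by linarith
    then have n: "n > 0" "t / n < d"
      using n d(1) by (auto simp: field_simps)
    define r where "r = t / n"
    have r: "r > 0" "r < d" "n * r = t" using n t by (auto simp: r_def)
    have "norm ((1 / r) *\<^sub>R (T r f - f - r *\<^sub>R g)) < e'"
      using d(2)[OF r(1,2)] r by (simp add: scaleR_diff_right)
    then have inc: "norm (T r f - f - r *\<^sub>R g) \<le> r * e'"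
      using r by (simp add: divide_simps mult.commute)
    have step: "norm (T (j * r + r) f - T (j * r) f - r *\<^sub>R g') \<le> r * (e' + b)" if "j < n" for j :: nat
    proof -
      have jr: "0 \<le> j * r" "j * r \<le> t"
        using r that by (auto simp flip: r(3) intro!: mult_right_mono)
      have "T (j * r + r) f - T (j * r) f - r *\<^sub>R T (j * r) g = T (j * r) (T r f - f - r *\<^sub>R g)"
        using r jr f g by (simp add: T_diff T_scaleR X_diff X_scaleR mem T_plus)
      then have "norm (T (j * r + r) f - T (j * r) f - r *\<^sub>R T (j * r) g) \<le> r * e'"
        using T_contr[OF jr(1), of "T r f - f - r *\<^sub>R g"] inc r f g by (simp add: X_diff X_scaleR mem)
      moreover have "norm (r *\<^sub>R (T (j * r) g - g')) \<le> r * b"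
        using T_g[OF jr] r by simp
      ultimately show ?thesis
        using norm_triangle_ineq[of "T (j * r + r) f - T (j * r) f - r *\<^sub>R T (j * r) g" "r *\<^sub>R (T (j * r) g - g')"]
        by (simp add: algebra_simps)
    qed
    have "norm (T (j * r) f - f - (j * r) *\<^sub>R g') \<le> j * (r * (e' + b))" if "j \<le> n" for j :: nat
      using that
    proof (induction j)
      case 0 then show ?case using T_0[OF f] by simp
    next
      case (Suc j)
      then show ?case
        using norm_triangle_ineq[of "T (j * r) f - f - (j * r) *\<^sub>R g'" "T (j * r + r) f - T (j * r) f - r *\<^sub>R g'"]
          step[of j] by (simp add: algebra_simps)
    qed
    from this[of n] show "norm (T t f - f - t *\<^sub>R g') \<le> t * b + e"
      using r t by (simp add: mult.assoc[symmetric]) (simp add: e'_def algebra_simps)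
  qed
qed

text \<open>Comparison of the orbit with the constant \<open>f\<close>, that is, with
  \<open>g' = 0\<close>.\<close>

lemma T_dist_le:
  assumes "(f, g) \<in> generator_on X T" "0 \<le> t"
  shows "norm (T t f - f) \<le> t * norm g"
  using T_minus_linear_le[OF assms, of 0 "norm g"] T_contr[of _ g] generatorD[OF assms(1)] X_0 by simp

text \<open>\<open>T s g - g\<close> has no rate of its own. The detour through the domain element
  \<open>f'\<close> gives the rate \<open>t * norm g'\<close> at the price of \<eta> on the way
  there and \<eta> on the way back.\<close>

lemma T_expansion:
  assumes fg: "(f, g) \<in> generator_on X T" and fg': "(f', g') \<in> generator_on X T"
    and close: "norm (g - f') \<le> \<eta>" and t: "0 \<le> t"
  shows "norm (T t f - f - t *\<^sub>R g) \<le> t * (2 * \<eta> + t * norm g')"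
proof (rule T_minus_linear_le[OF fg t])
  fix s assume s: "0 \<le> s" "s \<le> t"
  have "norm (T s g - T s f') \<le> \<eta>"
    using T_dist[OF s(1), of g f'] close generatorD[OF fg] generatorD[OF fg'] by simp
  moreover have "norm (T s f' - f') \<le> t * norm g'"
    using T_dist_le[OF fg' s(1)] mult_right_mono[OF s(2), of "norm g'"] by simp
  ultimately have "norm ((T s g - T s f') + (T s f' - f') + (f' - g)) \<le> \<eta> + t * norm g' + \<eta>"
    by (intro norm_triangle_le add_mono) (use close in \<open>auto simp: norm_minus_commute\<close>)
  then show "norm (T s g - g) \<le> 2 * \<eta> + t * norm g'" by simp
qed (fact generatorD[OF fg])

end

subsection \<open>Convergence of discrete approximations\<close>

lemma linear_contraction_funpow:
  fixes S :: "'b::real_normed_vector \<Rightarrow> 'b"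
  assumes "linear S" "\<And>u. norm (S u) \<le> norm u"
  shows "linear (S ^^ k) \<and> norm ((S ^^ k) u) \<le> norm u"
proof (induction k arbitrary: u)
  case 0
  show ?case by (simp add: module_hom_ident linear_iff)
next
  case (Suc k)
  then show ?case
    using linear_compose[of "S ^^ k" S] assms(1) order_trans[OF assms(2)] by (simp add: o_def)
qed

lemma funpow_contr_dist:
  fixes S :: "'b::real_normed_vector \<Rightarrow> 'b"
  assumes "linear S" "\<And>u. norm (S u) \<le> norm u"
  shows "norm ((S ^^ k) v - (S ^^ k) w) \<le> norm (v - w)"
  using linear_contraction_funpow[OF assms, of k "v - w"] linear_diff[of "S ^^ k" v w] by metis

text \<open>Discrete counterpart of \<open>T_minus_linear_le\<close>: the sum of the terms
  \<open>(S ^^ j) (S u - u)\<close> telescopes to \<open>(S ^^ k) u - u\<close>.\<close>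

lemma funpow_increment_le:
  fixes S :: "'b::real_normed_vector \<Rightarrow> 'b"
  assumes "linear S" "\<And>u. norm (S u) \<le> norm u"
    and "\<And>j. j < k \<Longrightarrow> norm ((S ^^ j) (S u - u) - a) \<le> b"
  shows "norm ((S ^^ k) u - u - k *\<^sub>R a) \<le> k * b"
  using assms(3)
proof (induction k)
  case (Suc k)
  have "linear (S ^^ k)" using linear_contraction_funpow[OF assms(1,2)] by blast
  then have "(S ^^ Suc k) u - u - Suc k *\<^sub>R a = ((S ^^ k) u - u - k *\<^sub>R a) + ((S ^^ k) (S u - u) - a)"
    by (simp add: linear_diff funpow_swap1 algebra_simps)
  also have "norm \<dots> \<le> k * b + b"
    using Suc by (intro norm_triangle_le add_mono) auto
  finally show ?case by (simp add: algebra_simps)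
qed simp

text \<open>Cutting \<open>nat \<lfloor>t / d\<rfloor>\<close> steps at the floors of intermediate
  times gives blocks whose duration is off by at most one step \<open>d\<close>, however many blocks
  there are.\<close>

lemma floor_increment:
  fixes a b d :: real
  assumes "0 \<le> a" "0 \<le> b" "d > 0"
  shows "nat \<lfloor>a / d\<rfloor> \<le> nat \<lfloor>(a + b) / d\<rfloor>"
    and "\<bar>real (nat \<lfloor>(a + b) / d\<rfloor> - nat \<lfloor>a / d\<rfloor>) * d - b\<bar> \<le> d"
proof -
  have le: "\<lfloor>a / d\<rfloor> \<le> \<lfloor>(a + b) / d\<rfloor>" "0 \<le> \<lfloor>a / d\<rfloor>"
    using assms by (auto intro!: floor_mono divide_right_mono)
  then show "nat \<lfloor>a / d\<rfloor> \<le> nat \<lfloor>(a + b) / d\<rfloor>" by (simp add: nat_mono)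
  let ?k = "real_of_int (\<lfloor>(a + b) / d\<rfloor> - \<lfloor>a / d\<rfloor>)"
  have k: "real (nat \<lfloor>(a + b) / d\<rfloor> - nat \<lfloor>a / d\<rfloor>) = ?k"
    using le order_trans[OF le(2,1)] by (simp only: of_nat_diff nat_mono of_nat_nat of_int_diff)
  have ab: "(a + b) / d = a / d + b / d" by (simp add: add_divide_distrib)
  have "\<bar>?k - b / d\<bar> \<le> 1"
    using of_int_floor_le[of "a / d"] of_int_floor_le[of "(a + b) / d"]
      floor_correct[of "a / d"] floor_correct[of "(a + b) / d"] unfolding ab by linarith
  then have "\<bar>?k - b / d\<bar> * d \<le> 1 * d"
    using assms by (intro mult_right_mono) auto
  moreover have "\<bar>?k - b / d\<bar> * d = \<bar>(?k - b / d) * d\<bar>"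
    using assms by (simp only: abs_mult abs_of_pos[of d])
  moreover have "(?k - b / d) * d = ?k * d - b"
    using assms by (simp add: left_diff_distrib)
  ultimately show "\<bar>real (nat \<lfloor>(a + b) / d\<rfloor> - nat \<lfloor>a / d\<rfloor>) * d - b\<bar> \<le> d"
    using k by simp
qed

text \<open>\<open>'b\<close> is one space for all \<epsilon>, with only \<open>S\<close>,
  \<open>P\<close> and \<delta> varying. Contractivity is asked eventually, since the perturbed
  kernel is stochastic only for small \<epsilon>. Consistency is stated on the graph
  \<open>L\<close>, from which the generator is reached by closure.\<close>

locale semigroup_approximation = subspace_semigroup X T
  for X :: "'a::banach set" and T +
  fixes S :: "'c \<Rightarrow> 'b::real_normed_vector \<Rightarrow> 'b"
    and P :: "'c \<Rightarrow> 'a \<Rightarrow> 'b"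
    and \<delta> :: "'c \<Rightarrow> real" and \<F> :: "'c filter" and L :: "('a \<times> 'a) set"
  assumes S: "\<forall>\<^sub>F \<epsilon> in \<F>. linear (S \<epsilon>) \<and> (\<forall>u. norm (S \<epsilon> u) \<le> norm u)"
    and linear_P: "\<And>\<epsilon>. linear (P \<epsilon>)"
    and P_contr: "\<And>\<epsilon> f. norm (P \<epsilon> f) \<le> norm f"
    and \<delta>_pos: "\<forall>\<^sub>F \<epsilon> in \<F>. \<delta> \<epsilon> > 0"
    and \<delta>_tendsto: "(\<delta> \<longlongrightarrow> 0) \<F>"
    and core: "generator_on X T \<subseteq> closure L"
    and consistent: "\<And>f g. (f, g) \<in> L \<Longrightarrow> \<exists>u.
      ((\<lambda>\<epsilon>. u \<epsilon> - P \<epsilon> f) \<longlongrightarrow> 0) \<F> \<and> ((\<lambda>\<epsilon>. (1 / \<delta> \<epsilon>) *\<^sub>R (S \<epsilon> (u \<epsilon>) - u \<epsilon>) - P \<epsilon> g) \<longlongrightarrow> 0) \<F>"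
begin

lemma S_regular: "\<forall>\<^sub>F \<epsilon> in \<F>. \<delta> \<epsilon> > 0 \<and> linear (S \<epsilon>) \<and> (\<forall>u. norm (S \<epsilon> u) \<le> norm u) \<and>
    (\<forall>k. linear (S \<epsilon> ^^ k)) \<and> (\<forall>k u. norm ((S \<epsilon> ^^ k) u) \<le> norm u)"
  using S \<delta>_pos by eventually_elim (simp add: linear_contraction_funpow)

lemma P_diff: "P \<epsilon> (f - g) = P \<epsilon> f - P \<epsilon> g"
  and P_scaleR: "P \<epsilon> (c *\<^sub>R f) = c *\<^sub>R P \<epsilon> f"
  using linear_P[of \<epsilon>] by (auto simp: linear_diff linear_cmul)

lemma P_dist: "norm (P \<epsilon> f - P \<epsilon> g) \<le> norm (f - g)"
  using P_contr[of \<epsilon> "f - g"] by (simp add: P_diff)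

text \<open>The pair \<open>(f, g)\<close> is replaced by a nearby pair of \<open>L\<close>. The
  witness \<open>u\<close> then depends on \<eta>, so convergence weakens to an eventual error of at
  most \<eta>.\<close>

lemma consistent_closure:
  assumes "(f, g) \<in> generator_on X T" "\<eta> > 0"
  obtains u where "\<forall>\<^sub>F \<epsilon> in \<F>. norm (u \<epsilon> - P \<epsilon> f) \<le> \<eta> \<and>
      norm ((1 / \<delta> \<epsilon>) *\<^sub>R (S \<epsilon> (u \<epsilon>) - u \<epsilon>) - P \<epsilon> g) \<le> \<eta>"
proof -
  have \<eta>2: "\<eta> / 2 > 0" using assms(2) by simp
  have "(f, g) \<in> closure L" using assms core by auto
  then obtain p where p: "p \<in> L" "dist p (f, g) < \<eta> / 2"
    using \<eta>2 unfolding closure_approachable by blast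
  obtain f' g' where [simp]: "p = (f', g')" by (cases p)
  have close: "norm (f' - f) < \<eta> / 2" "norm (g' - g) < \<eta> / 2"
    using p(2) dist_fst_le[of p "(f, g)"] dist_snd_le[of p "(f, g)"] by (auto simp: dist_norm)
  obtain u where u: "((\<lambda>\<epsilon>. u \<epsilon> - P \<epsilon> f') \<longlongrightarrow> 0) \<F>"
      "((\<lambda>\<epsilon>. (1 / \<delta> \<epsilon>) *\<^sub>R (S \<epsilon> (u \<epsilon>) - u \<epsilon>) - P \<epsilon> g') \<longlongrightarrow> 0) \<F>"
    using consistent p(1) by auto
  show ?thesis
  proof (rule that[of u])
    show "\<forall>\<^sub>F \<epsilon> in \<F>. norm (u \<epsilon> - P \<epsilon> f) \<le> \<eta> \<and>
      norm ((1 / \<delta> \<epsilon>) *\<^sub>R (S \<epsilon> (u \<epsilon>) - u \<epsilon>) - P \<epsilon> g) \<le> \<eta>"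
      using tendstoD[OF u(1) \<eta>2] tendstoD[OF u(2) \<eta>2]
    proof eventually_elim
      case (elim \<epsilon>)
      show ?case
        using norm_triangle_ineq[of "u \<epsilon> - P \<epsilon> f'" "P \<epsilon> f' - P \<epsilon> f"] P_dist[of \<epsilon> f' f]
          norm_triangle_ineq[of "(1 / \<delta> \<epsilon>) *\<^sub>R (S \<epsilon> (u \<epsilon>) - u \<epsilon>) - P \<epsilon> g'" "P \<epsilon> g' - P \<epsilon> g"]
          P_dist[of \<epsilon> g' g] elim close by (auto simp: dist_norm)
    qed
  qed
qed

text \<open>Crude Lipschitz bound along the discrete orbit. It is applied below to the stand-in
  \<open>f'\<close> for \<open>g\<close>, to keep
  \<open>(S \<epsilon> ^^ j) (P \<epsilon> g)\<close> near \<open>P \<epsilon> g\<close>.\<close>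

lemma funpow_dist_le:
  assumes "(f, g) \<in> generator_on X T" "\<eta> > 0"
  shows "\<forall>\<^sub>F \<epsilon> in \<F>. \<forall>k. norm ((S \<epsilon> ^^ k) (P \<epsilon> f) - P \<epsilon> f) \<le> k * \<delta> \<epsilon> * (norm g + \<eta>) + \<eta>"
proof -
  have \<eta>2: "\<eta> / 2 > 0" using assms by simp
  obtain u where u: "\<forall>\<^sub>F \<epsilon> in \<F>. norm (u \<epsilon> - P \<epsilon> f) \<le> \<eta> / 2 \<and>
      norm ((1 / \<delta> \<epsilon>) *\<^sub>R (S \<epsilon> (u \<epsilon>) - u \<epsilon>) - P \<epsilon> g) \<le> \<eta> / 2"
    by (rule consistent_closure[OF assms(1) \<eta>2])
  from S_regular u show ?thesis
  proof eventually_elim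
    case (elim \<epsilon>)
    have contr: "norm ((S \<epsilon> ^^ j) v - (S \<epsilon> ^^ j) w) \<le> norm (v - w)" for j v w
      by (rule funpow_contr_dist) (use elim in auto)
    show ?case
    proof
      fix k
      have "norm ((1 / \<delta> \<epsilon>) *\<^sub>R (S \<epsilon> (u \<epsilon>) - u \<epsilon>)) \<le> norm g + \<eta>"
        using norm_triangle_ineq[of "(1 / \<delta> \<epsilon>) *\<^sub>R (S \<epsilon> (u \<epsilon>) - u \<epsilon>) - P \<epsilon> g" "P \<epsilon> g"]
          P_contr[of \<epsilon> g] elim assms by simp
      then have "norm (S \<epsilon> (u \<epsilon>) - u \<epsilon>) \<le> \<delta> \<epsilon> * (norm g + \<eta>)"
        using elim by (simp only: norm_scaleR) (simp add: divide_simps mult.commute)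
      then have "norm ((S \<epsilon> ^^ j) (S \<epsilon> (u \<epsilon>) - u \<epsilon>) - 0) \<le> \<delta> \<epsilon> * (norm g + \<eta>)" for j
        using elim by (metis diff_zero order_trans)
      then have 1: "norm ((S \<epsilon> ^^ k) (u \<epsilon>) - u \<epsilon>) \<le> k * (\<delta> \<epsilon> * (norm g + \<eta>))"
        using funpow_increment_le[of "S \<epsilon>" k "u \<epsilon>" 0] elim by simp
      have 2: "norm ((S \<epsilon> ^^ k) (P \<epsilon> f) - (S \<epsilon> ^^ k) (u \<epsilon>)) \<le> \<eta> / 2"
        using contr[of k "P \<epsilon> f" "u \<epsilon>"] elim by (simp add: norm_minus_commute)
      have "norm ((S \<epsilon> ^^ k) (P \<epsilon> f) - P \<epsilon> f) = norm (((S \<epsilon> ^^ k) (P \<epsilon> f) - (S \<epsilon> ^^ k) (u \<epsilon>))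
          + ((S \<epsilon> ^^ k) (u \<epsilon>) - u \<epsilon>) + (u \<epsilon> - P \<epsilon> f))" by simp
      also have "\<dots> \<le> \<eta> / 2 + k * (\<delta> \<epsilon> * (norm g + \<eta>)) + \<eta> / 2"
        using 1 2 elim by (intro norm_triangle_le add_mono) auto
      finally show "norm ((S \<epsilon> ^^ k) (P \<epsilon> f) - P \<epsilon> f) \<le> k * \<delta> \<epsilon> * (norm g + \<eta>) + \<eta>"
        by (simp add: mult.assoc)
    qed
  qed
qed

text \<open>Discrete counterpart of \<open>T_expansion\<close>. The four \<eta> are the consistency
  error, the passage from \<open>g\<close> to \<open>f'\<close>, the slack in
  \<open>funpow_dist_le\<close> and the passage back.\<close>

lemma funpow_expansion:
  assumes fg: "(f, g) \<in> generator_on X T" and fg': "(f', g') \<in> generator_on X T"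
    and close: "norm (g - f') \<le> \<eta>" and pos: "\<eta> > 0" "\<rho> > 0" "b \<ge> 0"
  shows "\<forall>\<^sub>F \<epsilon> in \<F>. \<forall>k. k * \<delta> \<epsilon> \<le> b \<longrightarrow>
    norm ((S \<epsilon> ^^ k) (P \<epsilon> f) - P \<epsilon> f - (k * \<delta> \<epsilon>) *\<^sub>R P \<epsilon> g)
      \<le> k * \<delta> \<epsilon> * (4 * \<eta> + b * (norm g' + \<eta>)) + \<rho>"
proof -
  \<comment> \<open>The bound \<eta> is for the generator error of \<open>u\<close>, which is
    multiplied by time; \<open>\<rho> / 2\<close> is for
    \<open>u \<epsilon> - P \<epsilon> f\<close>, which enters twice, at the start and at the
    end.\<close>
  have min_pos: "min \<eta> (\<rho> / 2) > 0" using pos by simp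
  obtain u where u: "\<forall>\<^sub>F \<epsilon> in \<F>. norm (u \<epsilon> - P \<epsilon> f) \<le> min \<eta> (\<rho> / 2) \<and>
      norm ((1 / \<delta> \<epsilon>) *\<^sub>R (S \<epsilon> (u \<epsilon>) - u \<epsilon>) - P \<epsilon> g) \<le> min \<eta> (\<rho> / 2)"
    by (rule consistent_closure[OF fg min_pos])
  from S_regular u funpow_dist_le[OF fg' pos(1)] show ?thesis
  proof eventually_elim
    case (elim \<epsilon>)
    have lin: "linear (S \<epsilon> ^^ j)" for j using elim by blast
    have contr: "norm ((S \<epsilon> ^^ j) v - (S \<epsilon> ^^ j) w) \<le> norm (v - w)" for j v w
      by (rule funpow_contr_dist) (use elim in auto)
    have \<delta>: "\<delta> \<epsilon> > 0" using elim by simp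
    show ?case
    proof (intro allI impI)
      fix k assume k: "real k * \<delta> \<epsilon> \<le> b"
      define a where "a = (1 / \<delta> \<epsilon>) *\<^sub>R (S \<epsilon> (u \<epsilon>) - u \<epsilon>)"
      let ?b = "4 * \<eta> + b * (norm g' + \<eta>)"
      have step: "norm ((S \<epsilon> ^^ j) (S \<epsilon> (u \<epsilon>) - u \<epsilon>) - \<delta> \<epsilon> *\<^sub>R P \<epsilon> g) \<le> \<delta> \<epsilon> * ?b" if j: "j < k" for j
      proof -
        have "real j * \<delta> \<epsilon> \<le> b"
          using j k \<delta> by (meson less_imp_le mult_right_mono of_nat_mono order_trans)
        then have "real j * \<delta> \<epsilon> * (norm g' + \<eta>) \<le> b * (norm g' + \<eta>)"
          using pos by (intro mult_right_mono) auto
        moreover have "norm ((S \<epsilon> ^^ j) (P \<epsilon> f') - P \<epsilon> f') \<le> j * \<delta> \<epsilon> * (norm g' + \<eta>) + \<eta>"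
          using elim by blast
        ultimately have 3: "norm ((S \<epsilon> ^^ j) (P \<epsilon> f') - P \<epsilon> f') \<le> b * (norm g' + \<eta>) + \<eta>"
          by simp
        have 1: "norm ((S \<epsilon> ^^ j) a - (S \<epsilon> ^^ j) (P \<epsilon> g)) \<le> \<eta>"
          using contr[of j a "P \<epsilon> g"] elim unfolding a_def by simp
        have 2: "norm ((S \<epsilon> ^^ j) (P \<epsilon> g) - (S \<epsilon> ^^ j) (P \<epsilon> f')) \<le> \<eta>"
          using contr[of j "P \<epsilon> g" "P \<epsilon> f'"] P_dist[of \<epsilon> g f'] close by simp
        have 4: "norm (P \<epsilon> f' - P \<epsilon> g) \<le> \<eta>"
          using P_dist[of \<epsilon> f' g] close by (simp add: norm_minus_commute)
        have "norm ((S \<epsilon> ^^ j) a - P \<epsilon> g) = norm (((S \<epsilon> ^^ j) a - (S \<epsilon> ^^ j) (P \<epsilon> g)) +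
            ((S \<epsilon> ^^ j) (P \<epsilon> g) - (S \<epsilon> ^^ j) (P \<epsilon> f')) + ((S \<epsilon> ^^ j) (P \<epsilon> f') - P \<epsilon> f') + (P \<epsilon> f' - P \<epsilon> g))"
          by simp
        also have "\<dots> \<le> \<eta> + \<eta> + (b * (norm g' + \<eta>) + \<eta>) + \<eta>"
          using 1 2 3 4 by (intro norm_triangle_le add_mono) auto
        finally have "\<delta> \<epsilon> * norm ((S \<epsilon> ^^ j) a - P \<epsilon> g) \<le> \<delta> \<epsilon> * ?b"
          using \<delta> by (intro mult_left_mono) auto
        moreover have "(S \<epsilon> ^^ j) (S \<epsilon> (u \<epsilon>) - u \<epsilon>) = \<delta> \<epsilon> *\<^sub>R (S \<epsilon> ^^ j) a"
          using \<delta> by (simp add: a_def linear_cmul[OF lin])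
        ultimately show ?thesis
          using \<delta> by (simp flip: scaleR_diff_right)
      qed
      have 1: "norm ((S \<epsilon> ^^ k) (u \<epsilon>) - u \<epsilon> - k *\<^sub>R (\<delta> \<epsilon> *\<^sub>R P \<epsilon> g)) \<le> k * (\<delta> \<epsilon> * ?b)"
        by (rule funpow_increment_le) (use elim step in auto)
      have 2: "norm ((S \<epsilon> ^^ k) (P \<epsilon> f) - (S \<epsilon> ^^ k) (u \<epsilon>)) \<le> \<rho> / 2"
        using contr[of k "P \<epsilon> f" "u \<epsilon>"] elim by (simp add: norm_minus_commute)
      have "norm ((S \<epsilon> ^^ k) (P \<epsilon> f) - P \<epsilon> f - (k * \<delta> \<epsilon>) *\<^sub>R P \<epsilon> g)
          = norm (((S \<epsilon> ^^ k) (P \<epsilon> f) - (S \<epsilon> ^^ k) (u \<epsilon>)) +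
              ((S \<epsilon> ^^ k) (u \<epsilon>) - u \<epsilon> - k *\<^sub>R (\<delta> \<epsilon> *\<^sub>R P \<epsilon> g)) + (u \<epsilon> - P \<epsilon> f))"
        by (simp add: algebra_simps)
      also have "\<dots> \<le> \<rho> / 2 + k * (\<delta> \<epsilon> * ?b) + \<rho> / 2"
        using 1 2 elim by (intro norm_triangle_le add_mono) auto
      finally show "norm ((S \<epsilon> ^^ k) (P \<epsilon> f) - P \<epsilon> f - (k * \<delta> \<epsilon>) *\<^sub>R P \<epsilon> g)
          \<le> k * \<delta> \<epsilon> * ?b + \<rho>"
        by (simp add: mult.assoc)
    qed
  qed
qed

text \<open>Both semigroups are compared with \<open>f + \<tau> *\<^sub>R g\<close>. The number of
  steps may miss the duration \<tau> by one step, as \<open>floor_increment\<close> allows.\<close>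

lemma short_time_error:
  assumes fg: "(f, g) \<in> generator_on X T" and fg': "(f', g') \<in> generator_on X T"
    and close: "norm (g - f') \<le> \<eta>" and pos: "\<eta> > 0" "\<rho> > 0" "\<tau> > 0"
  shows "\<forall>\<^sub>F \<epsilon> in \<F>. \<forall>k. \<bar>k * \<delta> \<epsilon> - \<tau>\<bar> \<le> \<delta> \<epsilon> \<longrightarrow>
    norm ((S \<epsilon> ^^ k) (P \<epsilon> f) - P \<epsilon> (T \<tau> f)) \<le> \<tau> * (10 * \<eta> + 5 * \<tau> * (norm g' + \<eta>)) + \<rho>"
proof -
  \<comment> \<open>The minimum bounds \<delta> twice: by \<tau>, so that
    \<open>k * \<delta> \<epsilon> \<le> 2 * \<tau>\<close>, and so that the mistimed part
    \<open>\<delta> \<epsilon> * norm g\<close> stays below \<open>\<rho> / 2\<close>. The summand 1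
    guards against \<open>g = 0\<close>.\<close>
  have pos': "\<rho> / 2 > 0" "2 * \<tau> \<ge> 0" "min \<tau> (\<rho> / (2 * (norm g + 1))) > 0"
    using pos by (auto simp: add_nonneg_pos intro!: divide_pos_pos)
  from S_regular funpow_expansion[OF fg fg' close pos(1) pos'(1,2)] tendstoD[OF \<delta>_tendsto pos'(3)]
  show ?thesis
  proof eventually_elim
    case (elim \<epsilon>)
    have \<delta>: "0 < \<delta> \<epsilon>" "\<delta> \<epsilon> \<le> \<tau>" "\<delta> \<epsilon> \<le> \<rho> / (2 * (norm g + 1))"
      using elim by auto
    have "\<delta> \<epsilon> * norm g \<le> \<delta> \<epsilon> * (norm g + 1)" using \<delta> by simp
    also have "\<dots> \<le> \<rho> / (2 * (norm g + 1)) * (norm g + 1)"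
      using \<delta> by (intro mult_right_mono) auto
    also have "\<dots> = \<rho> / 2"
    proof -
      have "\<rho> / (2 * c) * c = \<rho> / 2" if "c \<noteq> 0" for c :: real using that by simp
      moreover have "norm g + 1 \<noteq> 0" using norm_ge_zero[of g] by linarith
      ultimately show ?thesis by blast
    qed
    finally have \<delta>g: "\<delta> \<epsilon> * norm g \<le> \<rho> / 2" .
    show ?case
    proof (intro allI impI)
      fix k assume k: "\<bar>real k * \<delta> \<epsilon> - \<tau>\<bar> \<le> \<delta> \<epsilon>"
      then have k2: "real k * \<delta> \<epsilon> \<le> 2 * \<tau>" using \<delta> by linarith
      have "norm ((S \<epsilon> ^^ k) (P \<epsilon> f) - P \<epsilon> f - (k * \<delta> \<epsilon>) *\<^sub>R P \<epsilon> g)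
          \<le> k * \<delta> \<epsilon> * (4 * \<eta> + 2 * \<tau> * (norm g' + \<eta>)) + \<rho> / 2"
        using elim k2 by blast
      also have "\<dots> \<le> 2 * \<tau> * (4 * \<eta> + 2 * \<tau> * (norm g' + \<eta>)) + \<rho> / 2"
        using k2 pos by (intro add_right_mono mult_right_mono) auto
      finally have 1: "norm ((S \<epsilon> ^^ k) (P \<epsilon> f) - P \<epsilon> f - (k * \<delta> \<epsilon>) *\<^sub>R P \<epsilon> g)
          \<le> 2 * \<tau> * (4 * \<eta> + 2 * \<tau> * (norm g' + \<eta>)) + \<rho> / 2" .
      have "norm ((k * \<delta> \<epsilon> - \<tau>) *\<^sub>R P \<epsilon> g) \<le> \<delta> \<epsilon> * norm g"
        unfolding norm_scaleR real_norm_def using k P_contr \<delta> by (intro mult_mono) auto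
      then have 2: "norm ((k * \<delta> \<epsilon> - \<tau>) *\<^sub>R P \<epsilon> g) \<le> \<rho> / 2" using \<delta>g by simp
      have "norm (f + \<tau> *\<^sub>R g - T \<tau> f) \<le> \<tau> * (2 * \<eta> + \<tau> * norm g')"
        using T_expansion[OF fg fg' close, of \<tau>] pos norm_minus_commute[of "T \<tau> f" "f + \<tau> *\<^sub>R g"]
        by (simp add: diff_diff_add)
      then have 3: "norm (P \<epsilon> (f + \<tau> *\<^sub>R g) - P \<epsilon> (T \<tau> f)) \<le> \<tau> * (2 * \<eta> + \<tau> * norm g')"
        using P_dist order_trans by blast
      have "P \<epsilon> (f + \<tau> *\<^sub>R g) = P \<epsilon> f + \<tau> *\<^sub>R P \<epsilon> g"
        by (simp add: linear_add[OF linear_P] P_scaleR)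
      then have "norm ((S \<epsilon> ^^ k) (P \<epsilon> f) - P \<epsilon> (T \<tau> f)) =
          norm (((S \<epsilon> ^^ k) (P \<epsilon> f) - P \<epsilon> f - (k * \<delta> \<epsilon>) *\<^sub>R P \<epsilon> g) + (k * \<delta> \<epsilon> - \<tau>) *\<^sub>R P \<epsilon> g
            + (P \<epsilon> (f + \<tau> *\<^sub>R g) - P \<epsilon> (T \<tau> f)))"
        by (simp add: algebra_simps)
      also have "\<dots> \<le> (2 * \<tau> * (4 * \<eta> + 2 * \<tau> * (norm g' + \<eta>)) + \<rho> / 2) + \<rho> / 2 + \<tau> * (2 * \<eta> + \<tau> * norm g')"
        using 1 2 3 by (intro norm_triangle_le add_mono)
      \<comment> \<open>The constants are 10 = 2*4 + 2 and 5 = 2*2 + 1. The coefficient of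
        \<open>\<tau> * \<tau> * \<eta>\<close> is only 4 and is rounded up to 5, so that
        \<open>norm g' + \<eta>\<close> can be factored out.\<close>
      also have "\<dots> = \<tau> * (10 * \<eta> + 5 * \<tau> * (norm g' + \<eta>)) + \<rho> - \<tau> * \<tau> * \<eta>"
        by (simp add: algebra_simps)
      also have "\<dots> \<le> \<tau> * (10 * \<eta> + 5 * \<tau> * (norm g' + \<eta>)) + \<rho>"
        using pos by simp
      finally show "norm ((S \<epsilon> ^^ k) (P \<epsilon> f) - P \<epsilon> (T \<tau> f))
          \<le> \<tau> * (10 * \<eta> + 5 * \<tau> * (norm g' + \<eta>)) + \<rho>" .
    qed
  qed
qed

text \<open>\<open>N\<close> blocks of length \<open>t / N\<close> each contribute a short-time
  error, and contractivity carries earlier errors along unchanged. The local error is \<tau> times a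
  small quantity, so \<open>N\<close> blocks stay small.\<close>

lemma convergence_on_domain:
  assumes fg: "(f, g) \<in> generator_on X T" and t: "0 < t" and e: "e > 0"
  shows "\<forall>\<^sub>F \<epsilon> in \<F>. norm ((S \<epsilon> ^^ nat \<lfloor>t / \<delta> \<epsilon>\<rfloor>) (P \<epsilon> f) - P \<epsilon> (T t f)) < e"
proof -
  \<comment> \<open>The choices of \<eta>, \<open>N\<close> and \<rho> make each of the three parts
    of the accumulated error \<open>N * ?E\<close> at most a quarter of \<open>e\<close>.\<close>
  define \<eta> where "\<eta> = e / (40 * t)"
  have \<eta>: "\<eta> > 0" using e t by (simp add: \<eta>_def)
  obtain f' g' where fg': "(f', g') \<in> generator_on X T" and close: "norm (g - f') < \<eta>"
    using generator_dense[OF generatorD(2)[OF fg] \<eta>] by blast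
  define C where "C = norm g' + \<eta>"
  obtain N :: nat where N: "20 * t * t * C / e < N" using reals_Archimedean2 by blast
  moreover have "0 \<le> 20 * t * t * C / e" using e t \<eta> by (auto simp: C_def)
  ultimately have N0: "real N > 0" by linarith
  define \<tau> where "\<tau> = t / N"
  have \<tau>: "\<tau> > 0" "N * \<tau> = t" using t N0 by (auto simp: \<tau>_def)
  define \<rho> where "\<rho> = e / (4 * N)"
  have \<rho>: "\<rho> > 0" using e N0 by (simp add: \<rho>_def)
  let ?E = "\<tau> * (10 * \<eta> + 5 * \<tau> * C) + \<rho>"
  have "t * (5 * \<tau> * C) < e / 4"
    using N e N0 by (simp add: \<tau>_def field_simps)
  moreover have "N * ?E = t * 10 * \<eta> + t * (5 * \<tau> * C) + N * \<rho>"
    by (simp add: \<tau>(2)[symmetric] algebra_simps)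
  moreover have "t * 10 * \<eta> = e / 4" "N * \<rho> = e / 4"
    using t N0 by (auto simp: \<eta>_def \<rho>_def)
  ultimately have NE: "N * ?E < e" using e by linarith
  have "\<forall>\<^sub>F \<epsilon> in \<F>. \<forall>k. \<bar>k * \<delta> \<epsilon> - \<tau>\<bar> \<le> \<delta> \<epsilon> \<longrightarrow>
     norm ((S \<epsilon> ^^ k) (P \<epsilon> (T (i * \<tau>) f)) - P \<epsilon> (T \<tau> (T (i * \<tau>) f))) \<le> ?E" for i :: nat
  proof -
    have i: "0 \<le> i * \<tau>" using \<tau> by simp
    have mem': "f' \<in> X" "g \<in> X" "g' \<in> X" using generatorD[OF fg] generatorD[OF fg'] by auto
    \<comment> \<open>The semigroup maps generator pairs to generator pairs without increasing
      norms, so the same \<eta> and \<open>C\<close> serve at every time \<open>i * \<tau>\<close>.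
      Only finitely many \<open>i\<close> occur, hence one threshold for \<epsilon>
      suffices.\<close>
    have "norm (T (i * \<tau>) g - T (i * \<tau>) f') \<le> \<eta>"
      using T_dist[OF i mem'(2,1)] close by simp
    from short_time_error[OF generator_T[OF fg i] generator_T[OF fg' i] this \<eta> \<rho> \<tau>(1)]
    show ?thesis
    proof eventually_elim
      case (elim \<epsilon>)
      have "5 * \<tau> * (norm (T (i * \<tau>) g') + \<eta>) \<le> 5 * \<tau> * C"
        unfolding C_def using \<tau> T_contr[OF i mem'(3)] by (intro mult_left_mono) auto
      then have "\<tau> * (10 * \<eta> + 5 * \<tau> * (norm (T (i * \<tau>) g') + \<eta>)) + \<rho> \<le> ?E"
        using \<tau> by (intro add_right_mono mult_left_mono) auto
      then show ?case using elim order_trans by blast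
    qed
  qed
  then have "\<forall>\<^sub>F \<epsilon> in \<F>. \<forall>i\<in>{..<N}. \<forall>k. \<bar>k * \<delta> \<epsilon> - \<tau>\<bar> \<le> \<delta> \<epsilon> \<longrightarrow>
     norm ((S \<epsilon> ^^ k) (P \<epsilon> (T (real i * \<tau>) f)) - P \<epsilon> (T \<tau> (T (real i * \<tau>) f))) \<le> ?E"
    by (intro eventually_ball_finite) auto
  with S_regular show ?thesis
  proof eventually_elim
    case (elim \<epsilon>)
    \<comment> \<open>Cutting at the floors instead of into equal blocks keeps the rounding error of
      every block within one step, and the last block ends exactly at the required number of
      steps.\<close>
    define m where "m i = nat \<lfloor>i * \<tau> / \<delta> \<epsilon>\<rfloor>" for i :: nat
    have f: "f \<in> X" using generatorD[OF fg] by simp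
    have "norm ((S \<epsilon> ^^ m i) (P \<epsilon> f) - P \<epsilon> (T (i * \<tau>) f)) \<le> i * ?E" if "i \<le> N" for i :: nat
      using that
    proof (induction i)
      case 0
      then show ?case using T_0[OF f] by (simp add: m_def)
    next
      case (Suc i)
      let ?k = "m (Suc i) - m i"
      have Si: "real (Suc i) * \<tau> = i * \<tau> + \<tau>" by (simp add: algebra_simps)
      have k: "m i \<le> m (Suc i)" "\<bar>?k * \<delta> \<epsilon> - \<tau>\<bar> \<le> \<delta> \<epsilon>"
        unfolding m_def Si using floor_increment[of "i * \<tau>" \<tau> "\<delta> \<epsilon>"] \<tau> elim by auto
      have "(S \<epsilon> ^^ m (Suc i)) (P \<epsilon> f) = (S \<epsilon> ^^ ?k) ((S \<epsilon> ^^ m i) (P \<epsilon> f))"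
        using k(1) by (metis comp_apply funpow_add le_add_diff_inverse2)
      moreover have "T (real (Suc i) * \<tau>) f = T \<tau> (T (i * \<tau>) f)"
        using T_plus[of \<tau> "i * \<tau>" f] \<tau> f unfolding Si by (simp add: add.commute)
      ultimately have "(S \<epsilon> ^^ m (Suc i)) (P \<epsilon> f) - P \<epsilon> (T (real (Suc i) * \<tau>) f) =
          (S \<epsilon> ^^ ?k) ((S \<epsilon> ^^ m i) (P \<epsilon> f) - P \<epsilon> (T (i * \<tau>) f)) +
          ((S \<epsilon> ^^ ?k) (P \<epsilon> (T (i * \<tau>) f)) - P \<epsilon> (T \<tau> (T (i * \<tau>) f)))"
        using elim by (simp add: linear_diff)
      also have "norm \<dots> \<le> i * ?E + ?E"
      proof (intro norm_triangle_le add_mono)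
        show "norm ((S \<epsilon> ^^ ?k) ((S \<epsilon> ^^ m i) (P \<epsilon> f) - P \<epsilon> (T (i * \<tau>) f))) \<le> i * ?E"
          using Suc elim by (meson Suc_leD order_trans)
      qed (use elim k(2) Suc in auto)
      finally show ?case by (simp add: algebra_simps)
    qed
    from this[of N] show ?case using NE \<tau> by (simp add: m_def)
  qed
qed

text \<open>Extension from the dense domain: both families are contractions, so approximating
  \<open>f\<close> within \<open>e / 3\<close> costs \<open>e / 3\<close> on each side.\<close>

theorem convergence:
  assumes f: "f \<in> X" and t: "0 \<le> t"
  shows "((\<lambda>\<epsilon>. (S \<epsilon> ^^ nat \<lfloor>t / \<delta> \<epsilon>\<rfloor>) (P \<epsilon> f) - P \<epsilon> (T t f)) \<longlongrightarrow> 0) \<F>"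
proof (cases "t = 0")
  case True
  then show ?thesis using T_0[OF f] by simp
next
  case False
  then have t: "t > 0" using t by simp
  show ?thesis
  proof (rule tendstoI)
    fix e :: real assume e: "e > 0"
    then have e3: "e / 3 > 0" by simp
    obtain f' g' where fg': "(f', g') \<in> generator_on X T" and close: "norm (f - f') < e / 3"
      using generator_dense[OF f e3] by blast
    have f': "f' \<in> X" using generatorD[OF fg'] by simp
    from S_regular convergence_on_domain[OF fg' t e3]
    show "\<forall>\<^sub>F \<epsilon> in \<F>. dist ((S \<epsilon> ^^ nat \<lfloor>t / \<delta> \<epsilon>\<rfloor>) (P \<epsilon> f) - P \<epsilon> (T t f)) 0 < e"
    proof eventually_elim
      case (elim \<epsilon>)
      let ?S = "S \<epsilon> ^^ nat \<lfloor>t / \<delta> \<epsilon>\<rfloor>"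
      have "norm (?S (P \<epsilon> f) - ?S (P \<epsilon> f')) \<le> norm (P \<epsilon> f - P \<epsilon> f')"
        by (rule funpow_contr_dist) (use elim in auto)
      then have 1: "norm (?S (P \<epsilon> f) - ?S (P \<epsilon> f')) < e / 3"
        using P_dist[of \<epsilon> f f'] close by simp
      have 2: "norm (P \<epsilon> (T t f') - P \<epsilon> (T t f)) < e / 3"
        using P_dist[of \<epsilon> "T t f'" "T t f"] T_dist[of t f' f] f f' t close
        by (simp add: norm_minus_commute)
      have "norm (?S (P \<epsilon> f) - P \<epsilon> (T t f)) = norm ((?S (P \<epsilon> f) - ?S (P \<epsilon> f')) +
          (?S (P \<epsilon> f') - P \<epsilon> (T t f')) + (P \<epsilon> (T t f') - P \<epsilon> (T t f)))"
        by simp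
      also have "\<dots> < e / 3 + e / 3 + e / 3"
        using 1 2 elim by (intro norm_triangle_lt add_strict_mono le_less_trans[OF norm_triangle_ineq]) auto
      finally show ?case by (simp add: dist_norm)
    qed
  qed
qed

end

subsection \<open>Cell problems on the periodic lattice\<close>

text \<open>Induction by elimination of a vertex: solving the equation at \<open>v\<close> for \<open>q v\<close> and substituting
  gives the same problem for the Schur complement weights on the remaining vertices.\<close>

lemma graph_poisson_solvable:
  fixes w :: "'a \<Rightarrow> 'a \<Rightarrow> real"
  assumes "finite S"
    and "\<And>x y. x \<in> S \<Longrightarrow> y \<in> S \<Longrightarrow> 0 \<le> w x y"
    and "\<And>x y. x \<in> S \<Longrightarrow> y \<in> S \<Longrightarrow> w x y = w y x"
    and "\<And>U. U \<subset> S \<Longrightarrow> U \<noteq> {} \<Longrightarrow> \<exists>x\<in>U. \<exists>y\<in>S - U. w x y > 0"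
    and "sum g S = 0"
  shows "\<exists>q. \<forall>x\<in>S. (\<Sum>y\<in>S. w x y * (q y - q x)) = g x"
  using assms
proof (induction S arbitrary: w g rule: finite_induct)
  case empty
  show ?case by simp
next
  case (insert v S)
  note nonneg = insert.prems(1) and sym = insert.prems(2) and cut = insert.prems(3)
  show ?case
  proof (cases "S = {}")
    case True
    then show ?thesis using insert.prems(4) by simp
  next
    case False
    define W where "W = (\<Sum>y\<in>S. w v y)"
    \<comment> \<open>The cut condition at \<open>{v}\<close> says that \<open>v\<close> is not
      isolated, so its total weight \<open>W\<close> can be divided by.\<close>
    obtain y0 where "y0 \<in> S" "w v y0 > 0"
      using cut[of "{v}"] False insert.hyps by auto
    then have W: "W > 0"
      unfolding W_def using nonneg insert.hyps by (intro sum_pos2[of S y0]) auto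
    \<comment> \<open>The added term is the weight of the path from \<open>x\<close> through
      \<open>v\<close> to \<open>y\<close>. The source \<open>g v\<close> is spread over the
      neighbours of \<open>v\<close> in proportion to their weights, so the total source stays
      zero.\<close>
    define w' where "w' x y = w x y + w x v * w v y / W" for x y
    define g' where "g' x = g x + w x v * g v / W" for x
    have "\<exists>q. \<forall>x\<in>S. (\<Sum>y\<in>S. w' x y * (q y - q x)) = g' x"
    proof (rule insert.IH)
      show "0 \<le> w' x y" if "x \<in> S" "y \<in> S" for x y
        using nonneg that W by (simp add: w'_def)
      show "w' x y = w' y x" if "x \<in> S" "y \<in> S" for x y
        using sym that by (simp add: w'_def mult.commute)
      have "(\<Sum>x\<in>S. w x v) = W"
        unfolding W_def using sym by (intro sum.cong) auto
      then have "sum g' S = sum g S + W * g v / W"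
        by (simp add: g'_def sum.distrib flip: sum_divide_distrib sum_distrib_right)
      also have "\<dots> = 0"
        using insert W by simp
      finally show "sum g' S = 0" .
      show "\<exists>x\<in>U. \<exists>y\<in>S - U. w' x y > 0" if U: "U \<subset> S" "U \<noteq> {}" for U
      proof -
        have ge: "w x y \<le> w' x y" if "x \<in> S" "y \<in> S" for x y
          using nonneg that W by (simp add: w'_def)
        obtain x y where xy: "x \<in> U" "y \<in> insert v S - U" "w x y > 0"
          using cut[of U] U by blast
        show ?thesis
        proof (cases "y = v")
          case False
          then show ?thesis using xy U ge[of x y] by (intro bexI[of _ x] bexI[of _ y]) auto
        next
          case True
          \<comment> \<open>The edge out of \<open>U\<close> ends in the vertex to be eliminated. An
            edge out of \<open>insert v U\<close> either starts in \<open>U\<close> and survives, or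
            starts at \<open>v\<close> and combines with the first edge into a path through
            \<open>v\<close>, which has positive weight in \<open>w'\<close>.\<close>
          have "insert v U \<subset> insert v S" using U insert.hyps(2) by auto
          from cut[OF this] obtain x' y' where x'y': "x' \<in> insert v U" "y' \<in> insert v S - insert v U" "w x' y' > 0"
            by auto
          show ?thesis
          proof (cases "x' = v")
            case False
            then show ?thesis using x'y' U ge[of x' y'] by (intro bexI[of _ x'] bexI[of _ y']) auto
          next
            case True
            have "w x v * w v y' / W > 0"
              using xy \<open>y = v\<close> x'y' True W by simp
            then have "w' x y' > 0"
              using nonneg[of x y'] xy x'y' U by (auto simp: w'_def intro!: add_nonneg_pos)
            then show ?thesis using xy x'y' by blast
          qed
        qed
      qed
    qed
    then obtain q' where q': "\<And>x. x \<in> S \<Longrightarrow> (\<Sum>y\<in>S. w' x y * (q' y - q' x)) = g' x" by blast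
    define qv where "qv = ((\<Sum>y\<in>S. w v y * q' y) - g v) / W"
    define q where "q = q'(v := qv)"
    have q: "q v = qv" "\<And>y. y \<in> S \<Longrightarrow> q y = q' y"
      using insert.hyps by (auto simp: q_def)
    \<comment> \<open>With \<open>c = qv\<close> this is the equation at \<open>v\<close>; with
      \<open>c = q' x\<close> it turns the part of \<open>w'\<close> routed through \<open>v\<close>
      back into the edge from \<open>x\<close> to \<open>v\<close>.\<close>
    have sum_v: "(\<Sum>y\<in>S. w v y * (q' y - c)) = W * (qv - c) + g v" for c
    proof -
      have "(\<Sum>y\<in>S. w v y * (q' y - c)) = (\<Sum>y\<in>S. w v y * q' y) - W * c"
        by (simp add: W_def right_diff_distrib sum_subtractf flip: sum_distrib_right)
      moreover have "W * qv = (\<Sum>y\<in>S. w v y * q' y) - g v"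
        using W by (simp add: qv_def)
      ultimately show ?thesis by (simp add: right_diff_distrib)
    qed
    have eq_v: "(\<Sum>y\<in>insert v S. w v y * (q y - q v)) = g v"
      using sum_v[of qv] insert.hyps by (simp add: q)
    moreover have "(\<Sum>y\<in>insert v S. w x y * (q y - q x)) = g x" if x: "x \<in> S" for x
    proof -
      have "g' x = (\<Sum>y\<in>S. w x y * (q' y - q' x)) + (\<Sum>y\<in>S. w x v / W * (w v y * (q' y - q' x)))"
        unfolding q'[OF x, symmetric] sum.distrib[symmetric]
        by (intro sum.cong) (simp_all add: w'_def distrib_right)
      also have "(\<Sum>y\<in>S. w x v / W * (w v y * (q' y - q' x))) = w x v / W * (W * (qv - q' x) + g v)"
        unfolding sum_distrib_left[symmetric] sum_v ..
      also have "\<dots> = w x v * (qv - q' x) + w x v * g v / W"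
        using W by (simp add: field_simps)
      finally show ?thesis
        using x insert.hyps by (simp add: q g'_def)
    qed
    ultimately show ?thesis by (intro exI[of _ q]) auto
  qed
qed

section \<open>Lattice points modulo the periods\<close>

definition residue :: "('d::finite \<Rightarrow> nat) \<Rightarrow> int ^ 'd \<Rightarrow> int ^ 'd" where
  "residue ell z = (\<chi> i. z $ i mod int (ell i))"

lemma ivec_nth [simp]: "ivec z $ i = real_of_int (z $ i)"
  by (simp add: ivec_def)

lemma ivec_add: "ivec (x + y) = ivec x + ivec y"
  and ivec_minus: "ivec (- x) = - ivec x"
  by (simp_all add: ivec_def vec_eq_iff)

lemma finite_int_vec_box:
  assumes "\<And>i. finite (I i)"
  shows "finite {z :: int ^ 'd::finite. \<forall>i. z $ i \<in> I i}"
proof (rule finite_subset)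
  show "{z :: int ^ 'd. \<forall>i. z $ i \<in> I i} \<subseteq> (\<lambda>f. vec_lambda f :: int ^ 'd) ` (PiE UNIV I)"
  proof
    fix z :: "int ^ 'd" assume "z \<in> {z. \<forall>i. z $ i \<in> I i}"
    then show "z \<in> (\<lambda>f. vec_lambda f :: int ^ 'd) ` (PiE UNIV I)"
      by (intro image_eqI[of _ _ "vec_nth z"]) (auto simp: vec_eq_iff)
  qed
  show "finite ((\<lambda>f. vec_lambda f :: int ^ 'd) ` (PiE UNIV I))"
    using assms by (intro finite_imageI finite_PiE) auto
qed

lemma finite_norm_ivec_le: "finite {\<xi> :: int ^ 'd::finite. norm (ivec \<xi>) \<le> c}"
proof (rule finite_subset)
  show "{\<xi> :: int ^ 'd. norm (ivec \<xi>) \<le> c} \<subseteq> {z. \<forall>i. z $ i \<in> {- \<lceil>c\<rceil>..\<lceil>c\<rceil>}}"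
  proof (clarify)
    fix \<xi> :: "int ^ 'd" and i assume "norm (ivec \<xi>) \<le> c"
    then have "\<bar>real_of_int (\<xi> $ i)\<bar> \<le> c"
      using component_le_norm_cart[of "ivec \<xi>" i] by simp
    then show "\<xi> $ i \<in> {- \<lceil>c\<rceil>..\<lceil>c\<rceil>}"
      by simp linarith
  qed
qed (intro finite_int_vec_box finite_atLeastAtMost_int)

context high_contrast_walk
begin

abbreviation "rep \<equiv> residue ell"
abbreviation "\<Gamma> \<equiv> period_lattice ell"

text \<open>One finite set of jumps that supports \<open>P0\<close>, \<open>V\<close> and the
  perturbed kernel for every \<epsilon>; all sums over the lattice become finite sums over
  it.\<close>

definition "steps = {\<xi> :: int ^ 'd. norm (ivec \<xi>) \<le> c1}"

text \<open>The phase k(x) read on the unscaled lattice, hence independent of \<epsilon>.\<close>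

definition "label z = (if rep z \<in> B then 0 else (THE j. j \<in> {1..M} \<and> rep z = xs j))"

lemma finite_steps: "finite steps"
  unfolding steps_def by (rule finite_norm_ivec_le)

lemma uminus_steps: "\<xi> \<in> steps \<Longrightarrow> - \<xi> \<in> steps"
  by (simp add: steps_def ivec_minus)

lemma rep_in_torus: "rep z \<in> torus ell"
proof -
  have "int (ell i) > 0" for i using periods_pos[of i] by simp
  then show ?thesis by (simp add: residue_def torus_def)
qed

lemma rep_torus: "z \<in> torus ell \<Longrightarrow> rep z = z"
  by (simp add: residue_def torus_def vec_eq_iff mod_pos_pos_trivial)

lemma rep_eq_iff: "rep x = rep y \<longleftrightarrow> x - y \<in> \<Gamma>"
  by (simp add: residue_def period_lattice_def vec_eq_iff mod_eq_dvd_iff)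

lemma rep_rep [simp]: "rep (rep z) = rep z"
  by (rule rep_torus[OF rep_in_torus])

lemma diff_rep: "z - rep z \<in> \<Gamma>"
  using rep_eq_iff[of z "rep z"] by simp

lemma rep_add_period: "\<gamma> \<in> \<Gamma> \<Longrightarrow> rep (z + \<gamma>) = rep z"
  by (simp add: rep_eq_iff)

lemma rep_add_rep: "rep (rep z + x) = rep (z + x)"
  using diff_rep[of z] by (simp add: rep_eq_iff period_lattice_def algebra_simps dvd_diff_commute)

lemma finite_torus: "finite (torus ell)"
proof -
  have "torus ell = {z. \<forall>i. z $ i \<in> {0..<int (ell i)}}" by (auto simp: torus_def)
  then show ?thesis using finite_int_vec_box[of "\<lambda>i. {0..<int (ell i)}"] by simp
qed

lemma subset_torus: "A \<subseteq> torus ell" "B \<subseteq> torus ell"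
  using torus_split(1) by auto

lemma periodic_ext_iff:
  assumes "S \<subseteq> torus ell"
  shows "z \<in> periodic_ext ell S \<longleftrightarrow> rep z \<in> S"
proof
  assume "z \<in> periodic_ext ell S"
  then obtain s \<gamma> where "z = s + \<gamma>" "s \<in> S" "\<gamma> \<in> \<Gamma>" by (auto simp: periodic_ext_def)
  then show "rep z \<in> S" using assms rep_torus[of s] by (auto simp: rep_add_period)
next
  assume "rep z \<in> S"
  then show "z \<in> periodic_ext ell S"
    using diff_rep[of z] unfolding periodic_ext_def by (intro CollectI exI[of _ "rep z"] exI[of _ "z - rep z"]) simp
qed

lemma finite_AB: "finite A" "finite B"
  using finite_torus subset_torus finite_subset by auto

lemma xs_in_A: "j \<in> {1..M} \<Longrightarrow> xs j \<in> A"
  using A_enum by (auto simp: bij_betw_def)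

lemma rep_xs: "j \<in> {1..M} \<Longrightarrow> rep (xs j) = xs j"
  using xs_in_A subset_torus rep_torus by auto

lemma label_eqI: "j \<in> {1..M} \<Longrightarrow> rep z = xs j \<Longrightarrow> label z = j"
proof -
  assume j: "j \<in> {1..M}" and z: "rep z = xs j"
  have "rep z \<notin> B" using torus_split(2) xs_in_A[OF j] z by auto
  moreover have "(THE j. j \<in> {1..M} \<and> rep z = xs j) = j"
    using A_enum j z by (intro the_equality) (auto simp: bij_betw_def dest: inj_onD)
  ultimately show ?thesis by (simp add: label_def)
qed

lemma label_cases:
  obtains "rep z \<in> B" "label z = 0" | j where "j \<in> {1..M}" "rep z = xs j" "label z = j"
proof (cases "rep z \<in> B")
  case True
  then show ?thesis using that by (simp add: label_def)
next
  case False
  then have "rep z \<in> A" using rep_in_torus[of z] torus_split(1) by auto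
  then obtain j where "j \<in> {1..M}" "rep z = xs j" using A_enum by (auto simp: bij_betw_def)
  then show ?thesis using that label_eqI by blast
qed

lemma label_le: "label z \<le> M"
  by (cases rule: label_cases[of z]) auto

lemma label_eq_0_iff: "label z = 0 \<longleftrightarrow> rep z \<in> B"
  by (cases rule: label_cases[of z]) (use torus_split(2) xs_in_A in auto)

lemma label_eq_iff:
  assumes "j \<in> {1..M}"
  shows "label z = j \<longleftrightarrow> rep z = xs j"
proof (cases rule: label_cases[of z])
  case 1
  then show ?thesis using assms torus_split(2) xs_in_A[OF assms] by auto
next
  case (2 i)
  then show ?thesis using label_eqI[OF assms] by auto
qed

lemma label_neq_0_iff: "label z \<noteq> 0 \<longleftrightarrow> rep z \<in> A"
  using label_eq_0_iff[of z] rep_in_torus[of z] torus_split by auto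

lemma label_cong: "rep x = rep y \<Longrightarrow> label x = label y"
  by (simp add: label_def)

lemma label_xs: "j \<in> {1..M} \<Longrightarrow> label (xs j) = j"
  by (simp add: label_eq_iff rep_xs)

lemma label_B: "y \<in> B \<Longrightarrow> label y = 0"
  using subset_torus by (auto simp: label_eq_0_iff rep_torus)

lemma kernel_rep:
  assumes "periodic_kernel ell q"
  shows "q (rep z) (rep z + \<xi>) = q z (z + \<xi>)"
proof -
  have "q (rep z + (z - rep z)) (rep z + (z - rep z) + \<xi>) = q (rep z) (rep z + \<xi>)"
    using assms diff_rep[of z] unfolding periodic_kernel_def by blast
  then show ?thesis by simp
qed

lemma kernel_zero: "finite_range c1 q \<Longrightarrow> \<xi> \<notin> steps \<Longrightarrow> q z (z + \<xi>) = 0"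
  by (auto simp: finite_range_def steps_def)

lemma infsum_kernel:
  assumes "finite_range c1 q"
  shows "(\<Sum>\<^sub>\<infinity>y\<in>UNIV. q z y * u y) = (\<Sum>\<xi>\<in>steps. q z (z + \<xi>) * u (z + \<xi>))"
proof -
  have "(\<Sum>\<^sub>\<infinity>y\<in>UNIV. q z y * u y) = (\<Sum>\<^sub>\<infinity>y\<in>(+) z ` steps. q z y * u y)"
  proof (rule infsum_cong_neutral)
    fix y assume "y \<in> UNIV - (+) z ` steps"
    then have "y - z \<notin> steps" by (auto simp: image_iff)
    then show "q z y * u y = 0" using kernel_zero[OF assms, of "y - z" z] by simp
  qed auto
  also have "\<dots> = (\<Sum>y\<in>(+) z ` steps. q z y * u y)"
    using finite_steps by simp
  also have "\<dots> = (\<Sum>\<xi>\<in>steps. q z (z + \<xi>) * u (z + \<xi>))"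
    by (subst sum.reindex) auto
  finally show ?thesis .
qed

lemma has_sum_kernel:
  assumes "finite_range c1 q" "(q z has_sum s) UNIV"
  shows "(\<Sum>\<xi>\<in>steps. q z (z + \<xi>)) = s"
  using infsum_kernel[OF assms(1), of z "\<lambda>_. 1"] infsumI[OF assms(2)] by simp

text \<open>Substitution of the jump \<open>\<xi> = y' + \<gamma> - y\<close> for the period
  \<gamma>.\<close>

lemma periodized_eq:
  assumes "finite_range c1 q" "y' \<in> torus ell"
  shows "periodized ell q y y' = (\<Sum>\<xi> | \<xi> \<in> steps \<and> rep (y + \<xi>) = y'. q y (y + \<xi>))"
proof -
  let ?R = "{\<xi> \<in> steps. rep (y + \<xi>) = y'}"
  have inj: "inj_on (\<lambda>\<xi>. y + \<xi> - y') ?R" by (auto simp: inj_on_def)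
  have "periodized ell q y y' = (\<Sum>\<^sub>\<infinity>\<gamma>\<in>(\<lambda>\<xi>. y + \<xi> - y') ` ?R. q y (y' + \<gamma>))"
    unfolding periodized_def
  proof (rule infsum_cong_neutral)
    fix \<gamma> assume \<gamma>: "\<gamma> \<in> \<Gamma> - (\<lambda>\<xi>. y + \<xi> - y') ` ?R"
    have "rep (y + (y' + \<gamma> - y)) = y'"
      using \<gamma> assms(2) by (simp add: rep_add_period rep_torus)
    then have "y' + \<gamma> - y \<notin> steps"
      using \<gamma> image_eqI[of \<gamma> "\<lambda>\<xi>. y + \<xi> - y'" "y' + \<gamma> - y" ?R] by auto
    then show "q y (y' + \<gamma>) = 0" using kernel_zero[OF assms(1), of "y' + \<gamma> - y" y] by simp
  next
    fix \<gamma> assume "\<gamma> \<in> (\<lambda>\<xi>. y + \<xi> - y') ` ?R - \<Gamma>"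
    moreover have "y + \<xi> - rep (y + \<xi>) \<in> \<Gamma>" for \<xi> by (rule diff_rep)
    ultimately show "q y (y' + \<gamma>) = 0" by auto
  qed auto
  also have "\<dots> = (\<Sum>\<gamma>\<in>(\<lambda>\<xi>. y + \<xi> - y') ` ?R. q y (y' + \<gamma>))"
    using finite_steps by simp
  also have "\<dots> = (\<Sum>\<xi>\<in>?R. q y (y + \<xi>))"
    by (subst sum.reindex[OF inj]) simp
  finally show ?thesis .
qed

section \<open>\<open>P0\<close> as a weighted graph on the torus\<close>

lemma P0_outside_eq_0: "rep x \<in> B \<Longrightarrow> rep y \<in> A \<Longrightarrow> P0 x y = 0"
  using P0_B_A by (simp add: periodic_ext_iff subset_torus)

lemma P0_nonneg: "0 \<le> P0 x y"
  using P0_stochastic by (simp add: stochastic_kernel_def)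

lemma P0_sum: "(\<Sum>\<xi>\<in>steps. P0 z (z + \<xi>)) = 1"
  using has_sum_kernel[OF P0_range] P0_stochastic by (simp add: stochastic_kernel_def)

lemma V_sum': "(\<Sum>\<xi>\<in>steps. V z (z + \<xi>)) = 0"
  using has_sum_kernel[OF V_range V_sum] .

text \<open>For \<open>y\<close> in the torus this is \<open>periodized ell P0 x y\<close>, in the
  finite form of \<open>periodized_eq\<close>.\<close>

definition "weight x y = (\<Sum>\<xi> | \<xi> \<in> steps \<and> rep (x + \<xi>) = y. P0 x (x + \<xi>))"

lemma weight_nonneg: "0 \<le> weight x y"
  unfolding weight_def by (intro sum_nonneg P0_nonneg)

text \<open>Reversing a jump and translating its starting point back into the torus matches the two
  sums term by term.\<close>

lemma weight_sym:
  assumes "x \<in> torus ell" "y \<in> torus ell"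
  shows "weight x y = weight y x"
proof -
  have rev: "rep (b + - \<xi>) = a \<and> P0 b (b + - \<xi>) = P0 a (a + \<xi>)"
    if ab: "a \<in> torus ell" "rep (a + \<xi>) = b" for a b \<xi>
  proof -
    have "rep (b + - \<xi>) = rep (a + \<xi> + - \<xi>)"
      unfolding ab(2)[symmetric] by (rule rep_add_rep)
    moreover have "P0 b (b + - \<xi>) = P0 (a + \<xi>) (a + \<xi> + - \<xi>)"
      unfolding ab(2)[symmetric] by (rule kernel_rep[OF P0_periodic])
    ultimately show ?thesis
      using P0_symmetric ab(1) by (simp add: rep_torus symmetric_kernel_def)
  qed
  show ?thesis
    unfolding weight_def
    by (rule sum.reindex_bij_witness[of _ uminus uminus])
      (use rev[OF assms(1)] rev[OF assms(2)] uminus_steps in auto)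
qed

text \<open>Connectedness in the form that \<open>graph_poisson_solvable\<close> expects. If no edge
  led from \<open>U\<close> to the rest of B, a path starting in \<open>U\<close> could never leave
  it.\<close>

lemma weight_cut:
  assumes "U \<subset> B" "U \<noteq> {}"
  shows "\<exists>x\<in>U. \<exists>y\<in>B - U. weight x y > 0"
proof (rule ccontr)
  assume no: "\<not> ?thesis"
  obtain x y where xy: "x \<in> U" "y \<in> B" "y \<notin> U" using assms by blast
  let ?r = "{(u, w). u \<in> torus ell \<and> w \<in> torus ell \<and> (\<exists>\<gamma>\<in>\<Gamma>. P0 u (w + \<gamma>) > 0)}"
  have "(x, y) \<in> ?r\<^sup>*"
    using B_connected[of x y] xy assms by (auto simp: connected_on_torus_def)
  then have "y \<in> U"
  proof (induction rule: rtrancl_induct)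
    case (step u w)
    then obtain \<gamma> where u: "u \<in> torus ell" and w: "w \<in> torus ell"
      and \<gamma>: "\<gamma> \<in> \<Gamma>" "P0 u (w + \<gamma>) > 0" by auto
    have rep_w: "rep (w + \<gamma>) = w" using \<gamma> w by (simp add: rep_add_period rep_torus)
    \<comment> \<open>Connecting paths run in the whole torus, but \<open>P0\<close> admits no step
      from B to A.\<close>
    have wB: "w \<in> B"
      using P0_outside_eq_0[of u "w + \<gamma>"] \<gamma> step(3) assms u w rep_w torus_split
      by (auto simp: rep_torus)
    have "P0 u (u + (w + \<gamma> - u)) \<le> weight u w"
      unfolding weight_def
    proof (rule member_le_sum)
      show "w + \<gamma> - u \<in> {\<xi> \<in> steps. rep (u + \<xi>) = w}"
        using \<gamma> rep_w kernel_zero[OF P0_range, of "w + \<gamma> - u" u] by auto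
    qed (use P0_nonneg finite_steps in auto)
    then have "weight u w > 0" using \<gamma> by simp
    then show ?case using no step(3) wB by auto
  qed (fact xy)
  with xy show False by simp
qed

lemma sum_steps_by_residue:
  assumes "rep z \<in> B"
  shows "(\<Sum>\<xi>\<in>steps. P0 z (z + \<xi>) * f (rep (z + \<xi>))) = (\<Sum>y\<in>B. weight (rep z) y * f y)"
proof -
  have "(\<Sum>y\<in>B. weight (rep z) y * f y)
      = (\<Sum>y\<in>B. \<Sum>\<xi> | \<xi> \<in> {\<xi> \<in> steps. rep (z + \<xi>) \<in> B} \<and> rep (z + \<xi>) = y. P0 z (z + \<xi>) * f (rep (z + \<xi>)))"
    by (intro sum.cong refl) (auto simp: weight_def sum_distrib_right rep_add_rep kernel_rep[OF P0_periodic]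
        intro!: sum.cong)
  also have "\<dots> = (\<Sum>\<xi>\<in>{\<xi> \<in> steps. rep (z + \<xi>) \<in> B}. P0 z (z + \<xi>) * f (rep (z + \<xi>)))"
    by (rule sum.group) (use finite_steps finite_AB in auto)
  also have "\<dots> = (\<Sum>\<xi>\<in>steps. P0 z (z + \<xi>) * f (rep (z + \<xi>)))"
    by (rule sum.mono_neutral_left)
      (use finite_steps P0_outside_eq_0[OF assms] rep_in_torus torus_split in auto)
  finally show ?thesis by simp
qed

text \<open>Poisson equation for the generator of the unperturbed walk on the extension of B; off
  it, \<open>q\<close> is only required to be periodic.\<close>

definition "cell_solution g q \<longleftrightarrow> (\<forall>z. q (rep z) = q z) \<and>
  (\<forall>z. label z = 0 \<longrightarrow> (\<Sum>\<xi>\<in>steps. P0 z (z + \<xi>) * (q (z + \<xi>) - q z)) = (g z :: real))"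

text \<open>Fredholm alternative on the finite graph B, whose kernel is the constants by
  connectedness; the solution is extended periodically.\<close>

lemma cell_problem_solvable:
  assumes "\<And>z. g (rep z) = g z" "(\<Sum>y\<in>B. g y) = 0"
  shows "\<exists>q. cell_solution g q"
proof -
  have "\<exists>q. \<forall>x\<in>B. (\<Sum>y\<in>B. weight x y * (q y - q x)) = g x"
    by (rule graph_poisson_solvable)
      (use finite_AB weight_nonneg weight_cut assms(2) subset_torus in \<open>auto intro!: weight_sym\<close>)
  then obtain q where q: "\<And>x. x \<in> B \<Longrightarrow> (\<Sum>y\<in>B. weight x y * (q y - q x)) = g x" by blast
  show ?thesis
    unfolding cell_solution_def
  proof (intro exI[of _ "\<lambda>z. q (rep z)"] conjI allI impI)
    fix z assume "label z = 0"
    then have z: "rep z \<in> B" by (simp add: label_eq_0_iff)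
    have "(\<Sum>\<xi>\<in>steps. P0 z (z + \<xi>) * (q (rep (z + \<xi>)) - q (rep z))) = g (rep z)"
      using sum_steps_by_residue[OF z, of "\<lambda>y. q y - q (rep z)"] q[OF z] by simp
    then show "(\<Sum>\<xi>\<in>steps. P0 z (z + \<xi>) * (q (rep (z + \<xi>)) - q (rep z))) = g z"
      using assms(1) by simp
  qed simp
qed

end

subsection \<open>Jump coefficients\<close>

context high_contrast_walk
begin

text \<open>Total \<open>V\<close>-weight from \<open>z\<close> into phase \<open>k\<close>. Over A
  these are the coefficients \<alpha> themselves; over B they vary with the site and only their mean
  is a coefficient.\<close>

definition "mass z k = (\<Sum>\<xi> | \<xi> \<in> steps \<and> label (z + \<xi>) = k. V z (z + \<xi>))"

lemma sum_V_by_label: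
  "(\<Sum>\<xi>\<in>steps. V z (z + \<xi>) * f (label (z + \<xi>))) = (\<Sum>k\<in>{0..M}. mass z k * f k)"
proof -
  have "(\<Sum>k\<in>{0..M}. mass z k * f k)
      = (\<Sum>k\<in>{0..M}. \<Sum>\<xi> | \<xi> \<in> steps \<and> label (z + \<xi>) = k. V z (z + \<xi>) * f (label (z + \<xi>)))"
    by (intro sum.cong refl) (auto simp: mass_def sum_distrib_right intro!: sum.cong)
  also have "\<dots> = (\<Sum>\<xi>\<in>steps. V z (z + \<xi>) * f (label (z + \<xi>)))"
    by (rule sum.group) (use finite_steps label_le in auto)
  finally show ?thesis by simp
qed

text \<open>The rows of \<open>V\<close> sum to zero, so the value at the present phase may be
  subtracted; this produces the jump form of the limit operator.\<close>

lemma sum_V_jumps: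
  "(\<Sum>\<xi>\<in>steps. V z (z + \<xi>) * f (label (z + \<xi>)))
    = (\<Sum>j\<in>{0..M} - {label z}. mass z j * (f j - f (label z)))"
proof -
  have "(\<Sum>k\<in>{0..M}. mass z k) = 0"
    using sum_V_by_label[of z "\<lambda>_. 1"] V_sum'[of z] by simp
  then have "(\<Sum>k\<in>{0..M}. mass z k * f k) = (\<Sum>k\<in>{0..M}. mass z k * (f k - f (label z)))"
    by (simp add: right_diff_distrib sum_subtractf flip: sum_distrib_right)
  also have "\<dots> = (\<Sum>j\<in>{0..M} - {label z}. mass z j * (f j - f (label z)))"
    by (rule sum.mono_neutral_right) auto
  finally show ?thesis by (simp add: sum_V_by_label)
qed

lemma mass_rep: "mass (rep z) k = mass z k"
proof -
  have "label (rep z + \<xi>) = label (z + \<xi>)" for \<xi> by (rule label_cong) (rule rep_add_rep)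
  then show ?thesis by (simp add: mass_def kernel_rep[OF V_periodic])
qed

lemma periodized_xs: "j \<in> {1..M} \<Longrightarrow> periodized ell V y (xs j) = mass y j"
  using periodized_eq[OF V_range, of "xs j" y] xs_in_A[of j] subset_torus(1)
  by (auto simp: mass_def label_eq_iff)

lemma sum_periodized_B: "(\<Sum>y\<in>B. periodized ell V x y) = mass x 0"
proof -
  have "(\<Sum>y\<in>B. periodized ell V x y)
      = (\<Sum>y\<in>B. \<Sum>\<xi> | \<xi> \<in> {\<xi> \<in> steps. rep (x + \<xi>) \<in> B} \<and> rep (x + \<xi>) = y. V x (x + \<xi>))"
    using subset_torus by (intro sum.cong refl) (auto simp: periodized_eq[OF V_range] intro!: sum.cong)
  also have "\<dots> = (\<Sum>\<xi>\<in>{\<xi> \<in> steps. rep (x + \<xi>) \<in> B}. V x (x + \<xi>))"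
    by (rule sum.group) (use finite_steps finite_AB in auto)
  finally show ?thesis by (simp add: mass_def label_eq_0_iff)
qed

text \<open>A phase \<open>k \<ge> 1\<close> has one site per period cell, so no average is
  involved.\<close>

lemma jump_coeff_eq_mass:
  assumes "label z \<noteq> 0" "j \<le> M"
  shows "jump_coeff ell V B xs (label z) j = mass z j"
proof -
  obtain k where k: "k \<in> {1..M}" "rep z = xs k" "label z = k"
    using assms(1) by (cases rule: label_cases[of z]) auto
  have "mass z j = mass (xs k) j" using mass_rep[of z j] k by simp
  then show ?thesis
    using k assms(2) by (cases "j = 0") (simp_all add: jump_coeff_def sum_periodized_B periodized_xs)
qed

lemma jump_coeff_0: "j \<in> {1..M} \<Longrightarrow> jump_coeff ell V B xs 0 j = 1 / real (card B) * (\<Sum>y\<in>B. mass y j)"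
  by (simp add: jump_coeff_def periodized_xs)

lemma P0_label_neq_eq_0:
  assumes "label x \<noteq> label y"
  shows "P0 x y = 0"
proof -
  consider "rep x \<in> B" "rep y \<in> A" | "rep x \<in> A" "rep y \<in> B" | "rep x \<in> A" "rep y \<in> A"
    using assms by (metis label_eq_0_iff label_neq_0_iff)
  then show ?thesis
  proof cases
    case 2
    then show ?thesis using P0_outside_eq_0[of y x] P0_symmetric by (simp add: symmetric_kernel_def)
  next
    case 3
    then show ?thesis using P0_A_off[of x y] assms by (auto simp: periodic_ext_iff subset_torus)
  qed (rule P0_outside_eq_0)
qed

lemma perturbed_stochastic: obtains \<epsilon> where "\<epsilon> > 0" "stochastic_kernel (perturbed P0 V \<epsilon>)"
proof -
  have "\<forall>\<^sub>F \<epsilon> in at_right 0. \<epsilon> > 0 \<and> stochastic_kernel (perturbed P0 V \<epsilon>)"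
    using perturbed_walk eventually_at_right_less by eventually_elim auto
  then show ?thesis
    using eventually_happens'[OF trivial_limit_at_right_real] that by blast
qed

text \<open>Where \<open>P0\<close> vanishes, an entry of a stochastic perturbed kernel is a
  positive multiple of the entry of \<open>V\<close>.\<close>

lemma V_nonneg:
  assumes "P0 x y = 0"
  shows "0 \<le> V x y"
proof -
  obtain \<epsilon> where "\<epsilon> > 0" "stochastic_kernel (perturbed P0 V \<epsilon>)" using perturbed_stochastic .
  then have "0 \<le> \<epsilon>\<^sup>2 * V x y" "\<epsilon>\<^sup>2 > 0"
    using assms by (simp_all add: stochastic_kernel_def perturbed_def) (metis add_0)
  then show ?thesis by (simp add: zero_le_mult_iff)
qed

lemma kernel_le_1:
  fixes q :: "'d kernel"
  assumes "stochastic_kernel q" "finite_range c1 q"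
  shows "q x y \<le> 1"
proof (cases "y - x \<in> steps")
  case True
  have "q x (x + (y - x)) \<le> (\<Sum>\<xi>\<in>steps. q x (x + \<xi>))"
    by (rule member_le_sum) (use True assms finite_steps in \<open>auto simp: stochastic_kernel_def\<close>)
  then show ?thesis using has_sum_kernel[OF assms(2), of x 1] assms(1) by (simp add: stochastic_kernel_def)
next
  case False
  then show ?thesis using kernel_zero[OF assms(2), of "y - x" x] by simp
qed

lemma P0_le_1: "P0 x y \<le> 1"
  by (rule kernel_le_1[OF P0_stochastic P0_range])

lemma perturbed_range: "finite_range c1 (perturbed P0 V \<epsilon>)"
  using P0_range V_range by (simp add: finite_range_def perturbed_def)

text \<open>For one admissible \<epsilon>, \<open>\<epsilon>\<^sup>2 * V x y\<close> is a difference
  of two numbers in the unit interval.\<close>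

lemma V_bounded: obtains C where "C \<ge> 0" "\<And>x y. \<bar>V x y\<bar> \<le> C"
proof -
  obtain \<epsilon> where \<epsilon>: "\<epsilon> > 0" "stochastic_kernel (perturbed P0 V \<epsilon>)" using perturbed_stochastic .
  have "\<bar>V x y\<bar> \<le> 1 / \<epsilon>\<^sup>2" for x y
  proof -
    have "0 \<le> perturbed P0 V \<epsilon> x y" "perturbed P0 V \<epsilon> x y \<le> 1"
      using \<epsilon> kernel_le_1[OF \<epsilon>(2) perturbed_range] by (auto simp: stochastic_kernel_def)
    then have "\<bar>\<epsilon>\<^sup>2 * V x y\<bar> \<le> 1"
      using P0_nonneg[of x y] P0_le_1[of x y] unfolding perturbed_def by linarith
    then show ?thesis using \<epsilon> by (simp add: abs_mult field_simps)
  qed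
  then show ?thesis using that[of "1 / \<epsilon>\<^sup>2"] by simp
qed

lemma mass_nonneg: "j \<noteq> label z \<Longrightarrow> 0 \<le> mass z j"
  unfolding mass_def by (intro sum_nonneg V_nonneg P0_label_neq_eq_0) auto

lemma jump_coeff_nonneg:
  assumes "k \<le> M" "j \<le> M" "j \<noteq> k"
  shows "0 \<le> jump_coeff ell V B xs k j"
proof (cases "k = 0")
  case True
  have "0 \<le> (\<Sum>y\<in>B. mass y j)"
    using assms True by (intro sum_nonneg mass_nonneg) (auto simp: label_B)
  then show ?thesis using assms True jump_coeff_0[of j] by auto
next
  case False
  then have "label (xs k) = k" using assms label_xs[of k] by auto
  then show ?thesis
    using jump_coeff_eq_mass[of "xs k" j] mass_nonneg[of j "xs k"] False assms by simp
qed

text \<open>If the intensity vanishes, all coefficients do, so that the division by zero is harmless.\<close>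

lemma limit_expr_eq:
  assumes "k \<le> M"
  shows "limit_expr ell P0 V B M xs h F (x, k) =
    (if k = 0 then \<Sum>i\<in>UNIV. \<Sum>m\<in>UNIV. eff_matrix P0 B h $ i $ m *
        partial_deriv i (partial_deriv m (\<lambda>x. F (x, 0))) x else 0) +
    (\<Sum>j\<in>{0..M} - {k}. jump_coeff ell V B xs k j * (F (x, j) - F (x, k)))"
proof -
  let ?I = "jump_intensity ell V B M xs k"
  have coeff: "?I * (jump_prob ell V B M xs k j * d) = jump_coeff ell V B xs k j * d" if j: "j \<in> {0..M} - {k}" for j d
  proof (cases "?I = 0")
    case True
    then have "jump_coeff ell V B xs k j = 0"
      using sum_nonneg_0[of "{0..M} - {k}" "jump_coeff ell V B xs k" j] jump_coeff_nonneg[OF assms] j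
      unfolding jump_intensity_def by auto
    then show ?thesis using True by simp
  qed (simp add: jump_prob_def)
  have "?I * (\<Sum>j\<in>{0..M} - {k}. jump_prob ell V B M xs k j * (F (x, j) - F (x, k)))
      = (\<Sum>j\<in>{0..M} - {k}. jump_coeff ell V B xs k j * (F (x, j) - F (x, k)))"
    unfolding sum_distrib_left by (intro sum.cong refl coeff)
  then show ?thesis by (simp add: limit_expr_def)
qed

lemma periodic_bounded:
  assumes "\<And>z. q (rep z) = q z"
  obtains C where "C \<ge> 0" "\<And>z. \<bar>q z :: real\<bar> \<le> C"
proof (rule that[of "\<Sum>y\<in>torus ell. \<bar>q y\<bar>"])
  fix z
  have "\<bar>q (rep z)\<bar> \<le> (\<Sum>y\<in>torus ell. \<bar>q y\<bar>)"
    by (rule member_le_sum) (use rep_in_torus finite_torus in auto)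
  then show "\<bar>q z\<bar> \<le> (\<Sum>y\<in>torus ell. \<bar>q y\<bar>)" by (simp add: assms)
qed (auto intro: sum_nonneg)

end

subsection \<open>Taylor expansion with uniform remainder\<close>

text \<open>Values are small outside radius \<open>R\<close>, and compactness handles the ball of
  radius \<open>R + 1\<close>. Capping the distance at 1 ensures that two points either both lie
  outside or both lie in the larger ball.\<close>

lemma vanishing_uniformly_continuous:
  fixes g :: "'a::euclidean_space \<Rightarrow> real"
  assumes "continuous_on UNIV g" "(g \<longlongrightarrow> 0) at_infinity"
  shows "uniformly_continuous_on UNIV g"
  unfolding uniformly_continuous_on_def
proof (intro allI impI)
  fix e :: real assume e: "e > 0"
  obtain R where R: "\<And>x. norm x \<ge> R \<Longrightarrow> \<bar>g x\<bar> < e / 2"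
    using tendstoD[OF assms(2), of "e/2"] e unfolding eventually_at_infinity by auto
  have "uniformly_continuous_on (cball 0 (R + 1)) g"
    by (intro compact_uniformly_continuous continuous_on_subset[OF assms(1)]) auto
  then obtain d where d: "d > 0" "\<And>x y. x \<in> cball 0 (R + 1) \<Longrightarrow> y \<in> cball 0 (R + 1) \<Longrightarrow>
      dist y x < d \<Longrightarrow> dist (g y) (g x) < e"
    using e unfolding uniformly_continuous_on_def by metis
  show "\<exists>d>0. \<forall>x\<in>UNIV. \<forall>y\<in>UNIV. dist y x < d \<longrightarrow> dist (g y) (g x) < e"
  proof (intro exI[of _ "min d 1"] conjI ballI impI)
    fix x y :: 'a assume xy: "dist y x < min d 1"
    show "dist (g y) (g x) < e"
    proof (cases "norm x \<ge> R \<and> norm y \<ge> R")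
      case True
      then show ?thesis using R[of x] R[of y] by (simp add: dist_real_def)
    next
      case False
      then have "norm x \<le> R + 1" "norm y \<le> R + 1"
        using xy norm_triangle_ineq2[of x y] norm_triangle_ineq2[of y x]
        by (auto simp: dist_norm norm_minus_commute)
      then show ?thesis using d(2)[of x y] xy by auto
    qed
  qed (use d in auto)
qed

lemma compact_support_tendsto_0:
  fixes g :: "'a::euclidean_space \<Rightarrow> real"
  assumes "compact K" "\<And>x. x \<notin> K \<Longrightarrow> g x = 0"
  shows "(g \<longlongrightarrow> 0) at_infinity"
proof -
  obtain R where R: "\<And>x. x \<in> K \<Longrightarrow> norm x \<le> R"
    using compact_imp_bounded[OF assms(1)] by (auto simp: bounded_iff)
  have "g x = 0" if "norm x \<ge> R + 1" for x
    using assms(2)[of x] R[of x] that by force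
  then have "\<forall>\<^sub>F x in at_infinity. g x = 0"
    unfolding eventually_at_infinity by blast
  then show ?thesis by (rule tendsto_eventually)
qed

lemma compact_support_bounded:
  fixes g :: "'a::euclidean_space \<Rightarrow> real"
  assumes "continuous_on UNIV g" "compact K" "\<And>x. x \<notin> K \<Longrightarrow> g x = 0"
  shows "bounded (range g)"
proof (rule bounded_subset)
  show "bounded (insert 0 (g ` K))"
    using compact_imp_bounded[OF compact_continuous_image[OF continuous_on_subset[OF assms(1)] assms(2)]]
    by simp
qed (use assms(3) in auto)

lemma has_derivative_partial:
  fixes f :: "real ^ 'd::finite \<Rightarrow> real"
  assumes "f differentiable (at x)"
  shows "(f has_derivative (\<lambda>v. \<Sum>i\<in>UNIV. v $ i * partial_deriv i f x)) (at x)"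
proof -
  let ?D = "frechet_derivative f (at x)"
  have D: "(f has_derivative ?D) (at x)" using assms frechet_derivative_works by blast
  then interpret bounded_linear ?D by (rule has_derivative_bounded_linear)
  have "?D v = (\<Sum>i\<in>UNIV. v $ i * partial_deriv i f x)" for v
  proof -
    have "?D (\<Sum>i\<in>UNIV. v $ i *s axis i 1) = (\<Sum>i\<in>UNIV. v $ i * partial_deriv i f x)"
      by (simp add: sum scaleR partial_deriv_def scalar_mult_eq_scaleR)
    then show ?thesis by (simp only: basis_expansion)
  qed
  then have "?D = (\<lambda>v. \<Sum>i\<in>UNIV. v $ i * partial_deriv i f x)" by blast
  then show ?thesis using D by simp
qed

lemma partial_deriv_line:
  fixes f :: "real ^ 'd::finite \<Rightarrow> real"
  assumes "f differentiable_on UNIV"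
  shows "((\<lambda>s. f (x + s *\<^sub>R v)) has_real_derivative (\<Sum>i\<in>UNIV. v $ i * partial_deriv i f (x + s *\<^sub>R v))) (at s)"
proof -
  have "f differentiable (at (x + s *\<^sub>R v))" using assms by (simp add: differentiable_on_def)
  note f = has_derivative_partial[OF this]
  have "((\<lambda>s. f (x + s *\<^sub>R v)) has_derivative
      (\<lambda>r. \<Sum>i\<in>UNIV. (r *\<^sub>R v) $ i * partial_deriv i f (x + s *\<^sub>R v))) (at s)"
    by (rule has_derivative_compose[where f = "\<lambda>s. x + s *\<^sub>R v" and g = f, OF _ f]) (auto intro!: derivative_eq_intros)
  moreover have "(\<lambda>r. \<Sum>i\<in>UNIV. (r *\<^sub>R v) $ i * partial_deriv i f (x + s *\<^sub>R v))
      = (*) (\<Sum>i\<in>UNIV. v $ i * partial_deriv i f (x + s *\<^sub>R v))"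
    by (auto simp: sum_distrib_left sum_distrib_right mult_ac intro!: sum.cong ext)
  ultimately show ?thesis by (simp add: has_field_derivative_def)
qed

lemma partial_deriv_support:
  fixes f :: "real ^ 'd::finite \<Rightarrow> real"
  assumes "closed K" "\<And>x. x \<notin> K \<Longrightarrow> f x = 0" "x \<notin> K"
  shows "partial_deriv i f x = 0"
proof -
  have "(f has_derivative (\<lambda>_. 0)) (at x)"
    by (rule has_derivative_transform_within_open[of "\<lambda>_. 0" _ _ UNIV "- K"]) (use assms in auto)
  then have "frechet_derivative f (at x) = (\<lambda>_. 0)" by (rule frechet_derivative_at[symmetric])
  then show ?thesis by (simp add: partial_deriv_def)
qed

locale smooth_function =
  fixes f :: "real ^ 'd::finite \<Rightarrow> real"
  assumes smooth: "smooth_compact_support f"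
begin

abbreviation "D i \<equiv> partial_deriv i f"
abbreviation "DD i m \<equiv> partial_deriv i (partial_deriv m f)"

lemma differentiable: "f differentiable_on UNIV" "D m differentiable_on UNIV"
  and continuous_DD: "continuous_on UNIV (DD i m)"
proof -
  have "times_cont_diff (Suc (Suc 0)) f" using smooth by (auto simp: smooth_compact_support_def)
  then show "f differentiable_on UNIV" "D m differentiable_on UNIV" "continuous_on UNIV (DD i m)"
    by auto
qed

lemma support_D: "x \<notin> closure {x. f x \<noteq> 0} \<Longrightarrow> D m x = 0"
  by (rule partial_deriv_support[of "closure {x. f x \<noteq> 0}"])
    (use closure_subset[of "{x. f x \<noteq> 0}"] in auto)

lemma support_DD: "x \<notin> closure {x. f x \<noteq> 0} \<Longrightarrow> DD i m x = 0"
  by (rule partial_deriv_support[of "closure {x. f x \<noteq> 0}"]) (auto intro: support_D)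

lemma compact_support: "compact (closure {x. f x \<noteq> 0})"
  using smooth by (simp add: smooth_compact_support_def)

lemma bounded_D: "bounded (range (D m))"
  by (rule compact_support_bounded[OF differentiable_imp_continuous_on[OF differentiable(2)] compact_support support_D])

lemma bounded_DD: "bounded (range (DD i m))"
  by (rule compact_support_bounded[OF continuous_DD compact_support support_DD])

lemma uniformly_continuous_DD: "uniformly_continuous_on UNIV (DD i m)"
  by (rule vanishing_uniformly_continuous[OF continuous_DD compact_support_tendsto_0[OF compact_support support_DD]])

lemma DD_modulus:
  assumes "\<eta> > 0"
  obtains d where "d > 0" "\<And>i m x y. norm (y - x) < d \<Longrightarrow> \<bar>DD i m y - DD i m x\<bar> \<le> \<eta>"
proof -
  have "\<forall>i m. \<exists>d>0. \<forall>x y :: real ^ 'd. norm (y - x) < d \<longrightarrow> \<bar>DD i m y - DD i m x\<bar> \<le> \<eta>"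
    using uniformly_continuous_DD assms unfolding uniformly_continuous_on_def dist_norm real_norm_def
    by (meson UNIV_I less_imp_le)
  then obtain d where d: "\<And>i m. d i m > 0" "\<And>i m x y. norm (y - x) < d i m \<Longrightarrow> \<bar>DD i m y - DD i m x\<bar> \<le> \<eta>"
    by metis
  show ?thesis
  proof (rule that[of "Min (range (\<lambda>(i, m). d i m))"])
    show "0 < Min (range (\<lambda>(i, m). d i m))" using d(1) by (subst Min_gr_iff) auto
    fix i m and x y :: "real ^ 'd" assume "norm (y - x) < Min (range (\<lambda>(i, m). d i m))"
    also have "Min (range (\<lambda>(i, m). d i m)) \<le> d i m" by (rule Min_le) (auto simp: image_iff)
    finally show "\<bar>DD i m y - DD i m x\<bar> \<le> \<eta>" by (rule d(2))
  qed
qed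

lemma taylor_D:
  assumes "\<eta> > 0"
  obtains d where "d > 0" "\<And>m x v. norm v < d \<Longrightarrow>
    \<bar>D m (x + v) - D m x - (\<Sum>i\<in>UNIV. v $ i * DD i m x)\<bar> \<le> \<eta> * norm v"
proof -
  let ?n = "real CARD('d)"
  \<comment> \<open>Each of the \<open>?n\<close> summands of the directional derivative receives an
    equal share of \<eta>.\<close>
  obtain d where d: "d > 0" "\<And>i m x y. norm (y - x) < d \<Longrightarrow> \<bar>DD i m y - DD i m x\<bar> \<le> \<eta> / ?n"
    using DD_modulus[of "\<eta> / ?n"] assms by auto
  show ?thesis
  proof (rule that[OF d(1)])
    fix m x and v :: "real ^ 'd" assume v: "norm v < d"
    have "\<exists>s>0. s < 1 \<and> D m (x + 1 *\<^sub>R v) - D m (x + 0 *\<^sub>R v) = (1 - 0) * (\<Sum>i\<in>UNIV. v $ i * DD i m (x + s *\<^sub>R v))"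
      by (rule MVT2) (use partial_deriv_line[OF differentiable(2)] in auto)
    then obtain s where s: "0 < s" "s < 1" "D m (x + v) - D m x = (\<Sum>i\<in>UNIV. v $ i * DD i m (x + s *\<^sub>R v))"
      by auto
    have "norm (x + s *\<^sub>R v - x) < d"
      using s v mult_right_mono[of s 1 "norm v"] by simp
    note DD = d(2)[OF this]
    have "D m (x + v) - D m x - (\<Sum>i\<in>UNIV. v $ i * DD i m x)
        = (\<Sum>i\<in>UNIV. v $ i * (DD i m (x + s *\<^sub>R v) - DD i m x))"
      unfolding s(3) by (simp add: right_diff_distrib sum_subtractf)
    also have "\<bar>\<dots>\<bar> \<le> (\<Sum>i\<in>(UNIV::'d set). norm v * (\<eta> / ?n))"
    proof (intro order_trans[OF sum_abs] sum_mono)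
      fix i
      show "\<bar>v $ i * (DD i m (x + s *\<^sub>R v) - DD i m x)\<bar> \<le> norm v * (\<eta> / ?n)"
        unfolding abs_mult by (intro mult_mono DD component_le_norm_cart) auto
    qed
    also have "\<dots> = \<eta> * norm v" by simp
    finally show "\<bar>D m (x + v) - D m x - (\<Sum>i\<in>UNIV. v $ i * DD i m x)\<bar> \<le> \<eta> * norm v" .
  qed
qed

lemma taylor_f:
  assumes "\<eta> > 0"
  obtains d where "d > 0" "\<And>x v. norm v < d \<Longrightarrow>
    \<bar>f (x + v) - f x - (\<Sum>m\<in>UNIV. v $ m * D m x) - 1/2 * (\<Sum>i\<in>UNIV. \<Sum>m\<in>UNIV. v $ i * v $ m * DD i m x)\<bar>
      \<le> \<eta> * (norm v)\<^sup>2"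
proof -
  let ?n = "real CARD('d)"
  \<comment> \<open>There are \<open>?n\<^sup>2\<close> mixed terms, and the factor 1/2 of the
    second order term is compensated by the 2.\<close>
  obtain d where d: "d > 0" "\<And>i m x y. norm (y - x) < d \<Longrightarrow> \<bar>DD i m y - DD i m x\<bar> \<le> 2 * \<eta> / ?n\<^sup>2"
    using DD_modulus[of "2 * \<eta> / ?n\<^sup>2"] assms by auto
  show ?thesis
  proof (rule that[OF d(1)])
    fix x and v :: "real ^ 'd" assume v: "norm v < d"
    \<comment> \<open>Successive derivatives along the segment, in the form that
      \<open>Maclaurin\<close> takes; it is used only up to order 2.\<close>
    let ?diff = "\<lambda>(n::nat) s. if n = 0 then f (x + s *\<^sub>R v)
      else if n = 1 then (\<Sum>m\<in>UNIV. v $ m * D m (x + s *\<^sub>R v))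
      else (\<Sum>i\<in>UNIV. \<Sum>m\<in>UNIV. v $ i * v $ m * DD i m (x + s *\<^sub>R v))"
    have "((\<lambda>s. \<Sum>m\<in>UNIV. v $ m * D m (x + s *\<^sub>R v)) has_real_derivative
        (\<Sum>m\<in>UNIV. v $ m * (\<Sum>i\<in>UNIV. v $ i * DD i m (x + s *\<^sub>R v)))) (at s)" for s
      by (intro DERIV_sum DERIV_cmult partial_deriv_line differentiable)
    moreover have "(\<Sum>m\<in>UNIV. v $ m * (\<Sum>i\<in>UNIV. v $ i * DD i m (x + s *\<^sub>R v)))
        = (\<Sum>i\<in>UNIV. \<Sum>m\<in>UNIV. v $ i * v $ m * DD i m (x + s *\<^sub>R v))" for s
      unfolding sum_distrib_left by (subst sum.swap) (simp add: mult_ac)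
    ultimately have deriv: "DERIV (?diff n) s :> ?diff (Suc n) s" if "n < 2" for n s
      using that partial_deriv_line[OF differentiable(1), of x v s] by (cases n) (auto simp: less_Suc_eq)
    have "\<exists>s. 0 < s \<and> s < 1 \<and>
        f (x + 1 *\<^sub>R v) = (\<Sum>n<2. ?diff n 0 / fact n * 1 ^ n) + ?diff 2 s / fact 2 * 1 ^ 2"
      by (rule Maclaurin) (use deriv in auto)
    then obtain s where s: "0 < s" "s < 1"
      "f (x + v) = f x + (\<Sum>m\<in>UNIV. v $ m * D m x) + 1/2 * (\<Sum>i\<in>UNIV. \<Sum>m\<in>UNIV. v $ i * v $ m * DD i m (x + s *\<^sub>R v))"
      by (auto simp: numeral_2_eq_2)
    have "norm (x + s *\<^sub>R v - x) < d"
      using s v mult_right_mono[of s 1 "norm v"] by simp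
    note DD = d(2)[OF this]
    have "f (x + v) - f x - (\<Sum>m\<in>UNIV. v $ m * D m x) - 1/2 * (\<Sum>i\<in>UNIV. \<Sum>m\<in>UNIV. v $ i * v $ m * DD i m x)
        = 1/2 * (\<Sum>i\<in>UNIV. \<Sum>m\<in>UNIV. v $ i * v $ m * (DD i m (x + s *\<^sub>R v) - DD i m x))"
      unfolding s(3) by (simp add: right_diff_distrib sum_subtractf)
    also have "\<bar>\<dots>\<bar> \<le> 1/2 * (\<Sum>i\<in>(UNIV::'d set). \<Sum>m\<in>(UNIV::'d set). norm v * norm v * (2 * \<eta> / ?n\<^sup>2))"
      unfolding abs_mult
    proof (intro mult_mono order_trans[OF sum_abs] sum_mono)
      fix i m
      show "\<bar>v $ i * v $ m * (DD i m (x + s *\<^sub>R v) - DD i m x)\<bar> \<le> norm v * norm v * (2 * \<eta> / ?n\<^sup>2)"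
        unfolding abs_mult by (intro mult_mono DD component_le_norm_cart) auto
    qed auto
    also have "\<dots> = \<eta> * (norm v)\<^sup>2" by (simp add: power2_eq_square)
    finally show "\<bar>f (x + v) - f x - (\<Sum>m\<in>UNIV. v $ m * D m x)
        - 1/2 * (\<Sum>i\<in>UNIV. \<Sum>m\<in>UNIV. v $ i * v $ m * DD i m x)\<bar> \<le> \<eta> * (norm v)\<^sup>2" .
  qed
qed

end

subsection \<open>Two-scale expansion\<close>

definition negligible :: "(real \<Rightarrow> 'z \<Rightarrow> real) \<Rightarrow> bool" where
  "negligible \<phi> \<longleftrightarrow> (\<forall>\<eta>>0. \<forall>\<^sub>F \<epsilon> in at_right 0. \<forall>z. \<bar>\<phi> \<epsilon> z\<bar> \<le> \<eta>)"

text \<open>The class of coefficients by which \<open>negligible\<close> errors may be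
  multiplied.\<close>

definition unif_bounded :: "(real \<Rightarrow> 'z \<Rightarrow> real) \<Rightarrow> bool" where
  "unif_bounded c \<longleftrightarrow> (\<exists>C. \<forall>\<epsilon> z. \<bar>c \<epsilon> z\<bar> \<le> C)"

lemma unif_bounded_const: "unif_bounded (\<lambda>_ _. c)"
  by (auto simp: unif_bounded_def)

lemma unif_bounded_add: "unif_bounded a \<Longrightarrow> unif_bounded b \<Longrightarrow> unif_bounded (\<lambda>\<epsilon> z. a \<epsilon> z + b \<epsilon> z)"
  unfolding unif_bounded_def by (meson abs_triangle_ineq add_mono order_trans)

lemma unif_bounded_minus: "unif_bounded a \<Longrightarrow> unif_bounded b \<Longrightarrow> unif_bounded (\<lambda>\<epsilon> z. a \<epsilon> z - b \<epsilon> z)"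
  unfolding unif_bounded_def by (meson abs_triangle_ineq4 add_mono order_trans)

lemma unif_bounded_mult:
  assumes "unif_bounded a" "unif_bounded b"
  shows "unif_bounded (\<lambda>\<epsilon> z. a \<epsilon> z * b \<epsilon> z)"
proof -
  obtain C1 C2 where C: "\<And>\<epsilon> z. \<bar>a \<epsilon> z\<bar> \<le> C1" "\<And>\<epsilon> z. \<bar>b \<epsilon> z\<bar> \<le> C2"
    using assms by (auto simp: unif_bounded_def)
  have "0 \<le> C1" using C(1) abs_ge_zero order_trans by blast
  then have "\<bar>a \<epsilon> z * b \<epsilon> z\<bar> \<le> C1 * C2" for \<epsilon> z
    unfolding abs_mult using C by (intro mult_mono) auto
  then show ?thesis by (auto simp: unif_bounded_def)
qed

lemma unif_bounded_sum:
  "(\<And>i. i \<in> I \<Longrightarrow> unif_bounded (a i)) \<Longrightarrow> unif_bounded (\<lambda>\<epsilon> z. \<Sum>i\<in>I. a i \<epsilon> z)"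
  by (induction I rule: infinite_finite_induct) (auto intro: unif_bounded_add unif_bounded_const)

lemma unif_bounded_range: "bounded (range g) \<Longrightarrow> unif_bounded (\<lambda>\<epsilon> z. g (p \<epsilon> z) :: real)"
  by (auto simp: unif_bounded_def bounded_iff)

lemma negligible_add:
  assumes "negligible a" "negligible b"
  shows "negligible (\<lambda>\<epsilon> z. a \<epsilon> z + b \<epsilon> z)"
  unfolding negligible_def
proof (intro allI impI)
  fix \<eta> :: real assume "\<eta> > 0"
  then have "\<forall>\<^sub>F \<epsilon> in at_right 0. \<forall>z. \<bar>a \<epsilon> z\<bar> \<le> \<eta> / 2" "\<forall>\<^sub>F \<epsilon> in at_right 0. \<forall>z. \<bar>b \<epsilon> z\<bar> \<le> \<eta> / 2"
    using assms unfolding negligible_def by (meson half_gt_zero)+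
  then show "\<forall>\<^sub>F \<epsilon> in at_right 0. \<forall>z. \<bar>a \<epsilon> z + b \<epsilon> z\<bar> \<le> \<eta>"
  proof eventually_elim
    case (elim \<epsilon>)
    have "\<bar>a \<epsilon> z + b \<epsilon> z\<bar> \<le> \<eta>" for z
      using abs_triangle_ineq[of "a \<epsilon> z" "b \<epsilon> z"] elim(1)[rule_format, of z] elim(2)[rule_format, of z] by linarith
    then show ?case by blast
  qed
qed

lemma negligible_0: "negligible (\<lambda>_ _. 0)"
  by (auto simp: negligible_def)

lemma negligible_sum:
  "(\<And>i. i \<in> I \<Longrightarrow> negligible (a i)) \<Longrightarrow> negligible (\<lambda>\<epsilon> z. \<Sum>i\<in>I. a i \<epsilon> z)"
  by (induction I rule: infinite_finite_induct) (auto intro: negligible_add negligible_0)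

lemma negligible_mult:
  assumes "unif_bounded c" "negligible a"
  shows "negligible (\<lambda>\<epsilon> z. c \<epsilon> z * a \<epsilon> z)"
  unfolding negligible_def
proof (intro allI impI)
  fix \<eta> :: real assume \<eta>: "\<eta> > 0"
  obtain C where C: "\<And>\<epsilon> z. \<bar>c \<epsilon> z\<bar> \<le> C" using assms by (auto simp: unif_bounded_def)
  have C0: "0 \<le> C" using C abs_ge_zero order_trans by blast
  then have "\<forall>\<^sub>F \<epsilon> in at_right 0. \<forall>z. \<bar>a \<epsilon> z\<bar> \<le> \<eta> / (C + 1)"
    using assms \<eta> by (auto simp: negligible_def)
  then show "\<forall>\<^sub>F \<epsilon> in at_right 0. \<forall>z. \<bar>c \<epsilon> z * a \<epsilon> z\<bar> \<le> \<eta>"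
  proof eventually_elim
    case (elim \<epsilon>)
    have "\<bar>c \<epsilon> z * a \<epsilon> z\<bar> \<le> (C + 1) * (\<eta> / (C + 1))" for z
      unfolding abs_mult by (rule mult_mono) (use C[of \<epsilon> z] C0 elim in auto)
    then show ?case using C0 by simp
  qed
qed

lemma negligible_mult_right:
  "unif_bounded c \<Longrightarrow> negligible a \<Longrightarrow> negligible (\<lambda>\<epsilon> z. a \<epsilon> z * c \<epsilon> z)"
  using negligible_mult[of c a] by (simp add: mult.commute)

lemma negligible_if:
  "negligible a \<Longrightarrow> negligible (\<lambda>\<epsilon> z. if Q z then a \<epsilon> z else 0)"
  unfolding negligible_def by (erule all_forward, erule imp_forward, assumption, erule eventually_mono) auto

lemma negligible_tendsto:
  assumes "(g \<longlongrightarrow> 0) (at_right 0)"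
  shows "negligible (\<lambda>\<epsilon> _. g \<epsilon>)"
  unfolding negligible_def
proof (intro allI impI)
  fix \<eta> :: real assume "\<eta> > 0"
  from tendstoD[OF assms this] show "\<forall>\<^sub>F \<epsilon> in at_right 0. \<forall>z. \<bar>g \<epsilon>\<bar> \<le> \<eta>"
    by eventually_elim auto
qed

lemma negligible_id: "negligible (\<lambda>\<epsilon> _. \<epsilon>)" and negligible_square: "negligible (\<lambda>\<epsilon> _. \<epsilon>\<^sup>2)"
proof -
  show "negligible (\<lambda>\<epsilon> _. \<epsilon>)" by (intro negligible_tendsto tendsto_ident_at)
  have "((\<lambda>\<epsilon>::real. \<epsilon>\<^sup>2) \<longlongrightarrow> 0\<^sup>2) (at_right 0)" by (intro tendsto_intros)
  then show "negligible (\<lambda>\<epsilon> _. \<epsilon>\<^sup>2)" by (intro negligible_tendsto) simp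
qed

lemma negligible_reindex: "negligible a \<Longrightarrow> negligible (\<lambda>\<epsilon> z. a \<epsilon> (p z))"
  unfolding negligible_def by (erule all_forward, erule imp_forward, assumption, erule eventually_mono) auto

text \<open>Lets the error term depend on the phase of the site: finitely many phases share one
  threshold for \<epsilon>.\<close>

lemma negligible_select:
  assumes "finite K" "\<And>z. \<kappa> z \<in> K" "\<And>k. k \<in> K \<Longrightarrow> negligible (a k)"
  shows "negligible (\<lambda>\<epsilon> z. a (\<kappa> z) \<epsilon> z)"
  unfolding negligible_def
proof (intro allI impI)
  fix \<eta> :: real assume \<eta>: "\<eta> > 0"
  have "\<forall>\<^sub>F \<epsilon> in at_right 0. \<forall>k\<in>K. \<forall>z. \<bar>a k \<epsilon> z\<bar> \<le> \<eta>"
    using assms \<eta> by (intro eventually_ball_finite) (auto simp: negligible_def)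
  then show "\<forall>\<^sub>F \<epsilon> in at_right 0. \<forall>z. \<bar>a (\<kappa> z) \<epsilon> z\<bar> \<le> \<eta>"
    by eventually_elim (use assms(2) in auto)
qed

lemma sum_swap_left:
  fixes a :: "'k \<Rightarrow> real"
  shows "(\<Sum>x\<in>A. \<Sum>k\<in>K. a k * g x k) = (\<Sum>k\<in>K. a k * (\<Sum>x\<in>A. g x k))"
  unfolding sum_distrib_left by (rule sum.swap)

lemma sum_swap_left2:
  fixes a :: "'i \<Rightarrow> 'k \<Rightarrow> real"
  shows "(\<Sum>x\<in>A. \<Sum>i\<in>I. \<Sum>k\<in>K. a i k * g x i k) = (\<Sum>i\<in>I. \<Sum>k\<in>K. a i k * (\<Sum>x\<in>A. g x i k))"
  by (subst sum.swap) (simp only: sum_swap_left)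

lemma eventually_small_step:
  fixes v :: "'a::real_normed_vector"
  assumes "d > 0"
  shows "\<forall>\<^sub>F \<epsilon> in at_right 0. norm (\<epsilon> *\<^sub>R v) < d"
proof -
  have "((\<lambda>\<epsilon>. \<epsilon> *\<^sub>R v) \<longlongrightarrow> 0 *\<^sub>R v) (at_right 0)" by (intro tendsto_intros)
  from tendstoD[OF this assms] show ?thesis by simp
qed

text \<open>A lattice jump has length of order \<epsilon> after scaling, so uniform continuity makes
  its effect vanish.\<close>

lemma negligible_shift:
  fixes g :: "real ^ 'd::finite \<Rightarrow> real"
  assumes "uniformly_continuous_on UNIV g"
  shows "negligible (\<lambda>\<epsilon> z. g (\<epsilon> *\<^sub>R ivec z + \<epsilon> *\<^sub>R ivec \<xi>) - g (\<epsilon> *\<^sub>R ivec z))"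
  unfolding negligible_def
proof (intro allI impI)
  fix \<eta> :: real assume \<eta>: "\<eta> > 0"
  obtain d where d: "d > 0" "\<And>x y. dist y x < d \<Longrightarrow> dist (g y) (g x) < \<eta>"
    using uniformly_continuous_onE[OF assms \<eta>] by (metis UNIV_I)
  from eventually_small_step[OF d(1), of "ivec \<xi>"]
  show "\<forall>\<^sub>F \<epsilon> in at_right 0. \<forall>z. \<bar>g (\<epsilon> *\<^sub>R ivec z + \<epsilon> *\<^sub>R ivec \<xi>) - g (\<epsilon> *\<^sub>R ivec z)\<bar> \<le> \<eta>"
  proof eventually_elim
    case (elim \<epsilon>)
    have "dist (g (\<epsilon> *\<^sub>R ivec z + \<epsilon> *\<^sub>R ivec \<xi>)) (g (\<epsilon> *\<^sub>R ivec z)) < \<eta>" for z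
      by (rule d(2)) (use elim in \<open>simp add: dist_norm\<close>)
    then show ?case by (auto simp: dist_real_def less_imp_le)
  qed
qed

lemma C0E_component:
  assumes "F \<in> C0E M"
  shows "uniformly_continuous_on UNIV (\<lambda>x. apply_bcontfun F (x, k))"
proof (rule vanishing_uniformly_continuous)
  show "continuous_on UNIV (\<lambda>x. apply_bcontfun F (x, k))"
    by (rule continuous_on_compose2[OF continuous_on_apply_bcontfun[of UNIV F]]) (auto intro!: continuous_intros)
  show "((\<lambda>x. apply_bcontfun F (x, k)) \<longlongrightarrow> 0) at_infinity"
  proof (cases "k \<le> M")
    case True
    then show ?thesis using assms by (simp add: C0E_def)
  next
    case False
    then have "(\<lambda>x. apply_bcontfun F (x, k)) = (\<lambda>_. 0)" using assms by (auto simp: C0E_def)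
    then show ?thesis by simp
  qed
qed

lemma bcontfun_component_bounded:
  fixes F :: "('a::topological_space \<times> 'b::topological_space) \<Rightarrow>\<^sub>C real"
  shows "bounded (range (\<lambda>x. apply_bcontfun F (x, k)))"
  using norm_bounded[of F] by (auto simp: bounded_iff)

section \<open>Taylor remainders on the scaled lattice\<close>

context smooth_function
begin

lemma negligible_taylor_D:
  "negligible (\<lambda>\<epsilon> z. (D m (\<epsilon> *\<^sub>R ivec z + \<epsilon> *\<^sub>R ivec \<xi>) - D m (\<epsilon> *\<^sub>R ivec z)
     - (\<Sum>i\<in>UNIV. (\<epsilon> *\<^sub>R ivec \<xi>) $ i * DD i m (\<epsilon> *\<^sub>R ivec z))) / \<epsilon>)"
  unfolding negligible_def
proof (intro allI impI)
  fix \<eta> :: real assume \<eta>: "\<eta> > 0"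
  let ?c = "norm (ivec \<xi>) + 1"
  have c: "?c > 0" using norm_ge_zero[of "ivec \<xi>"] by linarith
  then have "\<eta> / ?c > 0" using \<eta> by simp
  from taylor_D[OF this] obtain d where d: "d > 0" "\<And>m x v. norm v < d \<Longrightarrow>
    \<bar>D m (x + v) - D m x - (\<Sum>i\<in>UNIV. v $ i * DD i m x)\<bar> \<le> \<eta> / ?c * norm v" by blast
  from eventually_small_step[OF d(1), of "ivec \<xi>"] eventually_at_right_less[of 0]
  show "\<forall>\<^sub>F \<epsilon> in at_right 0. \<forall>z. \<bar>(D m (\<epsilon> *\<^sub>R ivec z + \<epsilon> *\<^sub>R ivec \<xi>) - D m (\<epsilon> *\<^sub>R ivec z)
     - (\<Sum>i\<in>UNIV. (\<epsilon> *\<^sub>R ivec \<xi>) $ i * DD i m (\<epsilon> *\<^sub>R ivec z))) / \<epsilon>\<bar> \<le> \<eta>"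
  proof eventually_elim
    case (elim \<epsilon>)
    have "\<eta> / ?c * norm (\<epsilon> *\<^sub>R ivec \<xi>) \<le> \<eta> / ?c * (\<epsilon> * ?c)"
      using elim c \<eta> by (intro mult_left_mono) auto
    also have "\<dots> = \<eta> * \<epsilon>" using c by simp
    finally show ?case
      using elim order_trans[OF d(2)[OF elim(1)]] unfolding abs_divide
      by (simp add: pos_divide_le_eq del: norm_scaleR)
  qed
qed

lemma negligible_taylor_f:
  "negligible (\<lambda>\<epsilon> z. (f (\<epsilon> *\<^sub>R ivec z + \<epsilon> *\<^sub>R ivec \<xi>) - f (\<epsilon> *\<^sub>R ivec z)
     - (\<Sum>m\<in>UNIV. (\<epsilon> *\<^sub>R ivec \<xi>) $ m * D m (\<epsilon> *\<^sub>R ivec z))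
     - 1/2 * (\<Sum>i\<in>UNIV. \<Sum>m\<in>UNIV. (\<epsilon> *\<^sub>R ivec \<xi>) $ i * (\<epsilon> *\<^sub>R ivec \<xi>) $ m * DD i m (\<epsilon> *\<^sub>R ivec z))) / \<epsilon>\<^sup>2)"
  unfolding negligible_def
proof (intro allI impI)
  fix \<eta> :: real assume \<eta>: "\<eta> > 0"
  let ?c = "(norm (ivec \<xi>))\<^sup>2 + 1"
  have c: "?c > 0" using zero_le_power2[of "norm (ivec \<xi>)"] by linarith
  then have "\<eta> / ?c > 0" using \<eta> by simp
  from taylor_f[OF this] obtain d where d: "d > 0" "\<And>x v. norm v < d \<Longrightarrow>
    \<bar>f (x + v) - f x - (\<Sum>m\<in>UNIV. v $ m * D m x) - 1/2 * (\<Sum>i\<in>UNIV. \<Sum>m\<in>UNIV. v $ i * v $ m * DD i m x)\<bar>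
      \<le> \<eta> / ?c * (norm v)\<^sup>2" by blast
  from eventually_small_step[OF d(1), of "ivec \<xi>"] eventually_at_right_less[of 0]
  show "\<forall>\<^sub>F \<epsilon> in at_right 0. \<forall>z. \<bar>(f (\<epsilon> *\<^sub>R ivec z + \<epsilon> *\<^sub>R ivec \<xi>) - f (\<epsilon> *\<^sub>R ivec z)
     - (\<Sum>m\<in>UNIV. (\<epsilon> *\<^sub>R ivec \<xi>) $ m * D m (\<epsilon> *\<^sub>R ivec z))
     - 1/2 * (\<Sum>i\<in>UNIV. \<Sum>m\<in>UNIV. (\<epsilon> *\<^sub>R ivec \<xi>) $ i * (\<epsilon> *\<^sub>R ivec \<xi>) $ m * DD i m (\<epsilon> *\<^sub>R ivec z))) / \<epsilon>\<^sup>2\<bar> \<le> \<eta>"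
  proof eventually_elim
    case (elim \<epsilon>)
    have "\<eta> / ?c * (norm (\<epsilon> *\<^sub>R ivec \<xi>))\<^sup>2 \<le> \<eta> / ?c * (\<epsilon>\<^sup>2 * ?c)"
      using elim c \<eta> by (intro mult_left_mono) (auto simp: power_mult_distrib)
    also have "\<dots> = \<eta> * \<epsilon>\<^sup>2" using c by simp
    finally show ?case
      using elim order_trans[OF d(2)[OF elim(1)]] unfolding abs_divide
      by (simp add: pos_divide_le_eq del: norm_scaleR)
  qed
qed

end

locale walk_with_corrector = high_contrast_walk ell P0 V c1 A B M xs
  for ell :: "'d::finite \<Rightarrow> nat" and P0 V :: "'d kernel" and c1 A B M xs +
  fixes h :: "int ^ 'd \<Rightarrow> real ^ 'd"
  assumes corrector: "periodic_corrector ell P0 B h"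
begin

text \<open>\<open>h\<close> is controlled only on the extension of B. Setting it to zero elsewhere
  gives a function periodic on the whole lattice, hence bounded.\<close>

definition "H z = (if rep z \<in> B then h (rep z) else 0)"

lemma H_periodic: "H (rep z) = H z"
  by (simp add: H_def)

lemma P0_sum_mult: "(\<Sum>\<xi>\<in>steps. P0 z (z + \<xi>) * c) = c"
  using P0_sum[of z] by (simp flip: sum_distrib_right)

lemma P0_neq_0_label: "P0 z (z + \<xi>) \<noteq> 0 \<Longrightarrow> label (z + \<xi>) = label z"
  using P0_label_neq_eq_0 by metis

lemma H_eq: "rep z \<in> B \<Longrightarrow> H z = h z"
proof -
  assume z: "rep z \<in> B"
  then have "rep z \<in> periodic_ext ell B" by (simp add: periodic_ext_iff subset_torus)
  then have "h (rep z + (z - rep z)) = h (rep z)"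
    using corrector diff_rep[of z] unfolding periodic_corrector_def by blast
  then show ?thesis using z by (simp add: H_def)
qed

text \<open>The corrector equation removes the terms of order \<open>1 / \<epsilon>\<close>.
  Unperturbed jumps from B stay in B, where \<open>H\<close> and \<open>h\<close> agree.\<close>

lemma first_order_cancels:
  assumes "label z = 0"
  shows "(\<Sum>\<xi>\<in>steps. P0 z (z + \<xi>) * (ivec \<xi> $ m + H (z + \<xi>) $ m - H z $ m)) = 0"
proof -
  have z: "rep z \<in> B" using assms by (simp add: label_eq_0_iff)
  have "(\<Sum>\<xi>\<in>steps. P0 z (z + \<xi>) * (ivec \<xi> $ m + H (z + \<xi>) $ m - H z $ m))
      = (\<Sum>\<xi> | P0 z (z + \<xi>) \<noteq> 0. P0 z (z + \<xi>) * (ivec \<xi> $ m + h (z + \<xi>) $ m - h z $ m))"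
  proof (rule sum.mono_neutral_cong_right)
    show "{\<xi>. P0 z (z + \<xi>) \<noteq> 0} \<subseteq> steps" using kernel_zero[OF P0_range] by blast
    fix \<xi> assume "\<xi> \<in> {\<xi>. P0 z (z + \<xi>) \<noteq> 0}"
    then have "rep (z + \<xi>) \<in> B" using P0_neq_0_label assms by (auto simp flip: label_eq_0_iff)
    then show "P0 z (z + \<xi>) * (ivec \<xi> $ m + H (z + \<xi>) $ m - H z $ m) =
        P0 z (z + \<xi>) * (ivec \<xi> $ m + h (z + \<xi>) $ m - h z $ m)"
      using z by (simp add: H_eq)
  qed (use finite_steps in auto)
  also have "\<dots> = (\<Sum>\<xi> | P0 z (z + \<xi>) \<noteq> 0. P0 z (z + \<xi>) *\<^sub>R (ivec \<xi> + h (z + \<xi>) - h z)) $ m"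
    by simp
  also have "\<dots> = 0"
    using corrector z by (simp add: periodic_corrector_def periodic_ext_iff subset_torus)
  finally show ?thesis .
qed

text \<open>Local second order coefficient before averaging: its mean over B is the entry of
  \<Theta>.\<close>

definition "\<Phi> i m z = (\<Sum>\<xi>\<in>steps. P0 z (z + \<xi>) * (1/2 * ivec \<xi> $ i * ivec \<xi> $ m + ivec \<xi> $ i * H (z + \<xi>) $ m))"

lemma \<Phi>_rep: "\<Phi> i m (rep z) = \<Phi> i m z"
proof -
  have "H (rep z + \<xi>) = H (z + \<xi>)" for \<xi> using rep_add_rep by (simp add: H_def)
  then show ?thesis by (simp add: \<Phi>_def kernel_rep[OF P0_periodic])
qed

text \<open>This is the solvability condition for the second corrector.\<close>

lemma eff_matrix_eq: "real (card B) * eff_matrix P0 B h $ i $ m = (\<Sum>y\<in>B. \<Phi> i m y)"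
proof -
  have "card B > 0" using finite_AB torus_split by (simp add: card_gt_0_iff)
  then have "real (card B) * eff_matrix P0 B h $ i $ m =
      (\<Sum>y\<in>B. \<Sum>\<xi> | P0 y (y + \<xi>) \<noteq> 0. P0 y (y + \<xi>) * (ivec \<xi> $ i * ((1/2) *\<^sub>R ivec \<xi> + h (y + \<xi>)) $ m))"
    by (simp add: eff_matrix_def)
  also have "\<dots> = (\<Sum>y\<in>B. \<Phi> i m y)"
  proof (rule sum.cong[OF refl])
    fix y assume "y \<in> B"
    show "(\<Sum>\<xi> | P0 y (y + \<xi>) \<noteq> 0. P0 y (y + \<xi>) * (ivec \<xi> $ i * ((1/2) *\<^sub>R ivec \<xi> + h (y + \<xi>)) $ m)) = \<Phi> i m y"
      unfolding \<Phi>_def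
    proof (rule sum.mono_neutral_cong_left)
      show "{\<xi>. P0 y (y + \<xi>) \<noteq> 0} \<subseteq> steps" using kernel_zero[OF P0_range] by blast
      fix \<xi> assume "\<xi> \<in> {\<xi>. P0 y (y + \<xi>) \<noteq> 0}"
      then have "rep (y + \<xi>) \<in> B"
        using P0_neq_0_label label_B[OF \<open>y \<in> B\<close>] by (auto simp flip: label_eq_0_iff)
      then show "P0 y (y + \<xi>) * (ivec \<xi> $ i * ((1/2) *\<^sub>R ivec \<xi> + h (y + \<xi>)) $ m) =
          P0 y (y + \<xi>) * (1/2 * ivec \<xi> $ i * ivec \<xi> $ m + ivec \<xi> $ i * H (y + \<xi>) $ m)"
        by (simp add: H_eq algebra_simps)
    qed (use finite_steps in auto)
  qed
  finally show ?thesis .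
qed

text \<open>Any solution serves: only periodicity and the cell equation are used afterwards.\<close>

definition "second_corrector i m = (SOME W. cell_solution (\<lambda>z. eff_matrix P0 B h $ i $ m - \<Phi> i m z) W)"

definition "jump_corrector j = (SOME Q. cell_solution (\<lambda>z. jump_coeff ell V B xs 0 j - mass z j) Q)"

lemma second_corrector: "cell_solution (\<lambda>z. eff_matrix P0 B h $ i $ m - \<Phi> i m z) (second_corrector i m)"
proof -
  have "\<exists>q. cell_solution (\<lambda>z. eff_matrix P0 B h $ i $ m - \<Phi> i m z) q"
    by (rule cell_problem_solvable) (simp_all add: \<Phi>_rep sum_subtractf eff_matrix_eq)
  then show ?thesis unfolding second_corrector_def by (rule someI_ex)
qed

lemma jump_corrector:
  assumes "j \<in> {1..M}"
  shows "cell_solution (\<lambda>z. jump_coeff ell V B xs 0 j - mass z j) (jump_corrector j)"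
proof -
  have "card B > 0" using finite_AB torus_split by (simp add: card_gt_0_iff)
  then have "\<exists>q. cell_solution (\<lambda>z. jump_coeff ell V B xs 0 j - mass z j) q"
    by (intro cell_problem_solvable) (simp_all add: mass_rep sum_subtractf jump_coeff_0[OF assms])
  then show ?thesis unfolding jump_corrector_def by (rule someI_ex)
qed

end

locale corrected_function =
  walk_with_corrector ell P0 V c1 A B M xs h + smooth_function "\<lambda>x. apply_bcontfun F (x, 0)"
  for ell :: "'d::finite \<Rightarrow> nat" and P0 V :: "'d kernel" and c1 A B M xs h
    and F :: "((real ^ 'd) \<times> nat) \<Rightarrow>\<^sub>C real" +
  assumes F_C0E: "F \<in> C0E M"
begin

abbreviation "f k x \<equiv> apply_bcontfun F (x, k)"

text \<open>The fast variable \<open>z\<close> and the slow variable \<open>x\<close> are separate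
  arguments, so that an increment splits into a slow part, which is an error, and a fast part, which
  the cell equations evaluate.\<close>

definition "second_order z x = (\<Sum>i\<in>UNIV. \<Sum>m\<in>UNIV. second_corrector i m z * DD i m x) + (\<Sum>j\<in>{1..M}. jump_corrector j z * (f j x - f 0 x))"

definition "correction \<epsilon> z = (if label z = 0
  then \<epsilon> * (\<Sum>m\<in>UNIV. H z $ m * D m (\<epsilon> *\<^sub>R ivec z)) + \<epsilon>\<^sup>2 * second_order z (\<epsilon> *\<^sub>R ivec z) else 0)"

definition "corrected \<epsilon> z = f (label z) (\<epsilon> *\<^sub>R ivec z) + correction \<epsilon> z"

text \<open>Remainders are defined as exact differences, so that the expansion of a step is an
  identity and all estimates are made separately.\<close>

definition "rem_f \<xi> \<epsilon> z = (f 0 (\<epsilon> *\<^sub>R ivec z + \<epsilon> *\<^sub>R ivec \<xi>) - f 0 (\<epsilon> *\<^sub>R ivec z)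
     - (\<Sum>m\<in>UNIV. (\<epsilon> *\<^sub>R ivec \<xi>) $ m * D m (\<epsilon> *\<^sub>R ivec z))
     - 1/2 * (\<Sum>i\<in>UNIV. \<Sum>m\<in>UNIV. (\<epsilon> *\<^sub>R ivec \<xi>) $ i * (\<epsilon> *\<^sub>R ivec \<xi>) $ m * DD i m (\<epsilon> *\<^sub>R ivec z))) / \<epsilon>\<^sup>2"

definition "rem_D \<xi> m \<epsilon> z = (D m (\<epsilon> *\<^sub>R ivec z + \<epsilon> *\<^sub>R ivec \<xi>) - D m (\<epsilon> *\<^sub>R ivec z)
     - (\<Sum>i\<in>UNIV. (\<epsilon> *\<^sub>R ivec \<xi>) $ i * DD i m (\<epsilon> *\<^sub>R ivec z))) / \<epsilon>"

definition "remainder \<xi> \<epsilon> z = rem_f \<xi> \<epsilon> z + (\<Sum>m\<in>UNIV. H (z + \<xi>) $ m * rem_D \<xi> m \<epsilon> z)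
     + (second_order (z + \<xi>) (\<epsilon> *\<^sub>R ivec z + \<epsilon> *\<^sub>R ivec \<xi>) - second_order (z + \<xi>) (\<epsilon> *\<^sub>R ivec z))"

definition "total_error \<epsilon> z = (if label z = 0 then \<Sum>\<xi>\<in>steps. P0 z (z + \<xi>) * remainder \<xi> \<epsilon> z else 0)
     + (\<Sum>\<xi>\<in>steps. V z (z + \<xi>) * (corrected \<epsilon> (z + \<xi>) - f (label (z + \<xi>)) (\<epsilon> *\<^sub>R ivec z)))"

lemma unif_bounded_periodic:
  assumes "\<And>z. q (rep z) = q z"
  shows "unif_bounded (\<lambda>\<epsilon> z. q (z + \<xi>) :: real)"
proof -
  obtain C where "C \<ge> 0" "\<And>z. \<bar>q z\<bar> \<le> C" by (rule periodic_bounded[of q, OF assms]) blast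
  then show ?thesis by (auto simp: unif_bounded_def)
qed

lemma unif_bounded_H: "unif_bounded (\<lambda>\<epsilon> z. H (z + \<xi>) $ m)"
  by (rule unif_bounded_periodic) (simp add: H_periodic)

lemma unif_bounded_W: "unif_bounded (\<lambda>\<epsilon> z. second_corrector i m (z + \<xi>))"
  by (rule unif_bounded_periodic) (use second_corrector in \<open>simp add: cell_solution_def\<close>)

lemma unif_bounded_Q: "j \<in> {1..M} \<Longrightarrow> unif_bounded (\<lambda>\<epsilon> z. jump_corrector j (z + \<xi>))"
  by (rule unif_bounded_periodic) (use jump_corrector[of j] in \<open>simp add: cell_solution_def\<close>)

lemma unif_bounded_P0: "unif_bounded (\<lambda>\<epsilon> z. P0 z (z + \<xi>))"
  using P0_nonneg P0_le_1 by (auto simp: unif_bounded_def intro!: exI[of _ 1])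

lemma unif_bounded_V: "unif_bounded (\<lambda>\<epsilon> z. V z (z + \<xi>))"
proof -
  obtain C where "C \<ge> 0" "\<And>x y. \<bar>V x y\<bar> \<le> C" by (rule V_bounded) blast
  then show ?thesis by (auto simp: unif_bounded_def)
qed

lemma unif_bounded_f: "unif_bounded (\<lambda>\<epsilon> z. f k (\<epsilon> *\<^sub>R ivec z))"
  and unif_bounded_D: "unif_bounded (\<lambda>\<epsilon> z. D m (\<epsilon> *\<^sub>R ivec z))"
  and unif_bounded_DD: "unif_bounded (\<lambda>\<epsilon> z. DD i m (\<epsilon> *\<^sub>R ivec z))"
  by (rule unif_bounded_range, rule bcontfun_component_bounded bounded_D bounded_DD)+

lemma unif_bounded_second_order: "unif_bounded (\<lambda>\<epsilon> z. second_order z (\<epsilon> *\<^sub>R ivec z))"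
  unfolding second_order_def
  using unif_bounded_W[where \<xi> = 0] unif_bounded_Q[where \<xi> = 0]
  by (intro unif_bounded_add unif_bounded_sum unif_bounded_mult unif_bounded_minus
      unif_bounded_DD unif_bounded_f) simp_all

lemma negligible_correction: "negligible correction"
proof -
  have "negligible (\<lambda>\<epsilon> z. \<epsilon> * (\<Sum>m\<in>UNIV. H z $ m * D m (\<epsilon> *\<^sub>R ivec z)) + \<epsilon>\<^sup>2 * second_order z (\<epsilon> *\<^sub>R ivec z))"
    using unif_bounded_H[where \<xi> = 0]
    by (intro negligible_add negligible_mult_right negligible_id negligible_square
        unif_bounded_second_order unif_bounded_sum unif_bounded_mult unif_bounded_D) simp_all
  then show ?thesis unfolding correction_def[abs_def] by (rule negligible_if)
qed

lemma negligible_remainder: "negligible (remainder \<xi>)"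
proof -
  \<comment> \<open>Bounded periodic coefficients times increments to which
    \<open>negligible_shift\<close> applies; \<open>(- 1) *\<close> turns a difference into a sum
    for \<open>negligible_add\<close>.\<close>
  have diff: "second_order (z + \<xi>) y - second_order (z + \<xi>) x =
      (\<Sum>i\<in>UNIV. \<Sum>m\<in>UNIV. second_corrector i m (z + \<xi>) * (DD i m y - DD i m x)) +
      (\<Sum>j\<in>{1..M}. jump_corrector j (z + \<xi>) * ((f j y - f j x) + (- 1) * (f 0 y - f 0 x)))" for z x y
    unfolding second_order_def add_diff_add sum_subtractf[symmetric]
    by (intro arg_cong2[of _ _ _ _ "(+)"] sum.cong refl) (simp_all add: algebra_simps)
  have "negligible (\<lambda>\<epsilon> z. second_order (z + \<xi>) (\<epsilon> *\<^sub>R ivec z + \<epsilon> *\<^sub>R ivec \<xi>) - second_order (z + \<xi>) (\<epsilon> *\<^sub>R ivec z))"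
    unfolding diff
    by (intro negligible_add negligible_sum negligible_mult unif_bounded_W unif_bounded_Q unif_bounded_const
        negligible_shift uniformly_continuous_DD C0E_component[OF F_C0E])
  then show ?thesis
    unfolding remainder_def[abs_def] rem_f_def rem_D_def
    by (intro negligible_add negligible_sum negligible_mult unif_bounded_H negligible_taylor_f negligible_taylor_D)
qed

lemma negligible_total_error: "negligible total_error"
proof -
  have "corrected \<epsilon> (z + \<xi>) - f (label (z + \<xi>)) (\<epsilon> *\<^sub>R ivec z) = correction \<epsilon> (z + \<xi>) +
      (f (label (z + \<xi>)) (\<epsilon> *\<^sub>R ivec z + \<epsilon> *\<^sub>R ivec \<xi>) - f (label (z + \<xi>)) (\<epsilon> *\<^sub>R ivec z))" for \<epsilon> z \<xi>
    by (simp add: corrected_def ivec_add scaleR_add_right)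
  moreover have "negligible (\<lambda>\<epsilon> z. f (label (z + \<xi>)) (\<epsilon> *\<^sub>R ivec z + \<epsilon> *\<^sub>R ivec \<xi>) - f (label (z + \<xi>)) (\<epsilon> *\<^sub>R ivec z))" for \<xi>
    by (rule negligible_select[of "{0..M}" "\<lambda>z. label (z + \<xi>)"
          "\<lambda>k \<epsilon> z. f k (\<epsilon> *\<^sub>R ivec z + \<epsilon> *\<^sub>R ivec \<xi>) - f k (\<epsilon> *\<^sub>R ivec z)"])
      (auto intro: negligible_shift C0E_component[OF F_C0E] simp: label_le)
  ultimately show ?thesis
    unfolding total_error_def[abs_def]
    by (simp only:) (intro negligible_add negligible_sum negligible_mult negligible_if unif_bounded_P0 unif_bounded_V
        negligible_remainder negligible_reindex[OF negligible_correction])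
qed

text \<open>The factor \<open>P0 z (z + \<xi>)\<close> is kept because a jump of positive weight
  stays in B, where both ends have the corrected form. The terms are the error, the order
  \<open>1 / \<epsilon>\<close>, the local second order term, and the increments of the two
  correctors in the fast variable.\<close>

lemma step_expansion:
  assumes "label z = 0" "\<epsilon> > 0" and x_def: "x = \<epsilon> *\<^sub>R ivec z"
  shows "P0 z (z + \<xi>) * ((corrected \<epsilon> (z + \<xi>) - corrected \<epsilon> z) / \<epsilon>\<^sup>2) =
    P0 z (z + \<xi>) * remainder \<xi> \<epsilon> z
    + 1 / \<epsilon> * (\<Sum>m\<in>UNIV. D m x * (P0 z (z + \<xi>) * (ivec \<xi> $ m + H (z + \<xi>) $ m - H z $ m)))
    + (\<Sum>i\<in>UNIV. \<Sum>m\<in>UNIV. DD i m x *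
        (P0 z (z + \<xi>) * (1/2 * ivec \<xi> $ i * ivec \<xi> $ m + ivec \<xi> $ i * H (z + \<xi>) $ m)))
    + ((\<Sum>i\<in>UNIV. \<Sum>m\<in>UNIV. DD i m x * (P0 z (z + \<xi>) * (second_corrector i m (z + \<xi>) - second_corrector i m z)))
    + (\<Sum>j\<in>{1..M}. (f j x - f 0 x) * (P0 z (z + \<xi>) * (jump_corrector j (z + \<xi>) - jump_corrector j z))))"
proof (cases "P0 z (z + \<xi>) = 0")
  case False
  let ?p = "P0 z (z + \<xi>)"
  define y where "y = x + \<epsilon> *\<^sub>R ivec \<xi>"
  have y: "\<epsilon> *\<^sub>R ivec (z + \<xi>) = y" by (simp add: y_def x_def ivec_add scaleR_add_right)
  have l: "label (z + \<xi>) = 0" using P0_neq_0_label[OF False] assms by simp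
  define s where "s = (\<Sum>m\<in>UNIV. ivec \<xi> $ m * D m x)"
  define s2 where "s2 = (\<Sum>i\<in>UNIV. \<Sum>m\<in>UNIV. ivec \<xi> $ i * ivec \<xi> $ m * DD i m x)"
  define t where "t m = (\<Sum>i\<in>UNIV. ivec \<xi> $ i * DD i m x)" for m
  define hy where "hy = (\<Sum>m\<in>UNIV. H (z + \<xi>) $ m * D m y)"
  define hx where "hx = (\<Sum>m\<in>UNIV. H (z + \<xi>) $ m * D m x)"
  define h0 where "h0 = (\<Sum>m\<in>UNIV. H z $ m * D m x)"
  define ht where "ht = (\<Sum>m\<in>UNIV. H (z + \<xi>) $ m * t m)"
  have r1: "rem_f \<xi> \<epsilon> z = (f 0 y - f 0 x - \<epsilon> * s - 1/2 * (\<epsilon>\<^sup>2 * s2)) / \<epsilon>\<^sup>2"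
    unfolding rem_f_def x_def[symmetric] y_def[symmetric] s_def s2_def
    by (simp add: sum_distrib_left power2_eq_square mult_ac)
  have r2: "rem_D \<xi> m \<epsilon> z = (D m y - D m x - \<epsilon> * t m) / \<epsilon>" for m
    unfolding rem_D_def x_def[symmetric] y_def[symmetric] t_def
    by (simp add: sum_distrib_left mult_ac)
  have r3: "(\<Sum>m\<in>UNIV. H (z + \<xi>) $ m * rem_D \<xi> m \<epsilon> z) = (hy - hx - \<epsilon> * ht) / \<epsilon>"
    unfolding r2 hy_def hx_def ht_def
    by (simp add: sum_distrib_left sum_subtractf[symmetric] sum_divide_distrib algebra_simps)
  have c: "corrected \<epsilon> (z + \<xi>) = f 0 y + \<epsilon> * hy + \<epsilon>\<^sup>2 * second_order (z + \<xi>) y"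
    "corrected \<epsilon> z = f 0 x + \<epsilon> * h0 + \<epsilon>\<^sup>2 * second_order z x"
    using l assms by (simp_all add: corrected_def correction_def y hy_def h0_def flip: x_def)
  have "(corrected \<epsilon> (z + \<xi>) - corrected \<epsilon> z) / \<epsilon>\<^sup>2 =
      (f 0 y - f 0 x - \<epsilon> * s - 1/2 * (\<epsilon>\<^sup>2 * s2)) / \<epsilon>\<^sup>2 + (hy - hx - \<epsilon> * ht) / \<epsilon>
      + (second_order (z + \<xi>) y - second_order (z + \<xi>) x)
      + 1 / \<epsilon> * (s + hx - h0) + (1/2 * s2 + ht) + (second_order (z + \<xi>) x - second_order z x)"
    unfolding c using assms(2) by (simp add: field_simps power2_eq_square)
  also have "\<dots> = remainder \<xi> \<epsilon> z + 1 / \<epsilon> * (s + hx - h0) + (1/2 * s2 + ht)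
      + (second_order (z + \<xi>) x - second_order z x)"
    unfolding remainder_def r1 r3 x_def[symmetric] y_def[symmetric] ..
  finally have eq: "(corrected \<epsilon> (z + \<xi>) - corrected \<epsilon> z) / \<epsilon>\<^sup>2 =
      remainder \<xi> \<epsilon> z + 1 / \<epsilon> * (s + hx - h0) + (1/2 * s2 + ht) + (second_order (z + \<xi>) x - second_order z x)" .
  have e1: "(\<Sum>m\<in>UNIV. D m x * (?p * (ivec \<xi> $ m + H (z + \<xi>) $ m - H z $ m))) = ?p * (s + hx - h0)"
    unfolding s_def hx_def h0_def
    by (simp add: sum_distrib_left sum.distrib[symmetric] sum_subtractf[symmetric] algebra_simps)
  have "ht = (\<Sum>i\<in>UNIV. \<Sum>m\<in>UNIV. ivec \<xi> $ i * H (z + \<xi>) $ m * DD i m x)"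
    unfolding ht_def t_def sum_distrib_left by (subst sum.swap) (simp add: mult_ac)
  then have e2: "(\<Sum>i\<in>UNIV. \<Sum>m\<in>UNIV. DD i m x * (?p * (1/2 * ivec \<xi> $ i * ivec \<xi> $ m + ivec \<xi> $ i * H (z + \<xi>) $ m)))
      = ?p * (1/2 * s2 + ht)"
    unfolding s2_def by (simp add: sum_distrib_left sum.distrib[symmetric] algebra_simps)
  have e3: "(\<Sum>i\<in>UNIV. \<Sum>m\<in>UNIV. DD i m x * (?p * (second_corrector i m (z + \<xi>) - second_corrector i m z)))
    + (\<Sum>j\<in>{1..M}. (f j x - f 0 x) * (?p * (jump_corrector j (z + \<xi>) - jump_corrector j z))) = ?p * (second_order (z + \<xi>) x - second_order z x)"
  proof -
    have "second_order (z + \<xi>) x - second_order z x = (\<Sum>i\<in>UNIV. \<Sum>m\<in>UNIV. DD i m x * (second_corrector i m (z + \<xi>) - second_corrector i m z))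
      + (\<Sum>j\<in>{1..M}. (f j x - f 0 x) * (jump_corrector j (z + \<xi>) - jump_corrector j z))"
      by (simp add: second_order_def right_diff_distrib sum_subtractf mult.commute)
    then show ?thesis by (simp add: distrib_left sum_distrib_left mult_ac)
  qed
  show ?thesis unfolding eq e1 e2 e3 by (simp add: distrib_left)
qed simp

text \<open>The cell equation for \<open>second_corrector\<close> replaces the local \<Phi> by
  \<Theta>. The one for \<open>jump_corrector\<close> adds the mean rate and subtracts the local
  one, which the \<open>V\<close>-part will cancel.\<close>

lemma sum_step_expansion:
  assumes "label z = 0" "\<epsilon> > 0" and x_def: "x = \<epsilon> *\<^sub>R ivec z"
  shows "(\<Sum>\<xi>\<in>steps. P0 z (z + \<xi>) * ((corrected \<epsilon> (z + \<xi>) - corrected \<epsilon> z) / \<epsilon>\<^sup>2)) =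
    (\<Sum>\<xi>\<in>steps. P0 z (z + \<xi>) * remainder \<xi> \<epsilon> z)
    + (\<Sum>i\<in>UNIV. \<Sum>m\<in>UNIV. eff_matrix P0 B h $ i $ m * DD i m x)
    + (\<Sum>j\<in>{1..M}. (jump_coeff ell V B xs 0 j - mass z j) * (f j x - f 0 x))"
proof -
  have W_eq: "(\<Sum>\<xi>\<in>steps. P0 z (z + \<xi>) * (second_corrector i m (z + \<xi>) - second_corrector i m z))
      = eff_matrix P0 B h $ i $ m - \<Phi> i m z" for i m
    using second_corrector[of i m] assms(1) by (simp add: cell_solution_def)
  have Q_eq: "(\<Sum>\<xi>\<in>steps. P0 z (z + \<xi>) * (jump_corrector j (z + \<xi>) - jump_corrector j z))
      = jump_coeff ell V B xs 0 j - mass z j" if "j \<in> {1..M}" for j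
    using jump_corrector[OF that] assms(1) by (simp add: cell_solution_def)
  have 1: "(\<Sum>\<xi>\<in>steps. 1 / \<epsilon> * (\<Sum>m\<in>UNIV. D m x * (P0 z (z + \<xi>) * (ivec \<xi> $ m + H (z + \<xi>) $ m - H z $ m)))) = 0"
    unfolding sum_distrib_left[symmetric] sum_swap_left by (simp only: first_order_cancels[OF assms(1)]) simp
  have 2: "(\<Sum>\<xi>\<in>steps. \<Sum>i\<in>UNIV. \<Sum>m\<in>UNIV. DD i m x *
        (P0 z (z + \<xi>) * (1/2 * ivec \<xi> $ i * ivec \<xi> $ m + ivec \<xi> $ i * H (z + \<xi>) $ m)))
      = (\<Sum>i\<in>UNIV. \<Sum>m\<in>UNIV. DD i m x * \<Phi> i m z)"
    unfolding sum_swap_left2 \<Phi>_def ..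
  have 3: "(\<Sum>\<xi>\<in>steps. \<Sum>i\<in>UNIV. \<Sum>m\<in>UNIV. DD i m x * (P0 z (z + \<xi>) * (second_corrector i m (z + \<xi>) - second_corrector i m z)))
      = (\<Sum>i\<in>UNIV. \<Sum>m\<in>UNIV. eff_matrix P0 B h $ i $ m * DD i m x) - (\<Sum>i\<in>UNIV. \<Sum>m\<in>UNIV. DD i m x * \<Phi> i m z)"
    unfolding sum_swap_left2 W_eq sum_subtractf[symmetric]
    by (intro sum.cong refl) (simp add: right_diff_distrib mult.commute)
  have 4: "(\<Sum>\<xi>\<in>steps. \<Sum>j\<in>{1..M}. (f j x - f 0 x) * (P0 z (z + \<xi>) * (jump_corrector j (z + \<xi>) - jump_corrector j z)))
      = (\<Sum>j\<in>{1..M}. (jump_coeff ell V B xs 0 j - mass z j) * (f j x - f 0 x))"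
    unfolding sum_swap_left by (intro sum.cong refl) (simp only: Q_eq mult.commute)
  show ?thesis
    unfolding step_expansion[OF assms] sum.distrib 1 2 3 4 by simp
qed

text \<open>Exact at every positive \<epsilon>, so consistency reduces to
  \<open>negligible_total_error\<close>.\<close>

lemma corrected_generator:
  assumes \<epsilon>: "\<epsilon> > 0"
  shows "((\<Sum>\<xi>\<in>steps. perturbed P0 V \<epsilon> z (z + \<xi>) * corrected \<epsilon> (z + \<xi>)) - corrected \<epsilon> z) / \<epsilon>\<^sup>2
    = limit_expr ell P0 V B M xs h (apply_bcontfun F) (\<epsilon> *\<^sub>R ivec z, label z) + total_error \<epsilon> z"
proof -
  define x where "x = \<epsilon> *\<^sub>R ivec z"
  let ?P = "\<Sum>\<xi>\<in>steps. P0 z (z + \<xi>) * ((corrected \<epsilon> (z + \<xi>) - corrected \<epsilon> z) / \<epsilon>\<^sup>2)"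
  let ?E = "\<Sum>\<xi>\<in>steps. V z (z + \<xi>) * (corrected \<epsilon> (z + \<xi>) - f (label (z + \<xi>)) x)"
  let ?J = "\<Sum>j\<in>{0..M} - {label z}. mass z j * (f j x - f (label z) x)"
  have "(\<Sum>\<xi>\<in>steps. P0 z (z + \<xi>) * (corrected \<epsilon> (z + \<xi>) - corrected \<epsilon> z))
      = (\<Sum>\<xi>\<in>steps. P0 z (z + \<xi>) * corrected \<epsilon> (z + \<xi>)) - corrected \<epsilon> z"
    using P0_sum_mult[of z "corrected \<epsilon> z"] by (simp add: right_diff_distrib sum_subtractf)
  then have "((\<Sum>\<xi>\<in>steps. perturbed P0 V \<epsilon> z (z + \<xi>) * corrected \<epsilon> (z + \<xi>)) - corrected \<epsilon> z)
      = (\<Sum>\<xi>\<in>steps. P0 z (z + \<xi>) * (corrected \<epsilon> (z + \<xi>) - corrected \<epsilon> z))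
        + \<epsilon>\<^sup>2 * (\<Sum>\<xi>\<in>steps. V z (z + \<xi>) * corrected \<epsilon> (z + \<xi>))"
    by (simp add: perturbed_def distrib_right sum.distrib sum_distrib_left mult.assoc)
  then have "((\<Sum>\<xi>\<in>steps. perturbed P0 V \<epsilon> z (z + \<xi>) * corrected \<epsilon> (z + \<xi>)) - corrected \<epsilon> z) / \<epsilon>\<^sup>2
      = ?P + (\<Sum>\<xi>\<in>steps. V z (z + \<xi>) * corrected \<epsilon> (z + \<xi>))"
    using \<epsilon> by (simp add: add_divide_distrib sum_divide_distrib)
  \<comment> \<open>The slow variable is frozen at \<open>x\<close>; what is lost goes into
    \<open>?E\<close>, and \<open>?J\<close> depends on the neighbours through their labels
    only.\<close>
  also have "(\<Sum>\<xi>\<in>steps. V z (z + \<xi>) * corrected \<epsilon> (z + \<xi>)) = ?E + ?J"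
    using sum_V_jumps[of z "\<lambda>k. f k x"] by (simp add: right_diff_distrib sum_subtractf)
  also have "?P + (?E + ?J) = limit_expr ell P0 V B M xs h (apply_bcontfun F) (x, label z) + total_error \<epsilon> z"
  proof (cases "label z = 0")
    case True
    have "{0..M} - {0} = {1..M}" by auto
    then show ?thesis
      using sum_step_expansion[OF True \<epsilon> x_def] True
      by (simp add: limit_expr_eq total_error_def left_diff_distrib sum_subtractf flip: x_def)
  next
    case False
    \<comment> \<open>From a site over A the unperturbed walk can only stay put, and then the
      increment is zero.\<close>
    have "P0 z (z + \<xi>) * ((corrected \<epsilon> (z + \<xi>) - corrected \<epsilon> z) / \<epsilon>\<^sup>2) = 0" for \<xi>
    proof (cases "\<xi> = 0")
      case nonzero: False
      have "P0 z (z + \<xi>) = 0"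
      proof (cases "label (z + \<xi>) = label z")
        case True
        then show ?thesis
          using P0_A_off[of z "z + \<xi>"] nonzero False label_neq_0_iff[of z] label_neq_0_iff[of "z + \<xi>"]
          by (simp add: periodic_ext_iff subset_torus)
      qed (simp add: P0_label_neq_eq_0)
      then show ?thesis by simp
    qed simp
    then have "?P = 0" by (intro sum.neutral ballI)
    moreover have "?J = (\<Sum>j\<in>{0..M} - {label z}. jump_coeff ell V B xs (label z) j * (f j x - f (label z) x))"
      by (intro sum.cong refl) (simp add: jump_coeff_eq_mass[OF False])
    ultimately show ?thesis
      using False by (simp add: limit_expr_eq label_le total_error_def flip: x_def)
  qed
  finally show ?thesis by (simp add: x_def)
qed

end

subsection \<open>Convergence of the walk\<close>

text \<open>Completeness of the space of bounded continuous functions is available in the library only over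
  metric domains; the discrete metric makes \<^typ>\<open>(real ^ 'd) \<times> nat\<close> one.\<close>

instantiation nat :: metric_space
begin

definition dist_nat :: "nat \<Rightarrow> nat \<Rightarrow> real" where
  "dist_nat m n = (if m = n then 0 else 1)"

definition uniformity_nat :: "(nat \<times> nat) filter" where
  "uniformity_nat = (INF e\<in>{0 <..}. principal {(x, y). dist x y < e})"

instance
proof
  have "\<forall>\<^sub>F p in (uniformity :: (nat \<times> nat) filter). fst p = snd p"
    unfolding uniformity_nat_def
    by (rule eventually_INF1[of 1]) (auto simp: eventually_principal dist_nat_def split: if_splits)
  then have "\<forall>\<^sub>F (x', y) in uniformity. x' = x \<longrightarrow> y \<in> U" if "x \<in> U" for x :: nat and U
    by (rule eventually_mono) (use that in auto)
  then show "open U \<longleftrightarrow> (\<forall>x\<in>U. \<forall>\<^sub>F (x', y) in uniformity. x' = x \<longrightarrow> y \<in> U)" for U :: "nat set"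
    by (simp add: open_discrete)
qed (auto simp: dist_nat_def uniformity_nat_def split: if_splits)

end

instance bcontfun :: (metric_space, banach) banach ..

text \<open>Integer vectors form a discrete space, so bounded continuous functions on them are all
  bounded functions with the sup norm.\<close>

lemma continuous_on_int_vec:
  fixes g :: "int ^ 'd::finite \<Rightarrow> 'b::topological_space"
  shows "continuous_on S g"
proof -
  have "open {x}" for x :: "int ^ 'd"
    unfolding open_vec_def
    by (intro ballI exI[of _ "\<lambda>i. {x $ i}"]) (auto simp: open_discrete vec_eq_iff)
  then have "at x within S = bot" for x :: "int ^ 'd"
    using at_le[of S UNIV x] by (simp add: at_eq_bot_iff[symmetric] bot_unique)
  then show ?thesis by (simp add: continuous_on_def)
qed

lemma apply_Bcontfun_int_vec:
  fixes g :: "int ^ 'd::finite \<Rightarrow> real"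
  assumes "bounded (range g)"
  shows "apply_bcontfun (Bcontfun g) = g"
  using assms continuous_on_int_vec by (intro Bcontfun_inverse) (auto simp: bcontfun_def)

lemma norm_apply_le: "\<bar>apply_bcontfun F x :: real\<bar> \<le> norm F"
  using norm_bounded[of F x] by simp

lemma negligible_cong:
  assumes "negligible a" "\<forall>\<^sub>F \<epsilon> in at_right 0. \<forall>z. b \<epsilon> z = a \<epsilon> z"
  shows "negligible b"
  unfolding negligible_def
proof (intro allI impI)
  fix \<eta> :: real assume "\<eta> > 0"
  then have "\<forall>\<^sub>F \<epsilon> in at_right 0. \<forall>z. \<bar>a \<epsilon> z\<bar> \<le> \<eta>" using assms(1) by (simp add: negligible_def)
  with assms(2) show "\<forall>\<^sub>F \<epsilon> in at_right 0. \<forall>z. \<bar>b \<epsilon> z\<bar> \<le> \<eta>"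
    by eventually_elim simp
qed

lemma negligible_norm_tendsto:
  fixes w :: "real \<Rightarrow> 'z::topological_space \<Rightarrow>\<^sub>C real"
  assumes "negligible (\<lambda>\<epsilon>. apply_bcontfun (w \<epsilon>))"
  shows "(w \<longlongrightarrow> 0) (at_right 0)"
proof (rule tendstoI)
  fix e :: real assume "e > 0"
  then have "e / 2 > 0" by simp
  then have "\<forall>\<^sub>F \<epsilon> in at_right 0. \<forall>z. \<bar>apply_bcontfun (w \<epsilon>) z\<bar> \<le> e / 2"
    using assms unfolding negligible_def by blast
  then show "\<forall>\<^sub>F \<epsilon> in at_right 0. dist (w \<epsilon>) 0 < e"
  proof eventually_elim
    case (elim \<epsilon>)
    then have "norm (w \<epsilon>) \<le> e / 2" by (intro norm_bound) simp
    then show ?case using \<open>e > 0\<close> by simp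
  qed
qed

lemma subspace_C0E: "subspace (C0E M)"
  unfolding subspace_def C0E_def by (auto intro: tendsto_add_zero tendsto_mult_right_zero)

text \<open>Vanishing at infinity and vanishing beyond phase \<open>M\<close> both survive uniform
  limits.\<close>

lemma closed_C0E: "closed (C0E M)"
proof (rule closed_closure[of "C0E M", THEN back_subst[of closed]], rule equalityI[OF subsetI closure_subset])
  fix F assume F: "F \<in> closure (C0E M)"
  have approx: "\<exists>F'\<in>C0E M. \<forall>y. \<bar>apply_bcontfun F y - apply_bcontfun F' y\<bar> < e" if e: "e > 0" for e
  proof -
    obtain F' where F': "F' \<in> C0E M" "dist F' F < e"
      using F e unfolding closure_approachable by blast
    then have "\<bar>apply_bcontfun F y - apply_bcontfun F' y\<bar> < e" for y
      using dist_bounded[of F' y F] by (simp add: dist_real_def abs_minus_commute)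
    with F' show ?thesis by blast
  qed
  have "((\<lambda>x. apply_bcontfun F (x, k)) \<longlongrightarrow> 0) at_infinity" if k: "k \<le> M" for k
  proof (rule tendstoI)
    fix e :: real assume "e > 0"
    then have e: "e / 2 > 0" by simp
    obtain F' where F': "F' \<in> C0E M" "\<forall>y. \<bar>apply_bcontfun F y - apply_bcontfun F' y\<bar> < e / 2"
      using approx[OF e] by blast
    then have "((\<lambda>x. apply_bcontfun F' (x, k)) \<longlongrightarrow> 0) at_infinity" using k by (simp add: C0E_def)
    from tendstoD[OF this e] show "\<forall>\<^sub>F x in at_infinity. dist (apply_bcontfun F (x, k)) 0 < e"
    proof eventually_elim
      case (elim x)
      then show ?case using F'(2)[rule_format, of "(x, k)"] unfolding dist_real_def by linarith
    qed
  qed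
  moreover have "apply_bcontfun F (x, k) = 0" if k: "k > M" for k x
  proof (rule ccontr)
    assume "apply_bcontfun F (x, k) \<noteq> 0"
    then obtain F' where "F' \<in> C0E M" "\<bar>apply_bcontfun F (x, k) - apply_bcontfun F' (x, k)\<bar> < \<bar>apply_bcontfun F (x, k)\<bar>"
      using approx[of "\<bar>apply_bcontfun F (x, k)\<bar>"] by auto
    then show False using k by (simp add: C0E_def)
  qed
  ultimately show "F \<in> C0E M" by (simp add: C0E_def)
qed

section \<open>The walk on the unscaled lattice\<close>

context high_contrast_walk
begin

definition step_op :: "real \<Rightarrow> ((int ^ 'd) \<Rightarrow>\<^sub>C real) \<Rightarrow> ((int ^ 'd) \<Rightarrow>\<^sub>C real)" where
  "step_op \<epsilon> u = Bcontfun (\<lambda>z. \<Sum>\<xi>\<in>steps. perturbed P0 V \<epsilon> z (z + \<xi>) * apply_bcontfun u (z + \<xi>))"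

definition sample :: "real \<Rightarrow> (((real ^ 'd) \<times> nat) \<Rightarrow>\<^sub>C real) \<Rightarrow> ((int ^ 'd) \<Rightarrow>\<^sub>C real)" where
  "sample \<epsilon> F = Bcontfun (\<lambda>z. apply_bcontfun F (\<epsilon> *\<^sub>R ivec z, label z))"

text \<open>Bounded entries and finitely many jumps keep the image bounded for every \<epsilon>, so
  \<open>Bcontfun\<close> acts as the identity here.\<close>

lemma apply_step_op:
  "apply_bcontfun (step_op \<epsilon> u) z = (\<Sum>\<xi>\<in>steps. perturbed P0 V \<epsilon> z (z + \<xi>) * apply_bcontfun u (z + \<xi>))"
proof -
  obtain C where C: "C \<ge> 0" "\<And>x y. \<bar>V x y\<bar> \<le> C" by (rule V_bounded) blast
  have "\<bar>perturbed P0 V \<epsilon> x y\<bar> \<le> 1 + \<epsilon>\<^sup>2 * C" for x y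
  proof -
    have "\<bar>\<epsilon>\<^sup>2 * V x y\<bar> \<le> \<epsilon>\<^sup>2 * C" using C by (simp add: abs_mult mult_left_mono)
    then show ?thesis unfolding perturbed_def using P0_nonneg[of x y] P0_le_1[of x y] by linarith
  qed
  then have "\<bar>\<Sum>\<xi>\<in>steps. perturbed P0 V \<epsilon> z (z + \<xi>) * apply_bcontfun u (z + \<xi>)\<bar>
      \<le> (\<Sum>\<xi>\<in>steps. (1 + \<epsilon>\<^sup>2 * C) * norm u)" for z
    using C norm_apply_le[of u]
    by (intro order_trans[OF sum_abs] sum_mono) (auto simp: abs_mult intro!: mult_mono)
  then have "bounded (range (\<lambda>z. \<Sum>\<xi>\<in>steps. perturbed P0 V \<epsilon> z (z + \<xi>) * apply_bcontfun u (z + \<xi>)))"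
    by (auto simp: bounded_iff)
  then show ?thesis by (simp add: step_op_def apply_Bcontfun_int_vec)
qed

lemma apply_sample: "apply_bcontfun (sample \<epsilon> F) z = apply_bcontfun F (\<epsilon> *\<^sub>R ivec z, label z)"
proof -
  have "bounded (range (\<lambda>z. apply_bcontfun F (\<epsilon> *\<^sub>R ivec z, label z)))"
    using norm_bounded[of F] by (auto simp: bounded_iff)
  then show ?thesis by (simp add: sample_def apply_Bcontfun_int_vec)
qed

lemma linear_step_op: "linear (step_op \<epsilon>)"
  by (rule linearI) (auto intro!: bcontfun_eqI simp: apply_step_op distrib_left sum.distrib sum_distrib_left mult_ac)

lemma linear_sample: "linear (sample \<epsilon>)"
  by (rule linearI) (auto intro!: bcontfun_eqI simp: apply_sample)

lemma norm_sample_le: "norm (sample \<epsilon> F) \<le> norm F"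
  by (rule norm_bound) (simp add: apply_sample norm_apply_le)

lemma norm_step_op_le:
  assumes "stochastic_kernel (perturbed P0 V \<epsilon>)"
  shows "norm (step_op \<epsilon> u) \<le> norm u"
proof (rule norm_bound)
  fix z
  have "\<bar>apply_bcontfun (step_op \<epsilon> u) z\<bar> \<le> (\<Sum>\<xi>\<in>steps. perturbed P0 V \<epsilon> z (z + \<xi>) * norm u)"
    unfolding apply_step_op using assms norm_apply_le[of u]
    by (intro order_trans[OF sum_abs] sum_mono) (auto simp: abs_mult stochastic_kernel_def intro!: mult_mono)
  also have "\<dots> = norm u"
    using has_sum_kernel[OF perturbed_range, of \<epsilon> z 1] assms
    by (simp add: stochastic_kernel_def flip: sum_distrib_right)
  finally show "norm (apply_bcontfun (step_op \<epsilon> u) z) \<le> norm u" by simp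
qed

lemma scaled_iff:
  assumes "\<epsilon> > 0"
  shows "\<epsilon> *\<^sub>R ivec z \<in> scaled \<epsilon> S \<longleftrightarrow> z \<in> S"
proof -
  have "\<epsilon> *\<^sub>R ivec y = \<epsilon> *\<^sub>R ivec z \<longleftrightarrow> y = z" for y
    using assms by (simp add: vec_eq_iff)
  then show ?thesis unfolding scaled_def image_iff by metis
qed

lemma phase_eq:
  assumes "\<epsilon> > 0"
  shows "phase ell B M xs \<epsilon> (\<epsilon> *\<^sub>R ivec z) = label z"
proof -
  have "(j \<in> {1..M} \<and> z \<in> periodic_ext ell {xs j}) \<longleftrightarrow> (j \<in> {1..M} \<and> rep z = xs j)" for j
    using xs_in_A[of j] subset_torus(1) periodic_ext_iff[of "{xs j}" z] by auto
  then show ?thesis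
    by (simp add: phase_def scaled_iff[OF assms] label_def periodic_ext_iff subset_torus)
qed

lemma ext_space_eq: "\<epsilon> > 0 \<Longrightarrow> ext_space ell B M xs \<epsilon> = range (\<lambda>z. (\<epsilon> *\<^sub>R ivec z, label z))"
  by (auto simp: ext_space_def scaled_def phase_eq)

lemma transition_op_eq:
  assumes "\<epsilon> > 0"
  shows "transition_op ell P0 V B M xs \<epsilon> g (\<epsilon> *\<^sub>R ivec z, label z)
    = (\<Sum>\<xi>\<in>steps. perturbed P0 V \<epsilon> z (z + \<xi>) * g (\<epsilon> *\<^sub>R ivec (z + \<xi>), label (z + \<xi>)))"
proof -
  have unscale: "unscale \<epsilon> (\<epsilon> *\<^sub>R ivec y) = y" for y :: "int ^ 'd"
    using assms by (simp add: unscale_def vec_eq_iff)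
  have inj: "inj (\<lambda>y :: int ^ 'd. \<epsilon> *\<^sub>R ivec y)"
    using assms by (auto simp: inj_def vec_eq_iff)
  have "(\<epsilon> *\<^sub>R ivec z, label z) \<in> ext_space ell B M xs \<epsilon>"
    using assms by (simp add: ext_space_eq)
  then have "transition_op ell P0 V B M xs \<epsilon> g (\<epsilon> *\<^sub>R ivec z, label z)
    = (\<Sum>\<^sub>\<infinity>x\<in>range (\<lambda>y. \<epsilon> *\<^sub>R ivec y). perturbed P0 V \<epsilon> z (unscale \<epsilon> x) * g (x, phase ell B M xs \<epsilon> x))"
    by (simp add: transition_op_def scaled_def unscale)
  also have "\<dots> = (\<Sum>\<^sub>\<infinity>y\<in>UNIV. perturbed P0 V \<epsilon> z y * g (\<epsilon> *\<^sub>R ivec y, label y))"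
    by (subst infsum_reindex[OF inj]) (simp add: o_def unscale phase_eq[OF assms])
  also have "\<dots> = (\<Sum>\<xi>\<in>steps. perturbed P0 V \<epsilon> z (z + \<xi>) * g (\<epsilon> *\<^sub>R ivec (z + \<xi>), label (z + \<xi>)))"
    by (rule infsum_kernel[OF perturbed_range])
  finally show ?thesis .
qed

lemma proj_eps_eq:
  "\<epsilon> > 0 \<Longrightarrow> proj_eps ell B M xs \<epsilon> F (\<epsilon> *\<^sub>R ivec z, label z) = apply_bcontfun (sample \<epsilon> F) z"
  by (simp add: proj_eps_def ext_space_eq apply_sample)

text \<open>The bijection from lattice points \<open>z\<close> to the extended space conjugates the
  original walk to \<open>step_op\<close>.\<close>

lemma transition_op_funpow_eq:
  assumes "\<epsilon> > 0"
  shows "(transition_op ell P0 V B M xs \<epsilon> ^^ n) (proj_eps ell B M xs \<epsilon> F) (\<epsilon> *\<^sub>R ivec z, label z)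
    = apply_bcontfun ((step_op \<epsilon> ^^ n) (sample \<epsilon> F)) z"
  by (induction n arbitrary: z) (simp_all add: proj_eps_eq transition_op_eq apply_step_op assms)

lemma sup_norm_on_le:
  assumes "\<epsilon> > 0" "\<And>z. g (\<epsilon> *\<^sub>R ivec z, label z) = apply_bcontfun w z"
  shows "\<bar>sup_norm_on (ext_space ell B M xs \<epsilon>) g\<bar> \<le> norm w"
proof -
  have le: "\<bar>g e\<bar> \<le> norm w" if "e \<in> ext_space ell B M xs \<epsilon>" for e
    using that assms norm_apply_le[of w] by (auto simp: ext_space_eq)
  \<comment> \<open>The origin shows that the supremum is over a nonempty set; this is also what
    makes it nonnegative.\<close>
  have e: "(\<epsilon> *\<^sub>R ivec 0, label 0) \<in> ext_space ell B M xs \<epsilon>"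
    using assms by (auto simp: ext_space_eq)
  have "sup_norm_on (ext_space ell B M xs \<epsilon>) g \<le> norm w"
    unfolding sup_norm_on_def using e le by (intro cSUP_least) auto
  moreover have "0 \<le> sup_norm_on (ext_space ell B M xs \<epsilon>) g"
    unfolding sup_norm_on_def by (rule cSUP_upper2[OF bdd_aboveI2 e]) (use le in auto)
  ultimately show ?thesis by simp
qed

end

context walk_with_corrector
begin

lemma limit_op_consistent:
  assumes "(F, G) \<in> limit_op ell P0 V B M xs h"
  shows "\<exists>u. ((\<lambda>\<epsilon>. u \<epsilon> - sample \<epsilon> F) \<longlongrightarrow> 0) (at_right 0) \<and>
    ((\<lambda>\<epsilon>. (1 / \<epsilon>\<^sup>2) *\<^sub>R (step_op \<epsilon> (u \<epsilon>) - u \<epsilon>) - sample \<epsilon> G) \<longlongrightarrow> 0) (at_right 0)"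
proof -
  have F: "F \<in> C0E M" "smooth_compact_support (\<lambda>x. apply_bcontfun F (x, 0))"
    and G: "\<And>x k. k \<le> M \<Longrightarrow> apply_bcontfun G (x, k) = limit_expr ell P0 V B M xs h (apply_bcontfun F) (x, k)"
    using assms by (auto simp: limit_op_def core_def)
  interpret corrected_function ell P0 V c1 A B M xs h F
    by unfold_locales (use F in auto)
  have "\<forall>\<^sub>F \<epsilon> in at_right 0. \<forall>z. \<bar>correction \<epsilon> z\<bar> \<le> 1"
    using negligible_correction by (simp add: negligible_def)
  then have ev: "\<forall>\<^sub>F \<epsilon> in at_right 0. \<epsilon> > 0 \<and> apply_bcontfun (Bcontfun (corrected \<epsilon>)) = corrected \<epsilon>"
    using eventually_at_right_less[of 0]
  proof eventually_elim
    case (elim \<epsilon>)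
    \<comment> \<open>Boundedness is drawn from the smallness of the correction, hence for small
      \<epsilon> only; this justifies \<open>Bcontfun\<close> eventually, which is enough for the
      limits.\<close>
    have "\<bar>corrected \<epsilon> z\<bar> \<le> norm F + 1" for z
      unfolding corrected_def using norm_apply_le[of F "(\<epsilon> *\<^sub>R ivec z, label z)"] elim(1)[rule_format, of z] by linarith
    then have "bounded (range (corrected \<epsilon>))" by (auto simp: bounded_iff)
    then show ?case using elim by (simp add: apply_Bcontfun_int_vec)
  qed
  show ?thesis
  proof (intro exI[of _ "\<lambda>\<epsilon>. Bcontfun (corrected \<epsilon>)"] conjI negligible_norm_tendsto)
    show "negligible (\<lambda>\<epsilon>. apply_bcontfun (Bcontfun (corrected \<epsilon>) - sample \<epsilon> F))"
    proof (rule negligible_cong[OF negligible_correction])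
      from ev show "\<forall>\<^sub>F \<epsilon> in at_right 0. \<forall>z. apply_bcontfun (Bcontfun (corrected \<epsilon>) - sample \<epsilon> F) z = correction \<epsilon> z"
        by eventually_elim (simp add: apply_sample, simp add: corrected_def)
    qed
    show "negligible (\<lambda>\<epsilon>. apply_bcontfun
        ((1 / \<epsilon>\<^sup>2) *\<^sub>R (step_op \<epsilon> (Bcontfun (corrected \<epsilon>)) - Bcontfun (corrected \<epsilon>)) - sample \<epsilon> G))"
    proof (rule negligible_cong[OF negligible_total_error])
      from ev show "\<forall>\<^sub>F \<epsilon> in at_right 0. \<forall>z. apply_bcontfun
          ((1 / \<epsilon>\<^sup>2) *\<^sub>R (step_op \<epsilon> (Bcontfun (corrected \<epsilon>)) - Bcontfun (corrected \<epsilon>)) - sample \<epsilon> G) z = total_error \<epsilon> z"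
      proof eventually_elim
        case (elim \<epsilon>)
        then show ?case
          using corrected_generator[of \<epsilon>] by (simp add: apply_sample apply_step_op G label_le)
      qed
    qed
  qed
qed

end

theorem theorem1:
  fixes ell :: "'d::finite \<Rightarrow> nat"
    and P0 V :: "'d kernel"
    and c1 :: real
    and A B :: "(int ^ 'd) set"
    and M :: nat
    and xs :: "nat \<Rightarrow> int ^ 'd"
    and h :: "int ^ 'd \<Rightarrow> real ^ 'd"
    and T :: "real \<Rightarrow> (((real ^ 'd) \<times> nat) \<Rightarrow>\<^sub>C real) \<Rightarrow> (((real ^ 'd) \<times> nat) \<Rightarrow>\<^sub>C real)"
    and F :: "((real ^ 'd) \<times> nat) \<Rightarrow>\<^sub>C real"
    and t :: real
  assumes "high_contrast_walk ell P0 V c1 A B M xs"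
    and "periodic_corrector ell P0 B h"
    and "contraction_semigroup_on (C0E M) T"
    and "positive_on (C0E M) T"
    and "generator_on (C0E M) T = closure (limit_op ell P0 V B M xs h)"
    and "F \<in> C0E M"
    and "t \<ge> 0"
  shows "((\<lambda>\<epsilon>. sup_norm_on (ext_space ell B M xs \<epsilon>)
            (\<lambda>e. (transition_op ell P0 V B M xs \<epsilon> ^^ nat \<lfloor>t / \<epsilon>\<^sup>2\<rfloor>) (proj_eps ell B M xs \<epsilon> F) e
                 - proj_eps ell B M xs \<epsilon> (T t F) e)) \<longlongrightarrow> 0) (at_right 0)"
proof -
  interpret walk_with_corrector ell P0 V c1 A B M xs h
    using assms(1,2) by (simp add: walk_with_corrector_def walk_with_corrector_axioms_def)
  \<comment> \<open>One step of the walk takes time \<open>\<epsilon>\<^sup>2\<close>.\<close>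
  interpret semigroup_approximation "C0E M" T step_op sample "\<lambda>\<epsilon>. \<epsilon>\<^sup>2" "at_right 0"
    "limit_op ell P0 V B M xs h"
  proof
    show "\<forall>\<^sub>F \<epsilon> in at_right 0. linear (step_op \<epsilon>) \<and> (\<forall>u. norm (step_op \<epsilon> u) \<le> norm u)"
      using perturbed_walk by eventually_elim (simp add: linear_step_op norm_step_op_le)
    show "\<forall>\<^sub>F \<epsilon> in at_right 0. (0::real) < \<epsilon>\<^sup>2"
      using eventually_at_right_less[of 0] by eventually_elim simp
    have "((\<lambda>\<epsilon>::real. \<epsilon>\<^sup>2) \<longlongrightarrow> 0\<^sup>2) (at_right 0)" by (intro tendsto_intros)
    then show "((\<lambda>\<epsilon>::real. \<epsilon>\<^sup>2) \<longlongrightarrow> 0) (at_right 0)" by simp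
  qed (use assms in \<open>auto intro: subspace_C0E closed_C0E norm_sample_le limit_op_consistent
      simp: linear_add[OF linear_sample] linear_cmul[OF linear_sample]\<close>)
  show ?thesis
  proof (rule Lim_null_comparison)
    show "((\<lambda>\<epsilon>. norm ((step_op \<epsilon> ^^ nat \<lfloor>t / \<epsilon>\<^sup>2\<rfloor>) (sample \<epsilon> F) - sample \<epsilon> (T t F))) \<longlongrightarrow> 0) (at_right 0)"
      using convergence[OF assms(6,7)] by (rule tendsto_norm_zero)
    show "\<forall>\<^sub>F \<epsilon> in at_right 0. norm (sup_norm_on (ext_space ell B M xs \<epsilon>)
            (\<lambda>e. (transition_op ell P0 V B M xs \<epsilon> ^^ nat \<lfloor>t / \<epsilon>\<^sup>2\<rfloor>) (proj_eps ell B M xs \<epsilon> F) e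
                 - proj_eps ell B M xs \<epsilon> (T t F) e))
        \<le> norm ((step_op \<epsilon> ^^ nat \<lfloor>t / \<epsilon>\<^sup>2\<rfloor>) (sample \<epsilon> F) - sample \<epsilon> (T t F))"
      using eventually_at_right_less[of 0]
    proof eventually_elim
      case (elim \<epsilon>)
      then show ?case
        unfolding real_norm_def by (intro sup_norm_on_le) (simp_all add: transition_op_funpow_eq proj_eps_eq)
    qed
  qed
qed

end
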